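(* Let $\pmb\lambda$ be a $d$-tuple of partitions of $m$ with $\ell(\lambda^{(i)})\le n$ for all $i$. (i) For odd $d$: $\mathrm{HWV}_{\pmb\lambda}\bigvee(\mathbb C^n)^{\otimes d}=\mathrm{span}\{\Delta_T: T\in B^+(\pmb\lambda')\}$ and $\mathrm{HWV}_{\pmb\lambda}\bigwedge(\mathbb C^n)^{\otimes d}=\mathrm{span}\{\nabla_S:S\in A^+(\pmb\lambda')\}$. (ii) For even $d$: $\mathrm{HWV}_{\pmb\lambda}\bigvee(\mathbb C^n)^{\otimes d}=\mathrm{span}\{\Delta_T:T\in A^+(\pmb\lambda')\}$ and $\mathrm{HWV}_{\pmb\lambda}\bigwedge(\mathbb C^n)^{\otimes d}=\mathrm{span}\{\nabla_S:S\in B^+(\pmb\lambda')\}$.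
   Context: $V=(\mathbb C^n)^{\otimes d}$ with basis $e_{\mathbf i}=e_{i_1}\otimes\cdots\otimes e_{i_d}$, $\mathbf i\in[n]^d$; $\bigvee V$ is the symmetric algebra (polynomial ring in commuting variables $e_{\mathbf i}$), $\bigwedge V$ the exterior algebra; $G=\mathrm{GL}(n,\mathbb C)^{\times d}$ acts factorwise on $V$ and by algebra automorphisms on $\bigvee V,\bigwedge V$. $\mathrm{HWV}_{\pmb\lambda}W$ is the space of vectors of weight $\pmb\lambda$ (for the torus of $d$-tuples of diagonal matrices) fixed by $U(n)^{\times d}$, $U(n)$ upper unitriangular. $\pmb\lambda'$ is the componentwise conjugate. Words/tables: for a sequence $\alpha$ of nonnegative integers with sum $m$, $A(\alpha)$ is the set of words of length $m$ in which letter $i$ occurs $\alpha_i$ times; a word is lattice if every prefix contains at least as many letters $i$ as letters $i+1$, for all $i$. $A(\pmb\alpha)=A(\alpha^{(1)})\times\cdots\times A(\alpha^{(d)})$, viewed as $d\times m$ tables with columns $S(1),\dots,S(m)$; $B(\pmb\alpha)$: tables with pairwise distinct columns; $A^+(\pmb\alpha)$: tables all of whose rows are lattice words; $B^+(\pmb\alpha)=A^+(\pmb\alpha)\cap B(\pmb\alpha)$. $\|T\|=\prod_{\mathbf c}(\#\{j:T(j)=\mathbf c\})!$. $\bigvee e_X=e_{X(1)}\cdots e_{X(m)}$, $\bigwedge e_X=e_{X(1)}\wedge\cdots\wedge e_{X(m)}$. Signs: $(-1)^w=(-1)^{\#\{i<j:w_i>w_j\}}$; $(-1)^T=\prod_i(-1)^{t_i}$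 over rows. For words $s,x$ of length $m$, $\mathrm{sgn}_s(x)=\prod_c\mathrm{sgn}(x_{b_1},\dots,x_{b_k})$ over letters $c$ of $s$ with positions $b_1<\dots<b_k$, where $\mathrm{sgn}(a_1,\dots,a_k)$ is the permutation sign if $(a_1,\dots,a_k)$ is a permutation of $[k]$ and $0$ otherwise; $\mathrm{sgn}_T(X)=\prod_i\mathrm{sgn}_{t_i}(x_i)$. Vectors: for a $d\times m$ table $T$ of positive integers, $\Delta_T=\frac{(-1)^T}{\|T\|}\sum_X\mathrm{sgn}_T(X)\bigvee e_X$ and $\nabla_T=\frac{(-1)^T}{\|T\|}\sum_X\mathrm{sgn}_T(X)\bigwedge e_X$, sums over all $d\times m$ tables $X$ with entries in $[n]$. *)

theory Defs
  imports
    Complex_Main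
    "HOL-Library.Poly_Mapping"
    "HOL-Library.FSet"
    "HOL-Library.List_Lexorder"
    "HOL-Combinatorics.Permutations"
    "Jordan_Normal_Form.Matrix"
begin

section \<open>Complex vector spaces of finitely supported functions\<close>

definition scale :: "complex \<Rightarrow> ('a \<Rightarrow>\<^sub>0 complex) \<Rightarrow> ('a \<Rightarrow>\<^sub>0 complex)" where
  "scale c f = Poly_Mapping.map ((*) c) f"

lemma lookup_scale: "poly_mapping.lookup (scale c f) x = c * poly_mapping.lookup f x"
  by (simp add: scale_def map.rep_eq when_def)

interpretation cvec: vector_space scale
  by unfold_locales (auto intro!: poly_mapping_eqI simp: lookup_scale lookup_add algebra_simps)

section \<open>Partitions, words and tables\<close>

definition is_partition :: "nat \<Rightarrow> nat list \<Rightarrow> bool" where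
  "is_partition m p \<longleftrightarrow> sorted_wrt (\<ge>) p \<and> 0 \<notin> set p \<and> sum_list p = m"

definition conjugate_partition :: "nat list \<Rightarrow> nat list" where
  "conjugate_partition p =
     map (\<lambda>j. length (filter (\<lambda>x. j \<le> x) p)) [1..<Suc (Max (insert 0 (set p)))]"

text \<open>Letters are positive integers, so the multiplicity of the letter \<open>i\<close> is \<open>\<alpha> ! (i - 1)\<close>.
  A table is the list of its rows; \<^const>\<open>List.transpose\<close> gives the list of its columns.\<close>

definition words :: "nat list \<Rightarrow> nat list set" where
  "words \<alpha> = {w. length w = sum_list \<alpha> \<and> set w \<subseteq> {1..length \<alpha>} \<and>
                (\<forall>i\<in>{1..length \<alpha>}. count_list w i = \<alpha> ! (i - 1))}"

definition lattice_word :: "nat list \<Rightarrow> bool" where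
  "lattice_word w \<longleftrightarrow>
     (\<forall>k\<le>length w. \<forall>i\<ge>1. count_list (take k w) (Suc i) \<le> count_list (take k w) i)"

definition tables_A :: "nat list list \<Rightarrow> nat list list set" where
  "tables_A \<alpha>s = {T. length T = length \<alpha>s \<and> (\<forall>k<length \<alpha>s. T ! k \<in> words (\<alpha>s ! k))}"

definition tables_B :: "nat list list \<Rightarrow> nat list list set" where
  "tables_B \<alpha>s = {T \<in> tables_A \<alpha>s. distinct (List.transpose T)}"

definition tables_A_plus :: "nat list list \<Rightarrow> nat list list set" where
  "tables_A_plus \<alpha>s = {T \<in> tables_A \<alpha>s. \<forall>t\<in>set T. lattice_word t}"

definition tables_B_plus :: "nat list list \<Rightarrow> nat list list set" where
  "tables_B_plus \<alpha>s = tables_A_plus \<alpha>s \<inter> tables_B \<alpha>s"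

definition tables :: "nat \<Rightarrow> nat \<Rightarrow> nat \<Rightarrow> nat list list set" where
  "tables n d m = {X. length X = d \<and> (\<forall>x\<in>set X. length x = m \<and> set x \<subseteq> {1..n})}"

definition table_norm :: "nat list list \<Rightarrow> nat" where
  "table_norm T = (\<Prod>c\<in>set (List.transpose T). fact (count_list (List.transpose T) c))"

section \<open>Signs\<close>

definition word_sign :: "nat list \<Rightarrow> int" where
  "word_sign w = (- 1) ^ card {(i, j). i < j \<and> j < length w \<and> w ! i > w ! j}"

definition table_sign :: "nat list list \<Rightarrow> int" where
  "table_sign T = (\<Prod>t\<leftarrow>T. word_sign t)"

definition perm_sgn :: "nat list \<Rightarrow> int" where
  "perm_sgn a = (if distinct a \<and> set a = {1..length a}
                 then sign_on {1..length a} (\<lambda>i. a ! (i - 1)) else 0)"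

definition word_sgn :: "nat list \<Rightarrow> nat list \<Rightarrow> int" where
  "word_sgn s x = (\<Prod>c\<in>set s. perm_sgn (nths x {b. b < length s \<and> s ! b = c}))"

definition table_sgn :: "nat list list \<Rightarrow> nat list list \<Rightarrow> int" where
  "table_sgn T X = (\<Prod>k<length T. word_sgn (T ! k) (X ! k))"

section \<open>The group\<close>

definition GL :: "nat \<Rightarrow> nat \<Rightarrow> complex mat list set" where
  "GL n d = {g. length g = d \<and> (\<forall>h\<in>set g. h \<in> carrier_mat n n \<and> invertible_mat h)}"

definition torus :: "nat \<Rightarrow> nat \<Rightarrow> complex mat list set" where
  "torus n d = {g \<in> GL n d. \<forall>h\<in>set g. diagonal_mat h}"

definition unipotent :: "nat \<Rightarrow> nat \<Rightarrow> complex mat list set" where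
  "unipotent n d = {g \<in> GL n d. \<forall>h\<in>set g. upper_triangular h \<and> (\<forall>i<n. h $$ (i, i) = 1)}"

text \<open>The index set of the basis of the \<open>d\<close>-th tensor power of \<open>\<complex>\<^sup>n\<close>, and the coefficient of
  \<open>e\<^sub>j\<close> in \<open>g \<cdot> e\<^sub>i\<close>.  Matrix entries are numbered from 0.\<close>

definition idx :: "nat \<Rightarrow> nat \<Rightarrow> nat list set" where
  "idx n d = {i. length i = d \<and> set i \<subseteq> {1..n}}"

definition act_coeff :: "complex mat list \<Rightarrow> nat list \<Rightarrow> nat list \<Rightarrow> complex" where
  "act_coeff g j i = (\<Prod>k<length g. (g ! k) $$ (j ! k - 1, i ! k - 1))"

section \<open>The symmetric algebra\<close>

type_synonym sym = "(nat list \<Rightarrow>\<^sub>0 nat) \<Rightarrow>\<^sub>0 complex"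

definition sym_space :: "nat \<Rightarrow> nat \<Rightarrow> sym set" where
  "sym_space n d = {p. \<forall>a\<in>Poly_Mapping.keys p. Poly_Mapping.keys a \<subseteq> idx n d}"

definition sym_e :: "nat list \<Rightarrow> sym" where
  "sym_e i = Poly_Mapping.single (Poly_Mapping.single i 1) 1"

definition sym_act_e :: "nat \<Rightarrow> complex mat list \<Rightarrow> nat list \<Rightarrow> sym" where
  "sym_act_e n g i = (\<Sum>j\<in>idx n (length g). scale (act_coeff g j i) (sym_e j))"

definition sym_act :: "nat \<Rightarrow> complex mat list \<Rightarrow> sym \<Rightarrow> sym" where
  "sym_act n g p = (\<Sum>a\<in>Poly_Mapping.keys p. scale (poly_mapping.lookup p a)
     (\<Prod>i\<in>Poly_Mapping.keys a. sym_act_e n g i ^ poly_mapping.lookup a i))"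

definition sym_monom :: "nat list list \<Rightarrow> sym" where
  "sym_monom X = (\<Prod>c\<leftarrow>List.transpose X. sym_e c)"

section \<open>The exterior algebra\<close>

text \<open>The basis vector attached to a finite set \<open>S\<close> of indices is the wedge product of the
  generators indexed by \<open>S\<close> in increasing order; the order on indices is lexicographic.
  Multiplying two such vectors needs one transposition for each pair in
  \<open>shuffle_inv\<close> to restore the increasing order.\<close>

type_synonym 'i ext = "'i fset \<Rightarrow>\<^sub>0 complex"

definition shuffle_inv :: "'i::linorder fset \<Rightarrow> 'i fset \<Rightarrow> nat" where
  "shuffle_inv S T = card {(a, b). a \<in> fset S \<and> b \<in> fset T \<and> b < a}"

definition wedge_basis :: "'i::linorder fset \<Rightarrow> 'i fset \<Rightarrow> 'i ext" where
  "wedge_basis S T = (if S |\<inter>| T = {||}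
     then Poly_Mapping.single (S |\<union>| T) ((- 1) ^ shuffle_inv S T) else 0)"

definition wedge :: "'i::linorder ext \<Rightarrow> 'i ext \<Rightarrow> 'i ext"  (infixr \<open>\<diamondop>\<close> 70) where
  "f \<diamondop> g = (\<Sum>S\<in>Poly_Mapping.keys f. \<Sum>T\<in>Poly_Mapping.keys g.
     scale (poly_mapping.lookup f S * poly_mapping.lookup g T) (wedge_basis S T))"

definition ext_one :: "'i ext" where
  "ext_one = Poly_Mapping.single {||} 1"

definition ext_e :: "'i \<Rightarrow> 'i ext" where
  "ext_e i = Poly_Mapping.single {|i|} 1"

definition wedge_list :: "'i::linorder ext list \<Rightarrow> 'i ext" where
  "wedge_list fs = foldr (\<diamondop>) fs ext_one"

definition ext_space :: "nat \<Rightarrow> nat \<Rightarrow> nat list ext set" where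
  "ext_space n d = {f. \<forall>S\<in>Poly_Mapping.keys f. fset S \<subseteq> idx n d}"

definition ext_act_e :: "nat \<Rightarrow> complex mat list \<Rightarrow> nat list \<Rightarrow> nat list ext" where
  "ext_act_e n g i = (\<Sum>j\<in>idx n (length g). scale (act_coeff g j i) (ext_e j))"

definition ext_act :: "nat \<Rightarrow> complex mat list \<Rightarrow> nat list ext \<Rightarrow> nat list ext" where
  "ext_act n g f = (\<Sum>S\<in>Poly_Mapping.keys f. scale (poly_mapping.lookup f S)
     (wedge_list (map (ext_act_e n g) (sorted_list_of_fset S))))"

definition ext_monom :: "nat list list \<Rightarrow> nat list ext" where
  "ext_monom X = wedge_list (map ext_e (List.transpose X))"

subsection \<open>Algebra laws\<close>

lemma scale_single [simp]: "scale c (Poly_Mapping.single x a) = Poly_Mapping.single x (c * a)"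
  by (simp add: scale_def)

lemma poly_mapping_eq_sum_single:
  fixes f :: "'a \<Rightarrow>\<^sub>0 complex"
  shows "f = (\<Sum>x\<in>Poly_Mapping.keys f. Poly_Mapping.single x (poly_mapping.lookup f x))"
  by (rule poly_mapping_eqI) (auto simp: lookup_sum lookup_single when_def in_keys_iff)

lemma wedge_superset:
  assumes "finite A" "Poly_Mapping.keys f \<subseteq> A" "finite B" "Poly_Mapping.keys g \<subseteq> B"
  shows "f \<diamondop> g = (\<Sum>S\<in>A. \<Sum>T\<in>B.
      scale (poly_mapping.lookup f S * poly_mapping.lookup g T) (wedge_basis S T))"
proof -
  have "f \<diamondop> g = (\<Sum>S\<in>A. \<Sum>T\<in>Poly_Mapping.keys g.
      scale (poly_mapping.lookup f S * poly_mapping.lookup g T) (wedge_basis S T))"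
    unfolding wedge_def by (rule sum.mono_neutral_left) (use assms in \<open>auto simp: in_keys_iff\<close>)
  also have "\<dots> = (\<Sum>S\<in>A. \<Sum>T\<in>B.
      scale (poly_mapping.lookup f S * poly_mapping.lookup g T) (wedge_basis S T))"
    by (intro sum.cong refl sum.mono_neutral_left) (use assms in \<open>auto simp: in_keys_iff\<close>)
  finally show ?thesis .
qed

lemma wedge_add_left: "(f + g) \<diamondop> h = f \<diamondop> h + g \<diamondop> h"
proof -
  let ?A = "Poly_Mapping.keys f \<union> Poly_Mapping.keys g" and ?B = "Poly_Mapping.keys h"
  have "Poly_Mapping.keys (f + g) \<subseteq> ?A" by (rule Poly_Mapping.keys_add)
  then show ?thesis
    by (simp add: wedge_superset[of ?A _ ?B] lookup_add distrib_right cvec.scale_left_distrib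
        sum.distrib)
qed

lemma wedge_add_right: "f \<diamondop> (g + h) = f \<diamondop> g + f \<diamondop> h"
proof -
  let ?A = "Poly_Mapping.keys f" and ?B = "Poly_Mapping.keys g \<union> Poly_Mapping.keys h"
  have "Poly_Mapping.keys (g + h) \<subseteq> ?B" by (rule Poly_Mapping.keys_add)
  then show ?thesis
    by (simp add: wedge_superset[of ?A _ ?B] lookup_add distrib_left cvec.scale_left_distrib
        sum.distrib)
qed

lemma wedge_zero [simp]: "0 \<diamondop> f = 0" "f \<diamondop> 0 = 0"
  by (simp_all add: wedge_def)

lemma wedge_single:
  "Poly_Mapping.single S a \<diamondop> Poly_Mapping.single T b = scale (a * b) (wedge_basis S T)"
  by (cases "a = 0"; cases "b = 0") (simp_all add: wedge_def)

lemma wedge_scale_left: "scale c f \<diamondop> g = scale c (f \<diamondop> g)"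
proof -
  have "Poly_Mapping.keys (scale c f) \<subseteq> Poly_Mapping.keys f"
    by (auto simp: in_keys_iff lookup_scale)
  then show ?thesis
    by (simp add: wedge_superset[of "Poly_Mapping.keys f" _ "Poly_Mapping.keys g"] lookup_scale
        cvec.scale_sum_right mult.assoc)
qed

lemma wedge_scale_right: "f \<diamondop> scale c g = scale c (f \<diamondop> g)"
proof -
  have "Poly_Mapping.keys (scale c g) \<subseteq> Poly_Mapping.keys g"
    by (auto simp: in_keys_iff lookup_scale)
  then show ?thesis
    by (simp add: wedge_superset[of "Poly_Mapping.keys f" _ "Poly_Mapping.keys g"] lookup_scale
        cvec.scale_sum_right mult.left_commute)
qed

lemma wedge_sum_left: "sum f A \<diamondop> g = (\<Sum>x\<in>A. f x \<diamondop> g)"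
  by (induction A rule: infinite_finite_induct) (auto simp: wedge_add_left)

lemma wedge_sum_right: "g \<diamondop> sum f A = (\<Sum>x\<in>A. g \<diamondop> f x)"
  by (induction A rule: infinite_finite_induct) (auto simp: wedge_add_right)

lemma shuffle_inv_union_left:
  assumes "S |\<inter>| T = {||}"
  shows "shuffle_inv (S |\<union>| T) U = shuffle_inv S U + shuffle_inv T U"
proof -
  let ?P = "\<lambda>S U. {(a, b). a \<in> fset S \<and> b \<in> fset U \<and> b < (a::'a)}"
  have fin: "finite (?P S U)" for S U
    by (rule finite_subset[of _ "fset S \<times> fset U"]) auto
  have "?P (S |\<union>| T) U = ?P S U \<union> ?P T U" by auto
  moreover have "?P S U \<inter> ?P T U = {}" using assms by (auto simp: fset_eq_iff)
  ultimately show ?thesis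
    unfolding shuffle_inv_def by (simp add: card_Un_disjoint fin)
qed

lemma shuffle_inv_union_right:
  assumes "T |\<inter>| U = {||}"
  shows "shuffle_inv S (T |\<union>| U) = shuffle_inv S T + shuffle_inv S U"
proof -
  let ?P = "\<lambda>S U. {(a, b). a \<in> fset S \<and> b \<in> fset U \<and> b < (a::'a)}"
  have fin: "finite (?P S U)" for S U
    by (rule finite_subset[of _ "fset S \<times> fset U"]) auto
  have "?P S (T |\<union>| U) = ?P S T \<union> ?P S U" by auto
  moreover have "?P S T \<inter> ?P S U = {}" using assms by (auto simp: fset_eq_iff)
  ultimately show ?thesis
    unfolding shuffle_inv_def by (simp add: card_Un_disjoint fin)
qed

lemma wedge_assoc_basis:
  "wedge_basis S T \<diamondop> Poly_Mapping.single U 1 = Poly_Mapping.single S 1 \<diamondop> wedge_basis T U"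
proof (cases "S |\<inter>| T = {||} \<and> T |\<inter>| U = {||} \<and> S |\<inter>| U = {||}")
  case True
  then have "(S |\<union>| T) |\<inter>| U = {||}" "S |\<inter>| (T |\<union>| U) = {||}" by auto
  with True show ?thesis
    by (simp add: wedge_basis_def wedge_single shuffle_inv_union_left shuffle_inv_union_right
        power_add sup_assoc mult.commute mult.left_commute)
next
  case False
  then have "S |\<inter>| T = {||} \<Longrightarrow> (S |\<union>| T) |\<inter>| U \<noteq> {||}"
    "T |\<inter>| U = {||} \<Longrightarrow> S |\<inter>| (T |\<union>| U) \<noteq> {||}" by auto
  then show ?thesis
    by (auto simp: wedge_basis_def wedge_single)
qed

lemma wedge_assoc: "(f \<diamondop> g) \<diamondop> h = f \<diamondop> (g \<diamondop> h)"
proof -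
  have single: "Poly_Mapping.single x c = scale c (Poly_Mapping.single x 1)"
    for x :: "'a fset" and c
    by simp
  have basis: "(scale a (Poly_Mapping.single S 1) \<diamondop> scale b (Poly_Mapping.single T 1))
      \<diamondop> scale c (Poly_Mapping.single U 1) = scale a (Poly_Mapping.single S 1) \<diamondop>
      (scale b (Poly_Mapping.single T 1) \<diamondop> scale c (Poly_Mapping.single U 1))"
    for a b c and S T U :: "'a fset"
    by (simp only: wedge_scale_left wedge_scale_right wedge_single wedge_assoc_basis)
       (simp add: wedge_scale_left wedge_scale_right wedge_assoc_basis ac_simps)
  show ?thesis
    apply (subst (1 2) poly_mapping_eq_sum_single[of f])
    apply (subst (1 2) poly_mapping_eq_sum_single[of g])
    apply (subst (1 2) poly_mapping_eq_sum_single[of h])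
    apply (simp only: wedge_sum_left wedge_sum_right)
    apply (subst (1 2 3 4 5 6) single)
    apply (simp only: basis)
    done
qed

lemma wedge_one [simp]: "ext_one \<diamondop> f = f" "f \<diamondop> ext_one = f"
proof -
  have [simp]: "wedge_basis {||} S = Poly_Mapping.single S 1"
    "wedge_basis S {||} = Poly_Mapping.single S 1" for S :: "'a fset"
    by (simp_all add: wedge_basis_def shuffle_inv_def)
  show "ext_one \<diamondop> f = f" "f \<diamondop> ext_one = f"
    by (simp_all add: wedge_def ext_one_def flip: poly_mapping_eq_sum_single)
qed

lemma ext_e_square: "ext_e i \<diamondop> ext_e i = 0"
  by (simp add: ext_e_def wedge_single wedge_basis_def)

lemma ext_e_anticommute: "ext_e i \<diamondop> ext_e j = - (ext_e j \<diamondop> ext_e i)"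
proof (cases "i = j")
  case False
  have "shuffle_inv {|a|} {|b|} = (if b < a then 1 else 0)" for a b :: 'a
  proof -
    have "{(x, y). x \<in> fset {|a|} \<and> y \<in> fset {|b|} \<and> y < x} = (if b < a then {(a, b)} else {})"
      by auto
    then show ?thesis by (simp add: shuffle_inv_def)
  qed
  with False show ?thesis
    by (auto simp: ext_e_def wedge_single wedge_basis_def single_uminus finsert_commute
        not_less_iff_gr_or_eq)
qed (simp add: ext_e_square)

section \<open>Highest weight vectors\<close>

definition weight :: "nat list list \<Rightarrow> complex mat list \<Rightarrow> complex" where
  "weight lam t = (\<Prod>k<length lam. \<Prod>j<length (lam ! k). (t ! k) $$ (j, j) ^ (lam ! k ! j))"

definition HWV :: "nat \<Rightarrow> nat list list \<Rightarrow> ('a \<Rightarrow>\<^sub>0 complex) set \<Rightarrow>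
    (complex mat list \<Rightarrow> ('a \<Rightarrow>\<^sub>0 complex) \<Rightarrow> ('a \<Rightarrow>\<^sub>0 complex)) \<Rightarrow> ('a \<Rightarrow>\<^sub>0 complex) set" where
  "HWV n lam W act = {v \<in> W.
     (\<forall>t\<in>torus n (length lam). act t v = scale (weight lam t) v) \<and>
     (\<forall>u\<in>unipotent n (length lam). act u v = v)}"

definition HWV_sym :: "nat \<Rightarrow> nat list list \<Rightarrow> sym set" where
  "HWV_sym n lam = HWV n lam (sym_space n (length lam)) (sym_act n)"

definition HWV_ext :: "nat \<Rightarrow> nat list list \<Rightarrow> nat list ext set" where
  "HWV_ext n lam = HWV n lam (ext_space n (length lam)) (ext_act n)"

definition Delta :: "nat \<Rightarrow> nat list list \<Rightarrow> sym" where
  "Delta n T = scale (of_int (table_sign T) / of_nat (table_norm T))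
     (\<Sum>X\<in>tables n (length T) (length (List.transpose T)).
        scale (of_int (table_sgn T X)) (sym_monom X))"

definition Nabla :: "nat \<Rightarrow> nat list list \<Rightarrow> nat list ext" where
  "Nabla n T = scale (of_int (table_sign T) / of_nat (table_norm T))
     (\<Sum>X\<in>tables n (length T) (length (List.transpose T)).
        scale (of_int (table_sgn T X)) (ext_monom X))"

end

theory Submission
  imports Defs "HOL-Library.NList" "HOL-Combinatorics.Multiset_Permutations"
    "Jordan_Normal_Form.Determinant"
begin

text \<open>Both algebras are quotients of the tensor algebra on which the group acts compatibly, so a
  highest weight vector lifts to an (anti)symmetric function on lists of columns, each of whose
  rows is a highest weight vector in a tensor power of \<open>\<complex>\<^sup>n\<close>. The functions \<open>x \<mapsto> sgn\<^sub>s(x)\<close> are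
  products of leading principal minors, hence highest weight vectors. Conversely, a vector killed by
  all raising operators vanishes as soon as its coefficients at lattice words vanish, and on lattice
  words the functions \<open>sgn\<^sub>s\<close> are unitriangular for the lexicographic order, the diagonal position
  of \<open>s\<close> being the lattice word that records which occurrence of its letter stands at each place of
  \<open>s\<close>. So every lift is a combination of the functions \<open>sgn\<^sub>T\<close> with \<open>T\<close> in \<open>A\<^sup>+\<close>. If \<open>T\<close> has two equal
  columns, exchanging the columns of \<open>X\<close> at these places changes the summand by \<open>(-1)\<^sup>d\<close> times the
  sign of the exchange in the algebra, which kills the vector of \<open>T\<close> for odd \<open>d\<close> in the symmetric
  and for even \<open>d\<close> in the exterior algebra.\<close>

section \<open>Lists of fixed length\<close>

lemma finite_nlists: "finite A \<Longrightarrow> finite (nlists l A)"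
  by (rule finite_subset[OF _ finite_lists_length_eq[of A l]]) (use nlistsE_set in auto)

lemma sum_nlists_Suc: "(\<Sum>x\<in>nlists (Suc l) A. g x) = (\<Sum>a\<in>A. \<Sum>x\<in>nlists l A. g (a # x))"
proof -
  have "nlists (Suc l) A = (\<lambda>(a, x). a # x) ` (A \<times> nlists l A)"
    by (auto simp: nlists_Suc)
  moreover have "inj_on (\<lambda>(a, x). a # x) (A \<times> nlists l A)"
    by (auto simp: inj_on_def)
  ultimately show ?thesis
    by (simp add: sum.reindex sum.cartesian_product case_prod_unfold)
qed

lemma sum_nlists_prod:
  fixes h :: "nat \<Rightarrow> 'a \<Rightarrow> 'b::comm_semiring_1"
  shows "(\<Sum>x\<in>nlists l A. \<Prod>k<l. h k (x ! k)) = (\<Prod>k<l. \<Sum>a\<in>A. h k a)"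
proof (induction l arbitrary: h)
  case (Suc l)
  have "(\<Sum>x\<in>nlists (Suc l) A. \<Prod>k<Suc l. h k (x ! k))
      = (\<Sum>a\<in>A. h 0 a * (\<Sum>x\<in>nlists l A. \<Prod>k<l. h (Suc k) (x ! k)))"
    by (simp add: sum_nlists_Suc prod.lessThan_Suc_shift sum_distrib_left del: prod.lessThan_Suc)
  also have "\<dots> = (\<Prod>k<Suc l. \<Sum>a\<in>A. h k a)"
    by (simp add: Suc[of "\<lambda>k. h (Suc k)"] prod.lessThan_Suc_shift sum_distrib_right
        del: prod.lessThan_Suc)
  finally show ?case .
qed simp

lemma prod_list_eq_prod_count:
  fixes h :: "'a \<Rightarrow> 'b::comm_monoid_mult"
  assumes "set x \<subseteq> A" "finite A"
  shows "(\<Prod>a\<leftarrow>x. h a) = (\<Prod>a\<in>A. h a ^ count_list x a)"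
proof -
  have "(\<Prod>a\<leftarrow>x. h a) = (\<Prod>a\<in>set x. h a ^ count_list x a)"
    using image_prod_mset_multiplicity[of h "mset x"]
    by (simp add: count_mset flip: prod_mset_prod_list)
  also have "\<dots> = (\<Prod>a\<in>A. h a ^ count_list x a)"
    by (rule prod.mono_neutral_left) (use assms in auto)
  finally show ?thesis .
qed

lemma count_list_distinct: "distinct x \<Longrightarrow> count_list x a = (if a \<in> set x then 1 else 0)"
  by (induction x) auto

lemma split_list_two_positions:
  assumes "i < j" "j < length xs"
  obtains ps a qs b rs
  where "xs = ps @ a # qs @ b # rs" "i = length ps" "j = length ps + Suc (length qs)"
proof (rule that)
  have "xs = take i xs @ xs ! i # drop (Suc i) xs"
    using assms by (simp add: id_take_nth_drop)
  also have "drop (Suc i) xs = take (j - Suc i) (drop (Suc i) xs)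
      @ drop (Suc i) xs ! (j - Suc i) # drop (Suc (j - Suc i)) (drop (Suc i) xs)"
    by (rule id_take_nth_drop) (use assms in auto)
  finally show "xs = take i xs @ xs ! i # take (j - Suc i) (drop (Suc i) xs)
      @ drop (Suc i) xs ! (j - Suc i) # drop (Suc (j - Suc i)) (drop (Suc i) xs)" .
qed (use assms in auto)

lemma permute_list_transpose:
  assumes "i < length xs" "j < length xs"
  shows "permute_list (Transposition.transpose i j) xs = xs[i := xs ! j, j := xs ! i]"
  by (rule nth_equalityI)
    (use assms in \<open>auto simp: permute_list_def Transposition.transpose_def nth_list_update\<close>)

lemma permute_list_transpose_append:
  "permute_list (Transposition.transpose (length ps) (length ps + Suc (length qs)))
     (ps @ a # qs @ b # rs) = ps @ b # qs @ a # rs"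
  by (simp add: permute_list_transpose nth_append list_update_append)

lemma transpose_permutes_lessThan:
  "i < j \<Longrightarrow> j < l \<Longrightarrow> Transposition.transpose i j permutes {..<l}" for i j l :: nat
  by (rule permutes_swap_id) auto

section \<open>Symmetric and antisymmetric functions of a list\<close>

definition swap_symmetric :: "'b::monoid_mult \<Rightarrow> ('a list \<Rightarrow> 'b) \<Rightarrow> bool" where
  "swap_symmetric \<epsilon> F \<longleftrightarrow> (\<forall>xs a b ys. F (xs @ a # b # ys) = \<epsilon> * F (xs @ b # a # ys))"

lemma swap_symmetricI:
  "(\<And>xs a b ys. F (xs @ a # b # ys) = \<epsilon> * F (xs @ b # a # ys)) \<Longrightarrow> swap_symmetric \<epsilon> F"
  unfolding swap_symmetric_def by blast

lemma swap_symmetricD: "swap_symmetric \<epsilon> F \<Longrightarrow> F (xs @ a # b # ys) = \<epsilon> * F (xs @ b # a # ys)"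
  unfolding swap_symmetric_def by blast

lemma swap_symmetric_Cons: "swap_symmetric \<epsilon> F \<Longrightarrow> swap_symmetric \<epsilon> (\<lambda>x. F (c # x))"
  unfolding swap_symmetric_def append_Cons[symmetric] by blast

lemma swap_symmetric_distant:
  assumes "swap_symmetric \<epsilon> F" "\<epsilon> * \<epsilon> = 1"
  shows "F (xs @ a # ys @ b # zs) = \<epsilon> * F (xs @ b # ys @ a # zs)"
proof (induction ys arbitrary: xs)
  case Nil
  then show ?case using swap_symmetricD[OF assms(1), of xs a b zs] by simp
next
  case (Cons c ys)
  have "F (xs @ a # (c # ys) @ b # zs) = \<epsilon> * F ((xs @ [c]) @ a # ys @ b # zs)"
    using swap_symmetricD[OF assms(1), of xs a c] by simp
  also have "\<dots> = \<epsilon> * (\<epsilon> * F ((xs @ [c]) @ b # ys @ a # zs))" by (simp only: Cons)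
  also have "\<dots> = \<epsilon> * (\<epsilon> * (\<epsilon> * F (xs @ b # (c # ys) @ a # zs)))"
    using swap_symmetricD[OF assms(1), of xs c b] by simp
  finally show ?case by (metis assms(2) mult.assoc mult.left_neutral)
qed

lemma swap_symmetric_permute_transpose:
  assumes "swap_symmetric \<epsilon> F" "\<epsilon> * \<epsilon> = 1" "i < j" "j < length xs"
  shows "F (permute_list (Transposition.transpose i j) xs) = \<epsilon> * F xs"
proof -
  obtain ps a qs b rs where xs: "xs = ps @ a # qs @ b # rs" "i = length ps"
    "j = length ps + Suc (length qs)"
    by (rule split_list_two_positions[OF assms(3,4)])
  show ?thesis
    unfolding xs permute_list_transpose_append by (rule swap_symmetric_distant[OF assms(1,2)])
qed

lemma swap_symmetric_not_distinct:
  fixes F :: "'a list \<Rightarrow> 'b::{idom,ring_char_0}"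
  assumes "swap_symmetric (- 1) F" "\<not> distinct xs"
  shows "F xs = 0"
proof -
  obtain ps a qs rs where xs: "xs = ps @ a # qs @ a # rs"
    using not_distinct_decomp[OF assms(2)] by auto
  have "F xs = - 1 * F xs"
    unfolding xs by (rule swap_symmetric_distant[OF assms(1)]) simp
  then show ?thesis by simp
qed

lemma mset_eq_adjacent_swaps [consumes 1, case_names refl trans swap]:
  assumes "mset xs = mset ys"
    and refl: "\<And>xs. R xs xs"
    and trans: "\<And>xs ys zs. R xs ys \<Longrightarrow> R ys zs \<Longrightarrow> R xs zs"
    and swap: "\<And>xs a b ys. R (xs @ a # b # ys) (xs @ b # a # ys)"
  shows "R xs ys"
proof -
  have bubble: "R (ps @ a # us @ vs) (ps @ us @ a # vs)" for ps us vs a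
  proof (induction us arbitrary: ps)
    case (Cons b us)
    show ?case
      using trans[OF swap[of ps a b "us @ vs"]] Cons[of "ps @ [b]"] by simp
  qed (simp add: refl)
  have "R (ps @ xs) (ps @ ys)" if "mset xs = mset ys" for ps xs ys
    using that
  proof (induction xs arbitrary: ps ys)
    case (Cons a xs)
    then have "a \<in> set ys" by (metis list.set_intros(1) set_mset_mset)
    then obtain us vs where ys: "ys = us @ a # vs" by (meson split_list)
    with Cons.prems have "mset xs = mset (us @ vs)" by simp
    from Cons.IH[OF this, of "ps @ [a]"] bubble[of ps a us vs] show ?case
      using trans ys by simp
  qed (simp add: refl)
  from this[of xs ys "[]"] assms(1) show ?thesis by simp
qed

lemma swap_symmetric_common_sign:
  fixes F G :: "'a list \<Rightarrow> 'b::comm_monoid_mult"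
  assumes "swap_symmetric \<epsilon> F" "swap_symmetric \<epsilon> G" "\<epsilon> * \<epsilon> = 1" "mset xs = mset ys"
  shows "\<exists>e. e * e = 1 \<and> F xs = e * F ys \<and> G xs = e * G ys"
  using assms(4)
proof (induction rule: mset_eq_adjacent_swaps)
  case (refl xs)
  show ?case by (intro exI[of _ 1]) simp
next
  case (trans xs ys zs)
  then obtain e e' where "e * e = 1" "e' * e' = 1" "F xs = e * F ys" "G xs = e * G ys"
    "F ys = e' * F zs" "G ys = e' * G zs" by blast
  moreover from this have "(e * e') * (e * e') = 1"
    by (metis mult.assoc mult.commute mult_1_right)
  ultimately show ?case by (intro exI[of _ "e * e'"]) (simp add: mult.assoc)
next
  case (swap xs a b ys)
  show ?case
    by (intro exI[of _ \<epsilon>] conjI assms(3) swap_symmetricD[OF assms(1)] swap_symmetricD[OF assms(2)])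
qed

section \<open>Action of a matrix on a tensor power\<close>

text \<open>Here \<open>u a b\<close> is the coefficient of \<open>e\<^sub>a\<close> in the image of \<open>e\<^sub>b\<close>, and \<open>F\<close> stands for the
  tensor with coefficients \<open>F x\<close>.\<close>

definition tensor_coeff :: "('a \<Rightarrow> 'b \<Rightarrow> 'c::comm_semiring_1) \<Rightarrow> 'a list \<Rightarrow> 'b list \<Rightarrow> 'c" where
  "tensor_coeff u y x = prod_list (map2 u y x)"

definition tensor_act ::
    "'a set \<Rightarrow> ('a \<Rightarrow> 'a \<Rightarrow> 'c::comm_semiring_1) \<Rightarrow> ('a list \<Rightarrow> 'c) \<Rightarrow> 'a list \<Rightarrow> 'c" where
  "tensor_act I u F y = (\<Sum>x\<in>nlists (length y) I. tensor_coeff u y x * F x)"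

lemma tensor_coeff_Nil [simp]: "tensor_coeff u [] x = 1"
  by (simp add: tensor_coeff_def)

lemma tensor_coeff_Cons [simp]: "tensor_coeff u (a # y) (b # x) = u a b * tensor_coeff u y x"
  by (simp add: tensor_coeff_def)

lemma tensor_act_Nil [simp]: "tensor_act I u F [] = F []"
  by (simp add: tensor_act_def)

lemma tensor_act_Cons [simp]:
  "tensor_act I u F (a # y) = (\<Sum>b\<in>I. u a b * tensor_act I u (\<lambda>x. F (b # x)) y)"
  by (simp add: tensor_act_def sum_nlists_Suc sum_distrib_left mult.assoc)

lemma tensor_act_cong:
  "(\<And>x. x \<in> nlists (length y) I \<Longrightarrow> F x = G x) \<Longrightarrow> tensor_act I u F y = tensor_act I u G y"
  by (simp add: tensor_act_def)

lemma tensor_act_cong_matrix: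
  assumes "\<And>a b. a \<in> I \<Longrightarrow> b \<in> I \<Longrightarrow> u a b = v a b" "set y \<subseteq> I"
  shows "tensor_act I u F y = tensor_act I v F y"
  using assms(2) by (induction y arbitrary: F) (simp_all add: assms(1) cong: sum.cong)

lemma tensor_act_cmult: "tensor_act I u (\<lambda>x. c * F x) y = c * tensor_act I u F y"
  by (simp add: tensor_act_def sum_distrib_left mult_ac)

lemma tensor_act_sum:
  "tensor_act I u (\<lambda>x. \<Sum>t\<in>A. F t x) y = (\<Sum>t\<in>A. tensor_act I u (F t) y)"
  by (simp add: tensor_act_def sum_distrib_left sum.swap[of _ A])

lemma tensor_act_diff:
  fixes u :: "'a \<Rightarrow> 'a \<Rightarrow> 'c::comm_ring_1"
  shows "tensor_act I u (\<lambda>x. F x - G x) y = tensor_act I u F y - tensor_act I u G y"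
  by (simp add: tensor_act_def right_diff_distrib sum_subtractf)

lemma tensor_act_diagonal:
  assumes "\<And>a b. a \<in> I \<Longrightarrow> b \<in> I \<Longrightarrow> a \<noteq> b \<Longrightarrow> u a b = 0" "set y \<subseteq> I" "finite I"
  shows "tensor_act I u F y = (\<Prod>a\<leftarrow>y. u a a) * F y"
  using assms(2)
proof (induction y arbitrary: F)
  case (Cons a y)
  then have "(\<Sum>b\<in>I. u a b * tensor_act I u (\<lambda>x. F (b # x)) y)
      = (\<Sum>b\<in>I. if b = a then u a a * tensor_act I u (\<lambda>x. F (a # x)) y else 0)"
    by (intro sum.cong refl) (use assms(1) in auto)
  then show ?case using Cons assms(3) by (simp add: mult.assoc)
qed simp

lemma swap_symmetric_tensor_act:
  assumes "swap_symmetric \<epsilon> F"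
  shows "swap_symmetric \<epsilon> (tensor_act I u F)"
proof (rule swap_symmetricI)
  fix xs a b ys
  show "tensor_act I u F (xs @ a # b # ys) = \<epsilon> * tensor_act I u F (xs @ b # a # ys)"
    using assms
  proof (induction xs arbitrary: F)
    case Nil
    have swap: "tensor_act I u (\<lambda>x. F (c # d # x)) ys = \<epsilon> * tensor_act I u (\<lambda>x. F (d # c # x)) ys"
      for c d
      using swap_symmetricD[OF Nil, of "[]" c d] by (simp flip: tensor_act_cmult)
    have "tensor_act I u F (a # b # ys)
        = (\<Sum>c\<in>I. \<Sum>d\<in>I. u a c * (u b d * tensor_act I u (\<lambda>x. F (c # d # x)) ys))"
      by (simp add: sum_distrib_left)
    also have "\<dots> = (\<Sum>c\<in>I. \<Sum>d\<in>I. u a c * (u b d * (\<epsilon> * tensor_act I u (\<lambda>x. F (d # c # x)) ys)))"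
      by (intro sum.cong refl arg_cong2[of _ _ _ _ times] swap)
    also have "\<dots> = \<epsilon> * tensor_act I u F (b # a # ys)"
      by (subst sum.swap) (simp add: sum_distrib_left mult_ac)
    finally show ?case by simp
  next
    case (Cons c xs)
    show ?case
      using Cons.IH[OF swap_symmetric_Cons[OF Cons.prems]] by (simp add: sum_distrib_left mult_ac)
  qed
qed

section \<open>Permutation signs\<close>

lemma perm_sgn_adjacent_swap: "perm_sgn (xs @ a # b # ys) = - perm_sgn (xs @ b # a # ys)"
proof (cases "distinct (xs @ b # a # ys) \<and> set (xs @ b # a # ys) = {1..length (xs @ b # a # ys)}")
  case True
  let ?l = "xs @ a # b # ys" and ?l' = "xs @ b # a # ys" and ?k = "Suc (length xs)"
  let ?N = "{1..length ?l'}" and ?\<tau> = "Transposition.transpose ?k (Suc ?k)"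
  have "bij_betw (\<lambda>i. i - 1) ?N {..<length ?l'}"
    by (rule bij_betw_byWitness[where f' = Suc]) auto
  moreover have "bij_betw ((!) ?l') {..<length ?l'} (set ?l')"
    by (rule bij_betw_nth) (use True in auto)
  ultimately have "bij_betw ((!) ?l' \<circ> (\<lambda>i. i - 1)) ?N (set ?l')"
    by (rule bij_betw_trans)
  then have bij: "bij_betw (\<lambda>i. ?l' ! (i - 1)) ?N ?N"
    using True by (simp add: comp_def)
  have "?l ! (i - 1) = (\<lambda>i. ?l' ! (i - 1)) (?\<tau> i)" if "i \<in> ?N" for i
    using that by (auto simp: nth_append nth_Cons' Transposition.transpose_def)
  then have "sign_on ?N (\<lambda>i. ?l ! (i - 1)) = sign_on ?N ((\<lambda>i. ?l' ! (i - 1)) \<circ> ?\<tau>)"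
    by (intro sign_on_cong) auto
  also have "\<dots> = sign_on ?N (\<lambda>i. ?l' ! (i - 1)) * sign_on ?N ?\<tau>"
  proof (rule sign_on_compose)
    show "bij_betw ?\<tau> ?N ?N" by (rule permutes_imp_bij, rule permutes_swap_id) auto
  qed (use bij in simp_all)
  also have "sign_on ?N ?\<tau> = -1" by (rule sign_on_transpose) auto
  finally show ?thesis using True by (auto simp: perm_sgn_def insert_commute)
next
  case False
  then have "\<not> (distinct (xs @ a # b # ys) \<and> set (xs @ a # b # ys) = {1..length (xs @ a # b # ys)})"
    by (auto simp: insert_commute)
  then show ?thesis using False by (simp only: perm_sgn_def if_False minus_zero)
qed

lemma swap_symmetric_perm_sgn: "swap_symmetric (- 1) perm_sgn"
  by (rule swap_symmetricI, subst perm_sgn_adjacent_swap) simp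

lemma swap_symmetric_of_int_perm_sgn:
  "swap_symmetric (- 1) (\<lambda>x. of_int (perm_sgn x) :: 'a::ring_1)"
  by (rule swap_symmetricI, subst perm_sgn_adjacent_swap) simp

lemma perm_sgn_nonzeroD: "perm_sgn x \<noteq> 0 \<Longrightarrow> distinct x \<and> set x = {1..length x}"
  by (auto simp: perm_sgn_def split: if_splits)

definition id_word :: "nat \<Rightarrow> nat list" where
  "id_word k = [1..<Suc k]"

lemma id_word_simps [simp]:
  "length (id_word k) = k" "set (id_word k) = {1..k}" "distinct (id_word k)" "id_word 0 = []"
  by (auto simp: id_word_def)

lemma nth_id_word: "j < k \<Longrightarrow> id_word k ! j = Suc j"
  unfolding id_word_def by (simp del: upt_Suc)

lemma id_word_Suc: "id_word (Suc k) = id_word k @ [Suc k]"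
  by (simp add: id_word_def)

lemma perm_sgn_id_word [simp]: "perm_sgn (id_word k) = 1"
proof -
  have "sign_on {1..k} (\<lambda>i. id_word k ! (i - 1)) = sign_on {1..k} (\<lambda>i. i)"
    by (rule sign_on_cong) (auto simp: nth_id_word)
  then show ?thesis by (simp add: perm_sgn_def)
qed

lemma mset_eq_id_word_iff:
  "mset x = mset (id_word (length x)) \<longleftrightarrow> distinct x \<and> set x = {1..length x}"
  by (metis id_word_simps(2,3) mset_eq_imp_distinct_iff mset_eq_setD set_eq_iff_mset_eq_distinct)

lemma antisymmetric_eq_perm_sgn:
  fixes F :: "nat list \<Rightarrow> 'a::{idom,ring_char_0}"
  assumes F: "swap_symmetric (- 1) F" and y: "set y \<subseteq> {1..length y}"
  shows "F y = F (id_word (length y)) * of_int (perm_sgn y)"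
proof (cases "distinct y")
  case True
  then have "set y = {1..length y}"
    using y by (intro card_subset_eq) (simp_all add: distinct_card)
  with True have "mset y = mset (id_word (length y))" by (simp only: mset_eq_id_word_iff)
  from swap_symmetric_common_sign[OF F swap_symmetric_of_int_perm_sgn _ this]
  obtain e where "F y = e * F (id_word (length y))"
    "of_int (perm_sgn y) = e * of_int (perm_sgn (id_word (length y)))" by auto
  then show ?thesis by simp
next
  case False
  then have "perm_sgn y = 0" using perm_sgn_nonzeroD by blast
  then show ?thesis using swap_symmetric_not_distinct[OF F False] by simp
qed

lemma perm_sgn_dominated_set:
  assumes "perm_sgn x \<noteq> 0" "list_all2 (\<le>) y x" "0 \<notin> set y"
  shows "set y \<subseteq> {1..length y}"
proof
  fix a assume a: "a \<in> set y"
  then obtain j where j: "j < length y" "a = y ! j" by (auto simp: in_set_conv_nth)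
  then have "y ! j \<le> x ! j" "x ! j \<in> set x"
    using assms(2) by (auto simp: list_all2_conv_all_nth)
  moreover have "set x = {1..length y}"
    using perm_sgn_nonzeroD[OF assms(1)] list_all2_lengthD[OF assms(2)] by simp
  moreover have "a \<noteq> 0" using a assms(3) by metis
  ultimately show "a \<in> {1..length y}" using j(2) by simp
qed

lemma perm_sgn_dominates_id_word:
  assumes "perm_sgn x \<noteq> 0" "list_all2 (\<le>) (id_word (length x)) x"
  shows "x = id_word (length x)"
proof (rule sym, rule nth_equalityI)
  let ?z = "id_word (length x)"
  have "mset x = mset ?z"
    using perm_sgn_nonzeroD[OF assms(1)] by (simp only: mset_eq_id_word_iff)
  then have "sum_list x = sum_list ?z" by (metis sum_mset_sum_list)
  then have sums: "(\<Sum>j<length x. ?z ! j) = (\<Sum>j<length x. x ! j)"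
    by (simp add: sum_list_sum_nth atLeast0LessThan)
  have "?z ! j \<le> x ! j" if "j < length x" for j
    using assms(2) that by (auto simp: list_all2_conv_all_nth)
  then show "?z ! j = x ! j" if "j < length ?z" for j
    using sum_mono_inv[OF sums, of j] that by auto
qed simp

lemma tensor_coeff_upper_triangular:
  fixes u :: "'a::linorder \<Rightarrow> 'a \<Rightarrow> 'b::comm_semiring_1"
  assumes upper: "\<forall>a\<in>I. \<forall>b\<in>I. b < a \<longrightarrow> u a b = 0"
    and "set y \<subseteq> I" "x \<in> nlists (length y) I" "tensor_coeff u y x \<noteq> 0"
  shows "list_all2 (\<le>) y x"
  using assms(2-)
proof (induction y arbitrary: x)
  case (Cons a y)
  then obtain b x' where x: "x = b # x'" "b \<in> I" "x' \<in> nlists (length y) I"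
    by (auto simp: in_nlists_Suc_iff)
  with Cons.prems have "u a b \<noteq> 0" "tensor_coeff u y x' \<noteq> 0" by auto
  then show ?case using Cons x upper by (auto simp: not_less[symmetric])
qed simp

text \<open>This is the expansion of the \<open>k\<close>-th leading principal minor, in which only the diagonal term
  survives.\<close>

lemma tensor_act_perm_sgn_id_word:
  fixes u :: "nat \<Rightarrow> nat \<Rightarrow> 'a::{idom,ring_char_0}"
  assumes upper: "\<forall>a\<in>{1..n}. \<forall>b\<in>{1..n}. b < a \<longrightarrow> u a b = 0" and "k \<le> n"
  shows "tensor_act {1..n} u (\<lambda>x. of_int (perm_sgn x)) (id_word k) = (\<Prod>a\<leftarrow>id_word k. u a a)"
proof -
  let ?z = "id_word k"
  have z: "set ?z \<subseteq> {1..n}" using \<open>k \<le> n\<close> by auto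
  have "tensor_coeff u ?z x * of_int (perm_sgn x) = 0"
    if "x \<in> nlists k {1..n}" "x \<noteq> ?z" for x
  proof (rule ccontr)
    assume "tensor_coeff u ?z x * of_int (perm_sgn x) \<noteq> 0"
    then have nz: "tensor_coeff u ?z x \<noteq> 0" "perm_sgn x \<noteq> 0" by auto
    then have "list_all2 (\<le>) ?z x"
      using tensor_coeff_upper_triangular[OF upper z] that(1) by simp
    then have "x = id_word (length x)"
      using nz(2) that(1) by (intro perm_sgn_dominates_id_word) simp_all
    then show False using that by simp
  qed
  then have "tensor_act {1..n} u (\<lambda>x. of_int (perm_sgn x)) ?z
      = (\<Sum>x\<in>{?z}. tensor_coeff u ?z x * of_int (perm_sgn x))"
    unfolding tensor_act_def using nlistsI[OF _ z]
    by (intro sum.mono_neutral_right) (auto simp: finite_nlists)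
  also have "\<dots> = (\<Prod>a\<leftarrow>?z. u a a)"
    by (simp add: tensor_coeff_def zip_same_conv_map comp_def)
  finally show ?thesis .
qed

lemma tensor_act_perm_sgn_eq_zero:
  fixes u :: "nat \<Rightarrow> nat \<Rightarrow> 'a::{idom,ring_char_0}"
  assumes upper: "\<forall>a\<in>{1..n}. \<forall>b\<in>{1..n}. b < a \<longrightarrow> u a b = 0"
    and y: "set y \<subseteq> {1..n}" and not_sub: "\<not> set y \<subseteq> {1..length y}"
  shows "tensor_act {1..n} u (\<lambda>x. of_int (perm_sgn x)) y = 0"
proof -
  have "tensor_coeff u y x * of_int (perm_sgn x) = 0" if x: "x \<in> nlists (length y) {1..n}" for x
  proof (rule ccontr)
    assume "tensor_coeff u y x * of_int (perm_sgn x) \<noteq> 0"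
    then have "perm_sgn x \<noteq> 0" "list_all2 (\<le>) y x"
      using tensor_coeff_upper_triangular[OF upper y x] by auto
    moreover have "0 \<notin> set y" using y by auto
    ultimately show False using perm_sgn_dominated_set not_sub by blast
  qed
  then show ?thesis
    unfolding tensor_act_def by (intro sum.neutral ballI)
qed

lemma tensor_act_perm_sgn:
  fixes u :: "nat \<Rightarrow> nat \<Rightarrow> 'a::{idom,ring_char_0}"
  assumes upper: "\<forall>a\<in>{1..n}. \<forall>b\<in>{1..n}. b < a \<longrightarrow> u a b = 0" and y: "set y \<subseteq> {1..n}"
  shows "tensor_act {1..n} u (\<lambda>x. of_int (perm_sgn x)) y = (\<Prod>a\<leftarrow>y. u a a) * of_int (perm_sgn y)"
    (is "?A y = ?D y * _")
proof (cases "set y \<subseteq> {1..length y}")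
  case True
  have "swap_symmetric (- 1) ?A"
    by (rule swap_symmetric_tensor_act[OF swap_symmetric_of_int_perm_sgn])
  from antisymmetric_eq_perm_sgn[OF this True]
  have A: "?A y = ?A (id_word (length y)) * of_int (perm_sgn y)" .
  show ?thesis
  proof (cases "perm_sgn y = 0")
    case False
    then have perm: "mset y = mset (id_word (length y))" and "set y = {1..length y}"
      using perm_sgn_nonzeroD[OF False] mset_eq_id_word_iff by blast+
    then have "length y \<le> n" using y by (cases y) auto
    then have "?A (id_word (length y)) = ?D (id_word (length y))"
      by (rule tensor_act_perm_sgn_id_word[OF upper])
    also have "\<dots> = ?D y"
      unfolding prod_mset_prod_list[symmetric] mset_map by (simp only: perm)
    finally show ?thesis using A by simp
  qed (use A in simp)
next
  case False
  then have "perm_sgn y = 0" using perm_sgn_nonzeroD by blast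
  then show ?thesis using tensor_act_perm_sgn_eq_zero[OF upper y False] by simp
qed

section \<open>Signs relative to a word\<close>

definition letters_at :: "'b \<Rightarrow> 'b list \<Rightarrow> 'a list \<Rightarrow> 'a list" where
  "letters_at c s x = map snd (filter (\<lambda>p. fst p = c) (zip s x))"

lemma letters_at_Nil [simp]: "letters_at c [] x = []"
  by (simp add: letters_at_def)

lemma letters_at_Cons [simp]:
  "letters_at c (a # s) (b # x) = (if a = c then b # letters_at c s x else letters_at c s x)"
  by (simp add: letters_at_def)

lemma letters_at_append [simp]:
  "length s = length x \<Longrightarrow> letters_at c (s @ s') (x @ x') = letters_at c s x @ letters_at c s' x'"
  by (simp add: letters_at_def)

lemma letters_at_notin: "c \<notin> set s \<Longrightarrow> letters_at c s x = []"
  by (auto simp: letters_at_def filter_empty_conv dest: set_zip_leftD)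

lemma set_letters_at_subset: "set (letters_at c s x) \<subseteq> set x"
  by (auto simp: letters_at_def dest: set_zip_rightD)

lemma length_letters_at: "length s = length x \<Longrightarrow> length (letters_at c s x) = count_list s c"
  by (induction s x rule: list_induct2) auto

lemma nths_eq_letters_at:
  "length x = length s \<Longrightarrow> nths x {b. b < length s \<and> s ! b = c} = letters_at c s x"
  by (induction x s rule: list_induct2) (auto simp: nths_Cons)

lemma count_list_letters_at:
  assumes "length s = length x" "finite C" "set s \<subseteq> C"
  shows "count_list x i = (\<Sum>c\<in>C. count_list (letters_at c s x) i)"
  using assms(1,3)
proof (induction s x rule: list_induct2)
  case (Cons a s b x)
  have "(\<Sum>c\<in>C. count_list (letters_at c (a # s) (b # x)) i)
      = (\<Sum>c\<in>C. (if c = a then (if b = i then 1 else 0) else 0) + count_list (letters_at c s x) i)"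
    by (rule sum.cong) auto
  also have "\<dots> = (if b = i then 1 else 0) + (\<Sum>c\<in>C. count_list (letters_at c s x) i)"
    using Cons assms(2) by (simp add: sum.distrib)
  finally show ?case using Cons by simp
qed simp

lemma prod_letters_at:
  fixes h :: "'a \<Rightarrow> 'c::comm_monoid_mult"
  assumes "length s = length x" "finite C" "set s \<subseteq> C"
  shows "(\<Prod>c\<in>C. \<Prod>a\<leftarrow>letters_at c s x. h a) = (\<Prod>a\<leftarrow>x. h a)"
proof -
  have "(\<Prod>c\<in>C. \<Prod>a\<leftarrow>letters_at c s x. h a)
      = (\<Prod>c\<in>C. \<Prod>a\<in>set x. h a ^ count_list (letters_at c s x) a)"
    by (intro prod.cong refl prod_list_eq_prod_count set_letters_at_subset) simp
  also have "\<dots> = (\<Prod>a\<in>set x. h a ^ count_list x a)"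
    by (subst prod.swap) (simp add: count_list_letters_at[OF assms] power_sum)
  also have "\<dots> = (\<Prod>a\<leftarrow>x. h a)"
    by (rule prod_list_eq_prod_count[symmetric]) simp_all
  finally show ?thesis .
qed

lemma tensor_act_letters_at:
  assumes "length s = length y" "finite C" "set s \<subseteq> C"
  shows "tensor_act I u (\<lambda>x. \<Prod>c\<in>C. f c (letters_at c s x)) y
    = (\<Prod>c\<in>C. tensor_act I u (f c) (letters_at c s y))"
  using assms(1,3)
proof (induction s y arbitrary: f rule: list_induct2)
  case (Cons a s q y)
  then have a: "a \<in> C" by simp
  let ?f = "\<lambda>b. f(a := (\<lambda>z. f a (b # z)))"
    and ?rest = "\<Prod>c\<in>C - {a}. tensor_act I u (f c) (letters_at c s y)"
  have "f c (letters_at c (a # s) (b # x)) = ?f b c (letters_at c s x)" for b c x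
    by simp
  then have "tensor_act I u (\<lambda>x. \<Prod>c\<in>C. f c (letters_at c (a # s) x)) (q # y)
      = (\<Sum>b\<in>I. u q b * tensor_act I u (\<lambda>x. \<Prod>c\<in>C. ?f b c (letters_at c s x)) y)"
    by (simp only: tensor_act_Cons)
  also have "\<dots> = (\<Sum>b\<in>I. u q b * (\<Prod>c\<in>C. tensor_act I u (?f b c) (letters_at c s y)))"
    by (intro sum.cong refl arg_cong2[of _ _ _ _ times] Cons.IH) (use Cons.prems in simp)
  also have "\<dots> = (\<Sum>b\<in>I. u q b * (tensor_act I u (\<lambda>z. f a (b # z)) (letters_at a s y) * ?rest))"
    by (simp add: prod.remove[OF assms(2) a])
  also have "\<dots> = tensor_act I u (f a) (letters_at a (a # s) (q # y)) * ?rest"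
    by (simp add: sum_distrib_right mult.assoc)
  also have "?rest = (\<Prod>c\<in>C - {a}. tensor_act I u (f c) (letters_at c (a # s) (q # y)))"
    by (rule prod.cong) auto
  also have "tensor_act I u (f a) (letters_at a (a # s) (q # y)) * \<dots>
      = (\<Prod>c\<in>C. tensor_act I u (f c) (letters_at c (a # s) (q # y)))"
    by (rule prod.remove[OF assms(2) a, symmetric])
  finally show ?case .
qed simp

lemma word_sgn_eq_prod:
  "length x = length s \<Longrightarrow> word_sgn s x = (\<Prod>c\<in>set s. perm_sgn (letters_at c s x))"
  by (simp add: word_sgn_def nths_eq_letters_at)

lemma word_sgn_nonzeroD:
  assumes "word_sgn s x \<noteq> 0" "length x = length s"
  shows "distinct (letters_at c s x) \<and> set (letters_at c s x) = {1..count_list s c}"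
proof (cases "c \<in> set s")
  case True
  then have "perm_sgn (letters_at c s x) \<noteq> 0" using assms by (auto simp: word_sgn_eq_prod)
  from perm_sgn_nonzeroD[OF this] show ?thesis using assms by (simp add: length_letters_at)
qed (simp add: letters_at_notin)

lemma tensor_act_word_sgn:
  fixes u :: "nat \<Rightarrow> nat \<Rightarrow> 'a::{idom,ring_char_0}"
  assumes "\<forall>a\<in>{1..n}. \<forall>b\<in>{1..n}. b < a \<longrightarrow> u a b = 0"
    and "set y \<subseteq> {1..n}" "length s = length y"
  shows "tensor_act {1..n} u (\<lambda>x. of_int (word_sgn s x)) y
    = (\<Prod>a\<leftarrow>y. u a a) * of_int (word_sgn s y)"
proof -
  have "tensor_act {1..n} u (\<lambda>x. of_int (word_sgn s x)) y
      = tensor_act {1..n} u (\<lambda>x. \<Prod>c\<in>set s. of_int (perm_sgn (letters_at c s x))) y"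
    by (rule tensor_act_cong) (simp add: word_sgn_eq_prod assms(3))
  also have "\<dots> = (\<Prod>c\<in>set s. tensor_act {1..n} u (\<lambda>x. of_int (perm_sgn x)) (letters_at c s y))"
    by (rule tensor_act_letters_at) (use assms in auto)
  also have "\<dots> = (\<Prod>c\<in>set s. (\<Prod>a\<leftarrow>letters_at c s y. u a a) * of_int (perm_sgn (letters_at c s y)))"
    by (intro prod.cong refl tensor_act_perm_sgn) (use assms set_letters_at_subset in fastforce)+
  also have "\<dots> = (\<Prod>a\<leftarrow>y. u a a) * of_int (word_sgn s y)"
    using assms(3) by (simp add: prod.distrib prod_letters_at word_sgn_eq_prod)
  finally show ?thesis .
qed

lemma word_sgn_swap:
  assumes "length s1 = length xs" "length s2 = length ys" "length s3 = length zs"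
  shows "word_sgn (s1 @ c # s2 @ c # s3) (xs @ a # ys @ b # zs)
    = - word_sgn (s1 @ c # s2 @ c # s3) (xs @ b # ys @ a # zs)"
    (is "word_sgn ?s ?x = - word_sgn ?s ?x'")
proof -
  have split: "word_sgn ?s x
      = perm_sgn (letters_at c ?s x) * (\<Prod>e\<in>set ?s - {c}. perm_sgn (letters_at e ?s x))"
    if "length x = length ?s" for x
    by (subst word_sgn_eq_prod[OF that], rule prod.remove) simp_all
  have "perm_sgn (letters_at c ?s ?x) = - 1 * perm_sgn (letters_at c ?s ?x')"
    unfolding letters_at_append[OF assms(1)] letters_at_append[OF assms(2)] letters_at_Cons
      simp_thms if_True
    by (rule swap_symmetric_distant[OF swap_symmetric_perm_sgn]) simp
  moreover have "letters_at e ?s ?x = letters_at e ?s ?x'" if "e \<noteq> c" for e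
    using that assms by simp
  ultimately show ?thesis
    using assms by (simp add: split)
qed

lemma word_sgn_permute_transpose:
  assumes "s ! i = s ! j" "i < j" "j < length s" "length x = length s"
  shows "word_sgn s (permute_list (Transposition.transpose i j) x) = - word_sgn s x"
proof -
  obtain s1 a s2 b s3 where s: "s = s1 @ a # s2 @ b # s3" "i = length s1"
    "j = length s1 + Suc (length s2)"
    by (rule split_list_two_positions[OF assms(2,3)])
  have "j < length x" using assms by simp
  obtain xs p ys q zs where x: "x = xs @ p # ys @ q # zs" "i = length xs"
    "j = length xs + Suc (length ys)"
    by (rule split_list_two_positions[OF assms(2) \<open>j < length x\<close>])
  have "a = b" using s assms(1) by (simp add: nth_append)
  show ?thesis
    unfolding x permute_list_transpose_append s(1) \<open>a = b\<close>
    by (rule word_sgn_swap) (use s x assms(4) in auto)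
qed

section \<open>Lattice words\<close>

lemma lattice_word_Nil [simp]: "lattice_word []"
  by (simp add: lattice_word_def)

lemma lattice_word_snoc:
  "lattice_word (w @ [a]) \<longleftrightarrow>
     lattice_word w \<and> (\<forall>i\<ge>1. a = Suc i \<longrightarrow> count_list w (Suc i) < count_list w i)"
proof -
  have "lattice_word (w @ [a]) \<longleftrightarrow> lattice_word w \<and>
      (\<forall>i\<ge>1. count_list (w @ [a]) (Suc i) \<le> count_list (w @ [a]) i)"
    unfolding lattice_word_def by (auto simp: le_Suc_eq)
  also have "\<dots> \<longleftrightarrow> lattice_word w \<and>
      (\<forall>i\<ge>1. a = Suc i \<longrightarrow> count_list w (Suc i) < count_list w i)"
  proof (intro conj_cong refl)
    assume "lattice_word w"
    then have "\<forall>i\<ge>1. count_list w (Suc i) \<le> count_list w i"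
      unfolding lattice_word_def by (metis order_refl take_all)
    then show "(\<forall>i\<ge>1. count_list (w @ [a]) (Suc i) \<le> count_list (w @ [a]) i) \<longleftrightarrow>
        (\<forall>i\<ge>1. a = Suc i \<longrightarrow> count_list w (Suc i) < count_list w i)"
      by (auto simp: Suc_le_eq less_Suc_eq_le le_SucI)
  qed
  finally show ?thesis .
qed

lemma lattice_word_count_antimono:
  assumes "lattice_word w" "1 \<le> a" "a \<le> b"
  shows "count_list w b \<le> count_list w a"
  using assms(3)
proof (induction b rule: dec_induct)
  case (step b)
  have "count_list w (Suc b) \<le> count_list w b"
    using assms(1,2) step by (auto simp: lattice_word_def dest: spec[of _ "length w"])
  with step show ?case by simp
qed simp

text \<open>Read as a standard Young tableau, a lattice word records the row of each entry, and
  \<open>running_count\<close> records its column.\<close>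

definition running_count :: "'a list \<Rightarrow> nat list" where
  "running_count w = map (\<lambda>j. count_list (take (Suc j) w) (w ! j)) [0..<length w]"

lemma length_running_count [simp]: "length (running_count w) = length w"
  by (simp add: running_count_def)

lemma running_count_Nil [simp]: "running_count [] = []"
  by (simp add: running_count_def)

lemma running_count_snoc [simp]:
  "running_count (w @ [a]) = running_count w @ [Suc (count_list w a)]"
proof (rule nth_equalityI)
  fix j assume "j < length (running_count (w @ [a]))"
  then consider "j < length w" | "j = length w" by force
  then show "running_count (w @ [a]) ! j = (running_count w @ [Suc (count_list w a)]) ! j"
    by cases (simp_all add: running_count_def nth_append del: upt_Suc)
qed simp

lemma letters_at_running_count: "letters_at c s (running_count s) = id_word (count_list s c)"
  by (induction s rule: rev_induct) (auto simp: id_word_Suc)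

lemma word_sgn_running_count [simp]: "word_sgn s (running_count s) = 1"
  by (simp add: word_sgn_eq_prod letters_at_running_count)

lemma append_le_append_left: "xs @ ys \<le> xs @ zs \<longleftrightarrow> ys \<le> (zs :: 'a::linorder list)"
  by (induction xs) auto

lemma running_count_least:
  assumes "length s = length x"
    and "\<And>c. distinct (letters_at c s x)" "0 \<notin> set x"
  shows "running_count s \<le> x"
  using assms
proof (induction s arbitrary: x rule: rev_induct)
  case (snoc a s)
  obtain z b where x: "x = z @ [b]" and z: "length s = length z"
    using snoc.prems(1) by (metis length_Suc_conv_rev)
  have letters: "distinct (letters_at c s z)" "b \<notin> set (letters_at a s z)" "b \<noteq> 0" for c
    using snoc.prems(2)[of c] snoc.prems(2)[of a] snoc.prems(3) z by (auto simp: x split: if_splits)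
  have "running_count s \<le> z" by (rule snoc.IH) (use z x letters snoc.prems(3) in auto)
  then consider "running_count s < z" | "z = running_count s" by force
  then show ?case
  proof cases
    case 1
    then have "running_count (s @ [a]) < z @ [b]"
      unfolding list_less_def by (simp add: lexord_sufI z)
    then show ?thesis by (simp add: x)
  next
    case 2
    then have "Suc (count_list s a) \<le> b"
      using letters(2,3) by (auto simp: letters_at_running_count)
    then show ?thesis
      unfolding x 2 running_count_snoc append_le_append_left by (simp add: le_less)
  qed
qed simp

lemma word_sgn_nonzero_imp_running_count_le:
  assumes "word_sgn s x \<noteq> 0" "length x = length s"
  shows "running_count s \<le> x"
proof (rule running_count_least)
  have "count_list x 0 = (\<Sum>c\<in>set s. count_list (letters_at c s x) 0)"
    by (rule count_list_letters_at) (use assms(2) in auto)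
  then have "count_list x 0 = 0"
    using word_sgn_nonzeroD[OF assms] by simp
  then show "0 \<notin> set x" by (simp add: count_list_0_iff)
qed (use word_sgn_nonzeroD[OF assms] assms(2) in auto)

lemma count_list_word_sgn_nonzero:
  assumes "word_sgn s x \<noteq> 0" "length x = length s"
  shows "count_list x i = (if i = 0 then 0 else card {c \<in> set s. i \<le> count_list s c})"
proof -
  have "count_list x i = (\<Sum>c\<in>set s. count_list (letters_at c s x) i)"
    by (rule count_list_letters_at) (use assms in auto)
  also have "\<dots> = (\<Sum>c\<in>set s. if 1 \<le> i \<and> i \<le> count_list s c then 1 else 0)"
    using word_sgn_nonzeroD[OF assms] by (intro sum.cong refl) (simp add: count_list_distinct)
  also have "\<dots> = (if i = 0 then 0 else card {c \<in> set s. i \<le> count_list s c})"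
    by (auto simp: sum.If_cases Int_def)
  finally show ?thesis .
qed

lemma count_list_running_count:
  "count_list (running_count s) i = (if i = 0 then 0 else card {c \<in> set s. i \<le> count_list s c})"
  for s :: "nat list"
  by (rule count_list_word_sgn_nonzero) auto

lemma lattice_word_snoc_superlevel:
  assumes "lattice_word (w @ [a])" "0 \<notin> set w" "a \<ge> 1"
  shows "{c \<in> set w. Suc (count_list w a) \<le> count_list w c} = {1..<a}"
proof (intro equalityI subsetI)
  have w: "lattice_word w" using assms(1) by (simp add: lattice_word_snoc)
  fix c
  {
    assume c: "c \<in> {c \<in> set w. Suc (count_list w a) \<le> count_list w c}"
    then have "c \<noteq> 0" using assms(2) by (auto intro: ccontr)
    moreover have "\<not> a \<le> c"
      using lattice_word_count_antimono[OF w assms(3), of c] c by auto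
    ultimately show "c \<in> {1..<a}" by simp
  next
    assume c: "c \<in> {1..<a}"
    then have "Suc (a - 1) = a" "c \<le> a - 1" by auto
    then have "count_list w a < count_list w (a - 1)"
      using assms(1) c unfolding lattice_word_snoc by (metis atLeastLessThan_iff le_trans)
    also have "\<dots> \<le> count_list w c"
      using lattice_word_count_antimono[OF w] c \<open>c \<le> a - 1\<close> by simp
    finally have "count_list w a < count_list w c" .
    moreover from this have "c \<in> set w" by (metis count_list_0_iff not_less_zero)
    ultimately show "c \<in> {c \<in> set w. Suc (count_list w a) \<le> count_list w c}" by simp
  }
qed

lemma running_count_running_count:
  assumes "lattice_word w" "0 \<notin> set w"
  shows "running_count (running_count w) = w"
  using assms
proof (induction w rule: rev_induct)
  case (snoc a w)
  have "0 \<notin> set w" "a \<ge> 1" using snoc.prems(2) by (auto simp: Suc_le_eq)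
  moreover have "running_count (running_count w) = w"
    using snoc by (simp add: lattice_word_snoc)
  ultimately show ?case
    using lattice_word_snoc_superlevel[OF snoc.prems(1)] by (simp add: count_list_running_count)
qed simp

lemma lattice_word_running_count: "lattice_word (running_count w)" for w :: "nat list"
proof (induction w rule: rev_induct)
  case (snoc a w)
  have "count_list (running_count w) (Suc i) < count_list (running_count w) i"
    if "i \<ge> 1" "count_list w a = i" for i
  proof -
    have "a \<in> set w" using that count_list_0_iff[of w a] by linarith
    then have "a \<in> {c \<in> set w. i \<le> count_list w c} - {c \<in> set w. Suc i \<le> count_list w c}"
      using that by simp
    then have "{c \<in> set w. Suc i \<le> count_list w c} \<subset> {c \<in> set w. i \<le> count_list w c}"
      using Suc_leD by blast
    then show ?thesis
      using that by (simp add: count_list_running_count psubset_card_mono)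
  qed
  with snoc show ?case by (auto simp: lattice_word_snoc)
qed simp

section \<open>Partitions\<close>

definition part :: "nat list \<Rightarrow> nat \<Rightarrow> nat" where
  "part p i = (if 1 \<le> i \<and> i \<le> length p then p ! (i - 1) else 0)"

lemma prod_lessThan_length_eq_prod_part:
  fixes h :: "nat \<Rightarrow> 'a::comm_monoid_mult"
  shows "(\<Prod>j<length p. h (Suc j) ^ (p ! j)) = (\<Prod>i\<in>{1..length p}. h i ^ part p i)"
  by (rule prod.reindex_bij_witness[of _ "\<lambda>i. i - 1" Suc]) (auto simp: part_def)

lemma sum_list_eq_sum_part: "sum_list p = (\<Sum>i\<in>{1..length p}. part p i)"
proof -
  have "sum_list p = (\<Sum>i<length p. p ! i)" by (simp add: sum_list_sum_nth atLeast0LessThan)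
  also have "\<dots> = (\<Sum>i\<in>{1..length p}. part p i)"
    by (rule sum.reindex_bij_witness[of _ "\<lambda>i. i - 1" Suc]) (auto simp: part_def)
  finally show ?thesis .
qed

lemma in_words_iff: "w \<in> words \<alpha> \<longleftrightarrow> (\<forall>i. count_list w i = part \<alpha> i)"
proof
  assume w: "w \<in> words \<alpha>"
  show "\<forall>i. count_list w i = part \<alpha> i"
  proof
    fix i
    show "count_list w i = part \<alpha> i"
    proof (cases "i \<in> {1..length \<alpha>}")
      case False
      then have "i \<notin> set w" using w by (auto simp: words_def)
      then show ?thesis using False by (auto simp: part_def count_list_0_iff)
    qed (use w in \<open>auto simp: words_def part_def\<close>)
  qed
next
  assume w: "\<forall>i. count_list w i = part \<alpha> i"
  have sub: "set w \<subseteq> {1..length \<alpha>}"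
  proof
    fix i assume "i \<in> set w"
    then have "part \<alpha> i \<noteq> 0" using w by (metis count_list_0_iff)
    then show "i \<in> {1..length \<alpha>}" by (auto simp: part_def split: if_splits)
  qed
  have "length w = (\<Sum>i\<in>set w. count_list w i)" by (simp add: sum_count_set[symmetric])
  also have "\<dots> = (\<Sum>i\<in>{1..length \<alpha>}. count_list w i)"
    by (rule sum.mono_neutral_left) (use sub in \<open>auto simp: count_list_0_iff\<close>)
  finally have "length w = sum_list \<alpha>" using w by (simp add: sum_list_eq_sum_part)
  then show "w \<in> words \<alpha>" using w sub by (auto simp: words_def part_def)
qed

lemma finite_words: "finite (words \<alpha>)"
  by (rule finite_subset[OF _ finite_nlists[of "{1..length \<alpha>}" "sum_list \<alpha>"]])
    (auto simp: words_def intro!: nlistsI)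

lemma part_conjugate_partition:
  assumes "j \<ge> 1"
  shows "part (conjugate_partition p) j = length (filter (\<lambda>x. j \<le> x) p)"
proof (cases "j \<le> Max (insert 0 (set p))")
  case False
  then have "filter (\<lambda>x. j \<le> x) p = []"
    by (auto simp: filter_empty_conv)
      (metis Max_ge List.finite_set finite_insert insertCI order_trans)
  then show ?thesis using False by (simp add: part_def conjugate_partition_def)
next
  case True
  then have "[1..<Suc (Max (insert 0 (set p)))] ! (j - 1) = j"
    using assms by (subst nth_upt) auto
  then show ?thesis
    using True assms by (simp add: part_def conjugate_partition_def del: upt_Suc)
qed

lemma part_conjugate_eq_card:
  assumes "j \<ge> 1"
  shows "part (conjugate_partition p) j = card {c. c \<ge> 1 \<and> j \<le> part p c}"
proof -
  have "{c. c \<ge> 1 \<and> j \<le> part p c} = Suc ` {k. k < length p \<and> j \<le> p ! k}"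
  proof (intro equalityI subsetI)
    fix c assume "c \<in> {c. c \<ge> 1 \<and> j \<le> part p c}"
    then show "c \<in> Suc ` {k. k < length p \<and> j \<le> p ! k}"
      using assms by (cases c) (auto simp: part_def split: if_splits)
  qed (auto simp: part_def)
  then show ?thesis
    using assms by (simp add: part_conjugate_partition length_filter_conv_card card_image)
qed

lemma sum_length_filter_ge:
  "\<forall>x\<in>set p. x \<le> M \<Longrightarrow> (\<Sum>j\<in>{1..M}. length (filter (\<lambda>x. j \<le> x) p)) = sum_list p"
proof (induction p)
  case (Cons x p)
  have "(\<Sum>j\<in>{1..M}. length (filter (\<lambda>y. j \<le> y) (x # p)))
      = (\<Sum>j\<in>{1..M}. (if j \<le> x then 1 else 0) + length (filter (\<lambda>y. j \<le> y) p))"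
    by (rule sum.cong) auto
  also have "\<dots> = card {j \<in> {1..M}. j \<le> x} + sum_list p"
    using Cons by (simp add: sum.distrib flip: sum.inter_filter)
  also have "{j \<in> {1..M}. j \<le> x} = {1..x}" using Cons.prems by auto
  finally show ?case by simp
qed simp

lemma sum_list_conjugate_partition: "sum_list (conjugate_partition p) = sum_list p"
proof -
  have "sum_list (conjugate_partition p)
      = (\<Sum>j\<in>{1..Max (insert 0 (set p))}. length (filter (\<lambda>x. j \<le> x) p))"
    unfolding conjugate_partition_def
    by (subst sum_list_distinct_conv_sum_set)
      (simp_all add: atLeastLessThanSuc_atLeastAtMost del: upt_Suc)
  also have "\<dots> = sum_list p" by (rule sum_length_filter_ge) auto
  finally show ?thesis .
qed

lemma length_filter_ge_iff:
  fixes p :: "'a::linorder list"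
  assumes "sorted_wrt (\<ge>) p" "k < length p"
  shows "k < length (filter (\<lambda>x. c \<le> x) p) \<longleftrightarrow> c \<le> p ! k"
proof -
  have antimono: "p ! j \<le> p ! i" if "i \<le> j" "j < length p" for i j
    using assms(1) that by (cases "i = j") (auto simp: sorted_wrt_iff_nth_less)
  have card: "length (filter (\<lambda>x. c \<le> x) p) = card {i. i < length p \<and> c \<le> p ! i}"
    by (rule length_filter_conv_card)
  show ?thesis
  proof
    assume "c \<le> p ! k"
    then have "{..k} \<subseteq> {i. i < length p \<and> c \<le> p ! i}"
      using antimono[of _ k] assms(2) by (auto intro: order_trans)
    then have "card {..k} \<le> length (filter (\<lambda>x. c \<le> x) p)"
      unfolding card by (intro card_mono) auto
    then show "k < length (filter (\<lambda>x. c \<le> x) p)" by simp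
  next
    assume less: "k < length (filter (\<lambda>x. c \<le> x) p)"
    show "c \<le> p ! k"
    proof (rule ccontr)
      assume "\<not> c \<le> p ! k"
      then have "{i. i < length p \<and> c \<le> p ! i} \<subseteq> {..<k}"
        using antimono[of k] by (auto simp: not_le[symmetric]) (meson not_le order_trans)
      then have "length (filter (\<lambda>x. c \<le> x) p) \<le> card {..<k}"
        unfolding card by (intro card_mono) auto
      with less show False by simp
    qed
  qed
qed

lemma part_eq_card_conjugate:
  assumes "sorted_wrt (\<ge>) p" "i \<ge> 1"
  shows "part p i = card {c. c \<ge> 1 \<and> i \<le> part (conjugate_partition p) c}"
proof (cases "i \<le> length p")
  case True
  have "{c. c \<ge> 1 \<and> i \<le> part (conjugate_partition p) c} = {1..p ! (i - 1)}"
  proof (rule Set.set_eqI)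
    fix c
    have "i \<le> length (filter (\<lambda>x. c \<le> x) p) \<longleftrightarrow> c \<le> p ! (i - 1)"
      using length_filter_ge_iff[OF assms(1), of "i - 1" c] True assms(2) by linarith
    then show "c \<in> {c. c \<ge> 1 \<and> i \<le> part (conjugate_partition p) c} \<longleftrightarrow> c \<in> {1..p ! (i - 1)}"
      by (auto simp: part_conjugate_partition)
  qed
  then show ?thesis using True assms(2) by (simp add: part_def)
next
  case False
  have "\<not> i \<le> part (conjugate_partition p) c" if "c \<ge> 1" for c
    using False length_filter_le[of "\<lambda>x. c \<le> x" p] part_conjugate_partition[OF that, of p]
    by linarith
  then have "{c. c \<ge> 1 \<and> i \<le> part (conjugate_partition p) c} = {}" by auto
  then show ?thesis using False by (simp add: part_def)
qed

lemma words_superlevel: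
  assumes "w \<in> words \<alpha>" "i \<ge> 1"
  shows "{c \<in> set w. i \<le> count_list w c} = {c. c \<ge> 1 \<and> i \<le> part \<alpha> c}"
proof (intro Collect_cong)
  fix c
  have "count_list w c = part \<alpha> c" using assms by (simp add: in_words_iff)
  then show "c \<in> set w \<and> i \<le> count_list w c \<longleftrightarrow> 1 \<le> c \<and> i \<le> part \<alpha> c"
    using assms(2) count_list_0_iff[of w c] by (cases "c = 0") (auto simp: part_def)
qed

lemma word_sgn_nonzero_imp_words:
  assumes "s \<in> words (conjugate_partition p)" "sorted_wrt (\<ge>) p"
    and "word_sgn s x \<noteq> 0" "length x = length s"
  shows "x \<in> words p"
  unfolding in_words_iff
proof
  fix i
  show "count_list x i = part p i"
  proof (cases "i = 0")
    case False
    then show ?thesis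
      using count_list_word_sgn_nonzero[OF assms(3,4)] words_superlevel[OF assms(1), of i]
        part_eq_card_conjugate[OF assms(2), of i] by simp
  qed (use count_list_word_sgn_nonzero[OF assms(3,4)] in \<open>simp add: part_def\<close>)
qed

lemma running_count_in_words:
  assumes "w \<in> words p"
  shows "running_count w \<in> words (conjugate_partition p)"
  unfolding in_words_iff
proof
  fix i
  show "count_list (running_count w) i = part (conjugate_partition p) i"
  proof (cases "i = 0")
    case False
    then show ?thesis
      using words_superlevel[OF assms, of i]
      by (simp add: count_list_running_count part_conjugate_eq_card)
  qed (simp add: count_list_running_count part_def)
qed

section \<open>Raising operators\<close>

definition raising :: "nat \<Rightarrow> (nat list \<Rightarrow> 'a::comm_semiring_1) \<Rightarrow> nat list \<Rightarrow> 'a" where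
  "raising i w y = (\<Sum>j | j < length y \<and> y ! j = i. w (y[j := Suc i]))"

lemma raising_Nil [simp]: "raising i w [] = 0"
  by (simp add: raising_def)

lemma raising_append:
  "raising i w (x @ y) = raising i (\<lambda>z. w (z @ y)) x + raising i (\<lambda>z. w (x @ z)) y"
proof -
  let ?J = "\<lambda>y. {j. j < length y \<and> y ! j = i}"
  have J: "?J (x @ y) = ?J x \<union> (+) (length x) ` ?J y"
  proof (intro equalityI subsetI)
    fix j assume "j \<in> ?J (x @ y)"
    then show "j \<in> ?J x \<union> (+) (length x) ` ?J y"
      by (cases "j < length x") (auto simp: nth_append image_iff intro!: exI[of _ "j - length x"])
  qed (auto simp: nth_append)
  have "raising i w (x @ y) = (\<Sum>j\<in>?J x. w ((x @ y)[j := Suc i]))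
      + (\<Sum>j\<in>(+) (length x) ` ?J y. w ((x @ y)[j := Suc i]))"
    unfolding raising_def J by (rule sum.union_disjoint) auto
  also have "(\<Sum>j\<in>?J x. w ((x @ y)[j := Suc i])) = raising i (\<lambda>z. w (z @ y)) x"
    unfolding raising_def by (rule sum.cong) (auto simp: list_update_append)
  also have "(\<Sum>j\<in>(+) (length x) ` ?J y. w ((x @ y)[j := Suc i])) = raising i (\<lambda>z. w (x @ z)) y"
    unfolding raising_def by (subst sum.reindex) (auto simp: list_update_append)
  finally show ?thesis .
qed

lemma raising_singleton: "raising i w [a] = (if a = i then w [Suc i] else 0)"
proof -
  have "{j. j < length [a] \<and> [a] ! j = i} = (if a = i then {0} else {})" by auto
  then show ?thesis by (simp add: raising_def)
qed

lemma raising_Cons: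
  "raising i w (a # y) = (if a = i then w (Suc i # y) else 0) + raising i (\<lambda>x. w (a # x)) y"
  using raising_append[of i w "[a]" y] by (simp add: raising_singleton)

lemma raising_snoc:
  "raising i w (y @ [a]) = raising i (\<lambda>x. w (x @ [a])) y + (if a = i then w (y @ [Suc i]) else 0)"
  by (simp add: raising_append raising_singleton)

lemma raising_add: "raising i (\<lambda>x. f x + g x) y = raising i f y + raising i g y"
  by (simp add: raising_def sum.distrib)

lemma raising_cmult: "raising i (\<lambda>x. c * f x) y = c * raising i f y"
  by (simp add: raising_def sum_distrib_left)

lemma raising_cong:
  assumes "\<And>x. x \<in> nlists (length y) I \<Longrightarrow> f x = g x" "set y \<subseteq> I" "Suc i \<in> I"
  shows "raising i f y = raising i g y"
  unfolding raising_def
  by (intro sum.cong refl assms(1) nlists_update_in_list nlistsI assms)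

lemma raising_funpow_cong:
  assumes "\<And>x. x \<in> nlists l I \<Longrightarrow> f x = g x" "Suc i \<in> I" "y \<in> nlists l I"
  shows "(raising i ^^ k) f y = (raising i ^^ k) g y"
  using assms(3)
proof (induction k arbitrary: y)
  case (Suc k)
  have "raising i ((raising i ^^ k) f) y = raising i ((raising i ^^ k) g) y"
    by (rule raising_cong[where I = I]) (use Suc assms(2) nlistsE_set in auto)
  then show ?case by simp
qed (use assms(1) in simp)

lemma raising_funpow_zero [simp]: "(raising i ^^ k) (\<lambda>x. 0) = (\<lambda>x. 0)"
  by (induction k) (auto simp: raising_def)

lemma raising_funpow_add:
  "(raising i ^^ k) (\<lambda>x. f x + g x) = (\<lambda>x. (raising i ^^ k) f x + (raising i ^^ k) g x)"
  by (induction k) (auto simp: raising_add)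

lemma raising_funpow_Cons:
  "(raising i ^^ k) w (a # y) = (raising i ^^ k) (\<lambda>x. w (a # x)) y
     + (if a = i then of_nat k * (raising i ^^ (k - 1)) (\<lambda>x. w (Suc i # x)) y else 0)"
proof (induction k arbitrary: w)
  case (Suc k)
  have slice: "(\<lambda>x. raising i w (b # x))
      = (\<lambda>x. (if b = i then w (Suc i # x) else 0) + raising i (\<lambda>x. w (b # x)) x)" for b
    by (simp add: raising_Cons)
  have shift: "of_nat k * (raising i ^^ (k - 1)) (raising i f) y = of_nat k * (raising i ^^ k) f y"
    for f :: "nat list \<Rightarrow> 'a"
    by (cases k) (simp_all add: funpow_swap1)
  have "(raising i ^^ Suc k) w (a # y) = (raising i ^^ k) (raising i w) (a # y)"
    by (simp add: funpow_swap1)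
  also have "\<dots> = (raising i ^^ k) (\<lambda>x. raising i w (a # x)) y
      + (if a = i then of_nat k * (raising i ^^ (k - 1)) (\<lambda>x. raising i w (Suc i # x)) y else 0)"
    by (rule Suc)
  also have "\<dots> = (raising i ^^ Suc k) (\<lambda>x. w (a # x)) y
      + (if a = i then of_nat (Suc k) * (raising i ^^ k) (\<lambda>x. w (Suc i # x)) y else 0)"
    unfolding slice raising_funpow_add by (simp add: shift[simplified] funpow_swap1 algebra_simps)
  finally show ?case by simp
qed simp

lemma raising_funpow_zero_slices:
  fixes w :: "nat list \<Rightarrow> 'a::{idom,ring_char_0}"
  assumes zero: "\<forall>y\<in>nlists (Suc l) I. (raising i ^^ Suc k) w y = 0"
    and I: "i \<in> I" "Suc i \<in> I" and x: "x \<in> nlists l I"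
  shows "a \<in> I \<Longrightarrow> a \<noteq> i \<Longrightarrow> (raising i ^^ Suc k) (\<lambda>x. w (a # x)) x = 0"
    and "(raising i ^^ Suc (Suc k)) (\<lambda>x. w (i # x)) x = 0"
    and "\<forall>z\<in>nlists l I. w (i # z) = 0 \<Longrightarrow> (raising i ^^ k) (\<lambda>x. w (Suc i # x)) x = 0"
proof -
  have slice: "(raising i ^^ Suc k) (\<lambda>x. w (a # x)) x
      + (if a = i then of_nat (Suc k) * (raising i ^^ k) (\<lambda>x. w (Suc i # x)) x else 0) = 0"
    if "a \<in> I" "x \<in> nlists l I" for a x
    using bspec[OF zero, of "a # x"] that
    by (simp only: raising_funpow_Cons diff_Suc_1 Cons_in_nlists_Suc simp_thms)
  show "(raising i ^^ Suc k) (\<lambda>x. w (a # x)) x = 0" if "a \<in> I" "a \<noteq> i"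
    using slice[OF that(1) x] that(2) by (simp del: funpow.simps)
  have "(raising i ^^ Suc (Suc k)) (\<lambda>x. w (i # x)) x
      = raising i (\<lambda>x. - of_nat (Suc k) * (raising i ^^ k) (\<lambda>x. w (Suc i # x)) x) x"
    unfolding funpow.simps(2)[of "Suc k"] o_apply
    by (rule raising_cong[OF _ nlistsE_set[OF x] I(2)])
      (use slice[OF I(1)] x in \<open>simp add: add_eq_0_iff2 del: funpow.simps of_nat_Suc\<close>)
  also have "\<dots> = - of_nat (Suc k) * (raising i ^^ Suc k) (\<lambda>x. w (Suc i # x)) x"
    by (simp only: raising_cmult funpow.simps o_apply)
  finally show "(raising i ^^ Suc (Suc k)) (\<lambda>x. w (i # x)) x = 0"
    using slice[OF I(2) x] by (simp del: funpow.simps of_nat_Suc)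
  assume low: "\<forall>z\<in>nlists l I. w (i # z) = 0"
  have "(raising i ^^ Suc k) (\<lambda>x. w (i # x)) x = (raising i ^^ Suc k) (\<lambda>x. 0) x"
    by (rule raising_funpow_cong[OF _ I(2) x]) (use low in blast)
  then show "(raising i ^^ k) (\<lambda>x. w (Suc i # x)) x = 0"
    using slice[OF I(1) x] by (simp del: of_nat_Suc funpow.simps)
qed

text \<open>In terms of \<open>sl\<^sub>2\<close>: the \<open>k\<close>-th power of the raising operator is injective on weights at
  most \<open>-k\<close>. Removing a first letter \<open>i\<close> or \<open>i + 1\<close> shifts the weight and the exponent alike.\<close>

lemma raising_funpow_injective:
  fixes w :: "nat list \<Rightarrow> 'a::{idom,ring_char_0}"
  assumes I: "i \<in> I" "Suc i \<in> I"
    and zero: "\<And>y. y \<in> nlists l I \<Longrightarrow> (raising i ^^ k) w y = 0"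
    and weight: "\<And>y. y \<in> nlists l I \<Longrightarrow> w y \<noteq> 0 \<Longrightarrow> count_list y i + k \<le> count_list y (Suc i)"
    and y: "y \<in> nlists l I"
  shows "w y = 0"
  using zero weight y
proof (induction l arbitrary: w k y)
  case 0
  then show ?case by (cases k) auto
next
  case (Suc l)
  show ?case
  proof (cases k)
    case 0
    then show ?thesis using Suc.prems by simp
  next
    case (Suc k')
    have zero: "\<forall>y\<in>nlists (Suc l) I. (raising i ^^ Suc k') w y = 0"
      using Suc.prems(1) unfolding Suc by blast
    note slices = raising_funpow_zero_slices[OF zero I]
    have weight: "count_list (a # x) i + Suc k' \<le> count_list (a # x) (Suc i)"
      if "a \<in> I" "x \<in> nlists l I" "w (a # x) \<noteq> 0" for a x
      using Suc.prems(2)[of "a # x"] that Suc by simp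
    have other: "w (a # x) = 0" if "a \<in> I" "a \<noteq> i" "a \<noteq> Suc i" "x \<in> nlists l I" for a x
      by (rule Suc.IH[of "Suc k'" "\<lambda>x. w (a # x)"])
        (use slices(1) weight[of a] that in \<open>simp_all del: funpow.simps\<close>)
    have low: "w (i # x) = 0" if "x \<in> nlists l I" for x
      by (rule Suc.IH[of "Suc (Suc k')" "\<lambda>x. w (i # x)"])
        (use slices(2) weight[OF I(1)] that in \<open>simp_all del: funpow.simps\<close>)
    have high: "w (Suc i # x) = 0" if "x \<in> nlists l I" for x
      by (rule Suc.IH[of k' "\<lambda>x. w (Suc i # x)"])
        (use slices(3) low weight[OF I(2)] that in \<open>simp_all del: funpow.simps\<close>)
    show ?thesis
      using Suc.prems(3) other low high unfolding in_nlists_Suc_iff by blast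
  qed
qed

corollary raising_injective:
  fixes w :: "nat list \<Rightarrow> 'a::{idom,ring_char_0}"
  assumes "i \<in> I" "Suc i \<in> I" "\<And>y. y \<in> nlists l I \<Longrightarrow> raising i w y = 0"
    and "\<And>y. y \<in> nlists l I \<Longrightarrow> w y \<noteq> 0 \<Longrightarrow> count_list y i < count_list y (Suc i)"
    and "y \<in> nlists l I"
  shows "w y = 0"
  by (rule raising_funpow_injective[where k = 1]) (use assms in \<open>auto simp: Suc_le_eq\<close>)

lemma lattice_slices_eq_zero:
  fixes w :: "nat list \<Rightarrow> 'a::{idom,ring_char_0}"
  assumes weight: "\<And>y i. y \<in> nlists (Suc l) {1..n} \<Longrightarrow> w y \<noteq> 0 \<Longrightarrow> count_list y i = \<mu> i"
    and raising: "\<And>y i. y \<in> nlists (Suc l) {1..n} \<Longrightarrow> 1 \<le> i \<Longrightarrow> i < n \<Longrightarrow> raising i w y = 0"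
    and lattice: "\<And>y. y \<in> nlists (Suc l) {1..n} \<Longrightarrow> lattice_word y \<Longrightarrow> w y = 0"
    and y: "y @ [r] \<in> nlists (Suc l) {1..n}" "lattice_word y"
  shows "w (y @ [r]) = 0"
proof (rule ccontr)
  assume nz: "w (y @ [r]) \<noteq> 0"
  then have "\<not> lattice_word (y @ [r])" using lattice[OF y(1)] by blast
  with y(2) obtain i where i: "i \<ge> 1" "r = Suc i" "count_list y i \<le> count_list y (Suc i)"
    by (auto simp: lattice_word_snoc not_less)
  have "r \<in> {1..n}" using nlistsE_set[OF y(1)] by simp
  then have letters: "i \<in> {1..n}" "Suc i \<in> {1..n}" using i by simp_all
  have "count_list (y @ [r]) i < count_list (y @ [r]) (Suc i)" using i by simp
  then have \<mu>: "\<mu> i < \<mu> (Suc i)" by (simp only: weight[OF y(1) nz])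
  have "w (y @ [r]) = 0"
  proof (rule raising_injective[OF letters _ _ y(1)])
    fix z assume z: "z \<in> nlists (Suc l) {1..n}"
    show "raising i w z = 0" using raising[OF z i(1)] letters(2) by simp
    show "count_list z i < count_list z (Suc i)" if "w z \<noteq> 0"
      using \<mu> by (simp only: weight[OF z that])
  qed
  with nz show False by contradiction
qed

lemma largest_last_letter_nonzero:
  fixes w :: "nat list \<Rightarrow> 'a::zero"
  assumes "y \<in> nlists (Suc l) {1..n}" "w y \<noteq> 0"
  obtains x r where "x \<in> nlists l {1..n}" "r \<in> {1..n}" "w (x @ [r]) \<noteq> 0"
    "\<forall>x\<in>nlists l {1..n}. \<forall>a\<in>{1..n}. r < a \<longrightarrow> w (x @ [a]) = 0"
proof -
  define K where "K = {a \<in> {1..n}. \<exists>x\<in>nlists l {1..n}. w (x @ [a]) \<noteq> 0}"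
  obtain x a where "y = x @ [a]" "length x = l"
    using assms(1) by (metis length_Suc_conv_rev nlistsE_length)
  with assms have "a \<in> K" by (auto simp: K_def nlists_append)
  then have K: "finite K" "K \<noteq> {}" by (auto simp: K_def)
  from Max_in[OF K] obtain z where "z \<in> nlists l {1..n}" "Max K \<in> {1..n}" "w (z @ [Max K]) \<noteq> 0"
    by (auto simp: K_def)
  moreover have "w (x @ [a]) = 0" if "x \<in> nlists l {1..n}" "a \<in> {1..n}" "Max K < a" for x a
  proof (rule ccontr)
    assume "w (x @ [a]) \<noteq> 0"
    then have "a \<in> K" using that by (auto simp: K_def)
    from Max_ge[OF K(1) this] that(3) show False by simp
  qed
  ultimately show ?thesis by (intro that) auto
qed

text \<open>Among the slices of \<open>w\<close> by the last letter, the nonzero one with the largest letter is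
  again killed by all raising operators.\<close>

lemma highest_weight_eq_zero:
  fixes w :: "nat list \<Rightarrow> 'a::{idom,ring_char_0}"
  assumes "\<And>y i. y \<in> nlists l {1..n} \<Longrightarrow> w y \<noteq> 0 \<Longrightarrow> count_list y i = \<mu> i"
    and "\<And>y i. y \<in> nlists l {1..n} \<Longrightarrow> 1 \<le> i \<Longrightarrow> i < n \<Longrightarrow> raising i w y = 0"
    and "\<And>y. y \<in> nlists l {1..n} \<Longrightarrow> lattice_word y \<Longrightarrow> w y = 0"
    and "y \<in> nlists l {1..n}"
  shows "w y = 0"
  using assms
proof (induction l arbitrary: w \<mu> y)
  case 0
  from 0(4) have "y = []" by simp
  with 0(3)[of y] show ?case by simp
next
  case (Suc l)
  show ?case
  proof (rule ccontr)
    assume "w y \<noteq> 0"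
    then obtain x r where x: "x \<in> nlists l {1..n}" and r: "r \<in> {1..n}" and nz: "w (x @ [r]) \<noteq> 0"
      and above: "\<forall>x\<in>nlists l {1..n}. \<forall>a\<in>{1..n}. r < a \<longrightarrow> w (x @ [a]) = 0"
      by (rule largest_last_letter_nonzero[OF Suc.prems(4)])
    have snoc: "y @ [r] \<in> nlists (Suc l) {1..n}" if "y \<in> nlists l {1..n}" for y
      using that r by (intro nlistsI) auto
    have "w (x @ [r]) = 0"
    proof (rule Suc.IH[of "\<lambda>x. w (x @ [r])" "\<mu>(r := \<mu> r - 1)", OF _ _ _ x])
      fix y i assume y: "y \<in> nlists l {1..n}"
      show "count_list y i = (\<mu>(r := \<mu> r - 1)) i" if "w (y @ [r]) \<noteq> 0"
        using Suc.prems(1)[OF snoc[OF y] that, of i] by (cases "i = r") auto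
      show "raising i (\<lambda>x. w (x @ [r])) y = 0" if "1 \<le> i" "i < n"
        using Suc.prems(2)[OF snoc[OF y] that] above y that
        by (auto simp: raising_snoc split: if_splits)
      show "w (y @ [r]) = 0" if "lattice_word y"
        by (rule lattice_slices_eq_zero[OF Suc.prems(1-3) snoc[OF y] that])
    qed
    with nz show False by contradiction
  qed
qed

section \<open>Transvections\<close>

definition transvection :: "nat \<Rightarrow> 'a::comm_semiring_1 \<Rightarrow> nat \<Rightarrow> nat \<Rightarrow> 'a" where
  "transvection i z a b = (if a = b then 1 else if a = i \<and> b = Suc i then z else 0)"

lemma tensor_act_transvection_zero:
  fixes F :: "nat list \<Rightarrow> 'a::comm_semiring_1"
  assumes "finite I" "set y \<subseteq> I"
  shows "tensor_act I (transvection i 0) F y = F y"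
proof -
  have "(\<Prod>a\<leftarrow>y. transvection i 0 a a) = (1::'a)"
    by (induction y) (auto simp: transvection_def)
  then show ?thesis
    using assms by (subst tensor_act_diagonal) (auto simp: transvection_def)
qed

lemma tensor_act_transvection_Cons:
  assumes "finite I" "a \<in> I" "Suc i \<in> I"
  shows "tensor_act I (transvection i z) F (a # y)
    = tensor_act I (transvection i z) (\<lambda>x. F (a # x)) y
    + (if a = i then z * tensor_act I (transvection i z) (\<lambda>x. F (Suc i # x)) y else 0)"
proof -
  let ?A = "\<lambda>b. tensor_act I (transvection i z) (\<lambda>x. F (b # x)) y"
  have "tensor_act I (transvection i z) F (a # y)
      = (\<Sum>b\<in>I. (if b = a then ?A a else 0)
        + (if b = Suc i then (if a = i then z * ?A (Suc i) else 0) else 0))"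
    unfolding tensor_act_Cons by (rule sum.cong) (auto simp: transvection_def)
  also have "\<dots> = ?A a + (if a = i then z * ?A (Suc i) else 0)"
    using assms by (simp add: sum.distrib)
  finally show ?thesis .
qed

lemma has_field_derivative_tensor_act_transvection:
  fixes F :: "nat list \<Rightarrow> 'a::real_normed_field"
  assumes "finite I" "Suc i \<in> I" "set y \<subseteq> I"
  shows "((\<lambda>z. tensor_act I (transvection i z) F y) has_field_derivative raising i F y) (at 0)"
  using assms(3)
proof (induction y arbitrary: F)
  case (Cons a y)
  let ?A = "\<lambda>b z. tensor_act I (transvection i z) (\<lambda>x. F (b # x)) y"
  have IH: "(?A b has_field_derivative raising i (\<lambda>x. F (b # x)) y) (at 0)" for b
    by (rule Cons.IH) (use Cons.prems in simp)
  have "((\<lambda>z. z * ?A (Suc i) z) has_field_derivative F (Suc i # y)) (at 0)"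
    using DERIV_mult[OF DERIV_ident IH[of "Suc i"]] Cons.prems
    by (simp add: tensor_act_transvection_zero[OF assms(1)])
  then have "((\<lambda>z. if a = i then z * ?A (Suc i) z else 0)
      has_field_derivative (if a = i then F (Suc i # y) else 0)) (at 0)"
    by auto
  from DERIV_add[OF IH[of a] this] show ?case
    using Cons.prems assms
    by (simp add: tensor_act_transvection_Cons raising_Cons add.commute del: tensor_act_Cons)
qed simp

lemma raising_eq_zero_of_invariant:
  fixes F :: "nat list \<Rightarrow> 'a::real_normed_field"
  assumes "finite I" "Suc i \<in> I" "set y \<subseteq> I"
    and "\<And>z. tensor_act I (transvection i z) F y = F y"
  shows "raising i F y = 0"
  using has_field_derivative_tensor_act_transvection[OF assms(1-3), of F] unfolding assms(4)
  by (rule DERIV_unique) simp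

section \<open>Rows of a list of columns\<close>

text \<open>A table is mostly given by the list of its columns, which indexes a basis vector of a tensor
  power of \<open>(\<complex>\<^sup>n)\<^bsup>\<otimes>d\<^esup>\<close>; the \<open>k\<close>-th factor \<open>GL(n)\<close> acts through \<open>table_row k\<close>.\<close>

definition table_row :: "nat \<Rightarrow> 'a list list \<Rightarrow> 'a list" where
  "table_row k cs = map (\<lambda>c. c ! k) cs"

definition put_row :: "nat \<Rightarrow> 'a list list \<Rightarrow> 'a list \<Rightarrow> 'a list list" where
  "put_row k cs x = map2 (\<lambda>c a. c[k := a]) cs x"

definition rows_of :: "nat \<Rightarrow> 'a list list \<Rightarrow> 'a list list" where
  "rows_of d cs = map (\<lambda>k. table_row k cs) [0..<d]"

lemma table_row_simps [simp]:
  "table_row k [] = []" "table_row k (c # cs) = c ! k # table_row k cs"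
  "length (table_row k cs) = length cs"
  by (simp_all add: table_row_def)

lemma put_row_simps [simp]:
  "put_row k [] x = []" "put_row k (c # cs) (a # x) = c[k := a] # put_row k cs x"
  "length (put_row k cs x) = min (length cs) (length x)"
  by (simp_all add: put_row_def)

lemma table_row_in_nlists:
  "cs \<in> nlists l (nlists d I) \<Longrightarrow> k < d \<Longrightarrow> table_row k cs \<in> nlists l I"
  by (induction l arbitrary: cs) (auto simp: in_nlists_Suc_iff nlistsE_nth_in)

lemma put_row_in_nlists:
  "cs \<in> nlists l (nlists d I) \<Longrightarrow> x \<in> nlists l I \<Longrightarrow> put_row k cs x \<in> nlists l (nlists d I)"
  by (induction l arbitrary: cs x) (auto simp: in_nlists_Suc_iff)

lemma table_row_put_row_same:
  "cs \<in> nlists l (nlists d I) \<Longrightarrow> x \<in> nlists l I \<Longrightarrow> k < d \<Longrightarrow> table_row k (put_row k cs x) = x"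
  by (induction l arbitrary: cs x) (auto simp: in_nlists_Suc_iff)

lemma table_row_put_row_other:
  "length x = length cs \<Longrightarrow> k' \<noteq> k \<Longrightarrow> table_row k' (put_row k cs x) = table_row k' cs"
  by (induction x cs rule: list_induct2) auto

lemma put_row_table_row [simp]: "put_row k cs (table_row k cs) = cs"
  by (induction cs) auto

lemma put_row_put_row:
  assumes "length x = length cs" "length y = length cs"
  shows "put_row k (put_row k cs x) y = put_row k cs y"
  by (rule nth_equalityI) (use assms in \<open>simp_all add: put_row_def\<close>)

lemma transpose_eq_map:
  assumes "T \<in> nlists d (nlists m I)" "d \<ge> 1"
  shows "List.transpose T = map (\<lambda>j. map (\<lambda>k. T ! k ! j) [0..<d]) [0..<m]"
proof -
  have "length T = d" "\<And>k. k < d \<Longrightarrow> length (T ! k) = m"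
    using assms(1) nlistsE_length[OF nlistsE_nth_in[OF assms(1)]] by auto
  then show ?thesis
    using transpose_rectangle[of T m] assms(2) by fastforce
qed

lemma transpose_in_nlists:
  assumes "T \<in> nlists d (nlists m I)" "d \<ge> 1"
  shows "List.transpose T \<in> nlists m (nlists d I)"
proof -
  have "T ! k ! j \<in> I" if "k < d" "j < m" for k j
    using nlistsE_nth_in[OF nlistsE_nth_in[OF assms(1) that(1)] that(2)] .
  then show ?thesis
    unfolding transpose_eq_map[OF assms] by (intro nlistsI) (auto intro!: nlistsI)
qed

lemma table_row_transpose:
  assumes "T \<in> nlists d (nlists m I)" "d \<ge> 1" "k < d"
  shows "table_row k (List.transpose T) = T ! k"
  unfolding transpose_eq_map[OF assms(1,2)]
  by (rule nth_equalityI)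
    (use nlistsE_length[OF nlistsE_nth_in[OF assms(1,3)]] assms(3) in \<open>simp_all add: table_row_def\<close>)

lemma rows_of_in_nlists: "cs \<in> nlists m (nlists d I) \<Longrightarrow> rows_of d cs \<in> nlists d (nlists m I)"
  by (intro nlistsI) (auto simp: rows_of_def intro: table_row_in_nlists)

lemma rows_of_transpose:
  assumes "T \<in> nlists d (nlists m I)" "d \<ge> 1"
  shows "rows_of d (List.transpose T) = T"
  by (rule nth_equalityI) (use assms in \<open>simp_all add: rows_of_def table_row_transpose\<close>)

lemma transpose_rows_of:
  assumes "cs \<in> nlists m (nlists d I)" "d \<ge> 1"
  shows "List.transpose (rows_of d cs) = cs"
proof -
  have len: "length cs = m" "\<And>j. j < m \<Longrightarrow> length (cs ! j) = d"
    using assms(1) nlistsE_length[OF nlistsE_nth_in[OF assms(1)]] by auto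
  show ?thesis
    unfolding transpose_eq_map[OF rows_of_in_nlists[OF assms(1)] assms(2)]
    by (rule nth_equalityI)
      (use len in \<open>auto simp: rows_of_def table_row_def intro!: nth_equalityI\<close>)
qed

lemma bij_betw_transpose:
  "d \<ge> 1 \<Longrightarrow> bij_betw List.transpose (nlists d (nlists m I)) (nlists m (nlists d I))"
  by (rule bij_betw_byWitness[where f' = "rows_of d"])
    (auto simp: rows_of_transpose transpose_rows_of transpose_in_nlists rows_of_in_nlists)

lemma tensor_act_rows:
  fixes u :: "nat \<Rightarrow> 'a \<Rightarrow> 'a \<Rightarrow> 'b::comm_semiring_1"
  shows "tensor_act (nlists d I) (\<lambda>a b. \<Prod>k<d. u k (a ! k) (b ! k))
      (\<lambda>cs. \<Prod>k<d. f k (table_row k cs)) cs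
    = (\<Prod>k<d. tensor_act I (u k) (f k) (table_row k cs))"
proof (induction cs arbitrary: f)
  case (Cons a cs)
  let ?h = "\<lambda>k q. u k (a ! k) q * tensor_act I (u k) (\<lambda>x. f k (q # x)) (table_row k cs)"
  have "tensor_act (nlists d I) (\<lambda>a b. \<Prod>k<d. u k (a ! k) (b ! k))
        (\<lambda>cs. \<Prod>k<d. f k (table_row k cs)) (a # cs)
      = (\<Sum>b\<in>nlists d I. \<Prod>k<d. ?h k (b ! k))"
    using Cons[of "\<lambda>k x. f k (b ! k # x)" for b] by (simp add: prod.distrib)
  also have "\<dots> = (\<Prod>k<d. \<Sum>q\<in>I. ?h k q)"
    by (rule sum_nlists_prod)
  finally show ?case by simp
qed simp

lemma bij_betw_list_update:
  assumes "a \<in> nlists d I" "k < d"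
  shows "bij_betw (\<lambda>q. a[k := q]) I {b \<in> nlists d I. \<forall>l<d. l \<noteq> k \<longrightarrow> b ! l = a ! l}"
proof (rule bij_betw_byWitness[where f' = "\<lambda>b. b ! k"])
  show "\<forall>b\<in>{b \<in> nlists d I. \<forall>l<d. l \<noteq> k \<longrightarrow> b ! l = a ! l}. a[k := b ! k] = b"
  proof
    fix b assume b: "b \<in> {b \<in> nlists d I. \<forall>l<d. l \<noteq> k \<longrightarrow> b ! l = a ! l}"
    show "a[k := b ! k] = b"
    proof (rule nth_equalityI)
      show "a[k := b ! k] ! l = b ! l" if "l < length (a[k := b ! k])" for l
        using assms b that by (cases "l = k") auto
    qed (use assms b in auto)
  qed
qed (use assms nlistsE_nth_in in auto)

lemma tensor_act_single_row:
  fixes u :: "'a \<Rightarrow> 'a \<Rightarrow> 'b::comm_semiring_1"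
  assumes "cs \<in> nlists l (nlists d I)" "k < d" "finite I"
  shows "tensor_act (nlists d I)
      (\<lambda>a b. if \<forall>l<d. l \<noteq> k \<longrightarrow> b ! l = a ! l then u (a ! k) (b ! k) else 0) F cs
    = tensor_act I u (\<lambda>x. F (put_row k cs x)) (table_row k cs)"
  using assms(1)
proof (induction l arbitrary: cs F)
  case (Suc l)
  let ?same = "\<lambda>a b. \<forall>l<d. l \<noteq> k \<longrightarrow> b ! l = a ! l"
  let ?u = "\<lambda>a b. if ?same a b then u (a ! k) (b ! k) else 0"
  from Suc.prems obtain a cs'
    where cs: "cs = a # cs'" "a \<in> nlists d I" "cs' \<in> nlists l (nlists d I)"
    unfolding in_nlists_Suc_iff by blast
  let ?G = "\<lambda>b. tensor_act (nlists d I) ?u (\<lambda>x. F (b # x)) cs'"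
  have "tensor_act (nlists d I) ?u F cs
      = (\<Sum>b\<in>{b \<in> nlists d I. ?same a b}. u (a ! k) (b ! k) * ?G b)"
    unfolding cs tensor_act_Cons sum.inter_filter[OF finite_nlists[OF assms(3)]]
    by (rule sum.cong) auto
  also have "\<dots> = (\<Sum>q\<in>I. u (a ! k) (a[k := q] ! k) * ?G (a[k := q]))"
    by (rule sum.reindex_bij_betw[OF bij_betw_list_update[OF cs(2) assms(2)], symmetric])
  also have "\<dots> = (\<Sum>q\<in>I. u (a ! k) q *
      tensor_act I u (\<lambda>x. F (a[k := q] # put_row k cs' x)) (table_row k cs'))"
    using Suc.IH[OF cs(3)] cs(2) assms(2) by simp
  finally show ?case by (simp add: cs(1))
qed simp

section \<open>Interpolation\<close>

lemma unitriangular_interpolation: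
  fixes v :: "'a::linorder \<Rightarrow> 'a \<Rightarrow> 'b::comm_ring_1"
  assumes "finite A" "\<And>a. a \<in> A \<Longrightarrow> v a a = 1"
    and "\<And>a b. a \<in> A \<Longrightarrow> b \<in> A \<Longrightarrow> v a b \<noteq> 0 \<Longrightarrow> a \<le> b"
  shows "\<exists>c. \<forall>b\<in>A. (\<Sum>a\<in>A. c a * v a b) = f b"
  using assms
proof (induction A rule: finite_linorder_max_induct)
  case (insert m A)
  then obtain c where c: "\<forall>b\<in>A. (\<Sum>a\<in>A. c a * v a b) = f b" by (meson insertI2)
  define c' where "c' = c(m := f m - (\<Sum>a\<in>A. c a * v a m))"
  have m: "m \<notin> A" using insert by blast
  have eq: "(\<Sum>a\<in>insert m A. c' a * v a b) = c' m * v m b + (\<Sum>a\<in>A. c a * v a b)" for b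
  proof -
    have "(\<Sum>a\<in>A. c' a * v a b) = (\<Sum>a\<in>A. c a * v a b)"
      by (rule sum.cong) (use m in \<open>auto simp: c'_def\<close>)
    then show ?thesis using insert.hyps(1) m by simp
  qed
  have "v m b = 0" if "b \<in> A" for b
    using insert.hyps(2) insert.prems(2)[of m b] that by force
  then have "\<forall>b\<in>insert m A. (\<Sum>a\<in>insert m A. c' a * v a b) = f b"
    using c by (auto simp: eq insert.prems(1)) (simp add: c'_def)
  then show ?case by blast
qed simp

lemma list_le_of_nth_le:
  fixes xs ys :: "'a::linorder list"
  assumes "length xs = length ys" "\<And>k. k < length ys \<Longrightarrow> xs ! k \<le> ys ! k"
  shows "xs \<le> ys"
  using assms
proof (induction xs ys rule: list_induct2)
  case (Cons x xs y ys)
  have "xs \<le> ys" using Cons.prems[of "Suc _"] by (intro Cons.IH) auto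
  moreover have "x \<le> y" using Cons.prems[of 0] by simp
  ultimately show ?case by (auto simp: le_less)
qed simp

section \<open>Tensors of highest weight\<close>

definition entry :: "complex mat \<Rightarrow> nat \<Rightarrow> nat \<Rightarrow> complex" where
  "entry A a b = A $$ (a - 1, b - 1)"

lemma idx_eq_nlists: "idx n d = nlists d {1..n}"
  unfolding idx_def nlists_def by (rule refl)

lemma finite_idx [simp]: "finite (idx n d)"
  by (simp add: idx_eq_nlists finite_nlists)

lemma tables_eq_nlists: "tables n d m = nlists d (nlists m {1..n})"
  unfolding tables_def nlists_def by blast

lemma act_coeff_eq_prod: "act_coeff g a b = (\<Prod>k<length g. entry (g ! k) (a ! k) (b ! k))"
  by (simp add: act_coeff_def entry_def)

lemma prod_list_act_coeff_diagonal:
  "(\<Prod>c\<leftarrow>cs. act_coeff g c c) = (\<Prod>k<length g. \<Prod>a\<leftarrow>table_row k cs. entry (g ! k) a a)"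
  by (induction cs) (simp_all add: act_coeff_eq_prod prod.distrib)

lemma weight_eq_prod_part:
  "weight lam g = (\<Prod>k<length lam. \<Prod>i\<in>{1..length (lam ! k)}. entry (g ! k) i i ^ part (lam ! k) i)"
  unfolding weight_def prod_lessThan_length_eq_prod_part[symmetric] by (simp add: entry_def)

lemma prod_list_act_coeff_eq_weight:
  assumes "length g = length lam"
    and rows: "\<And>k. k < length lam \<Longrightarrow> table_row k cs \<in> words (lam ! k)"
  shows "(\<Prod>c\<leftarrow>cs. act_coeff g c c) = weight lam g"
proof -
  have "(\<Prod>a\<leftarrow>table_row k cs. entry (g ! k) a a)
      = (\<Prod>i\<in>{1..length (lam ! k)}. entry (g ! k) i i ^ part (lam ! k) i)" if "k < length lam" for k
  proof -
    have "set (table_row k cs) \<subseteq> {1..length (lam ! k)}"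
      using rows[OF that] by (simp add: words_def)
    then show ?thesis
      using rows[OF that] by (simp add: prod_list_eq_prod_count in_words_iff)
  qed
  then show ?thesis
    by (simp add: prod_list_act_coeff_diagonal weight_eq_prod_part assms(1))
qed

lemma weight_unipotent:
  assumes "u \<in> unipotent n (length lam)" "\<forall>p\<in>set lam. length p \<le> n"
  shows "weight lam u = 1"
proof -
  have "(u ! k) $$ (j, j) = 1" if "k < length lam" "j < length (lam ! k)" for k j
  proof -
    have "u ! k \<in> set u" using assms(1) that by (simp add: unipotent_def GL_def)
    moreover have "j < n" using assms(2) that by (meson less_le_trans nth_mem)
    ultimately show ?thesis using assms(1) by (simp add: unipotent_def)
  qed
  then show ?thesis by (simp add: weight_def)
qed

lemma torus_unipotent_upper_triangular:
  "g \<in> torus n d \<union> unipotent n d \<Longrightarrow> g \<in> GL n d \<and> (\<forall>h\<in>set g. upper_triangular h)"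
  by (auto simp: torus_def unipotent_def GL_def diagonal_mat_def upper_triangular_def)

text \<open>On the unipotent group the weight is trivial, so a single equation expresses both conditions
  on a highest weight vector.\<close>

definition highest_weight_fun ::
    "nat \<Rightarrow> nat list list \<Rightarrow> nat \<Rightarrow> (nat list list \<Rightarrow> complex) \<Rightarrow> bool" where
  "highest_weight_fun n lam l F \<longleftrightarrow>
     (\<forall>g\<in>torus n (length lam) \<union> unipotent n (length lam). \<forall>cs\<in>nlists l (idx n (length lam)).
        tensor_act (idx n (length lam)) (act_coeff g) F cs = weight lam g * F cs)"

lemma highest_weight_funD:
  "highest_weight_fun n lam l F \<Longrightarrow> g \<in> torus n (length lam) \<union> unipotent n (length lam) \<Longrightarrow>
     cs \<in> nlists l (idx n (length lam)) \<Longrightarrow>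
     tensor_act (idx n (length lam)) (act_coeff g) F cs = weight lam g * F cs"
  unfolding highest_weight_fun_def by blast

lemma highest_weight_fun_diff_sum:
  assumes "highest_weight_fun n lam l F" "\<And>a. a \<in> A \<Longrightarrow> highest_weight_fun n lam l (G a)"
  shows "highest_weight_fun n lam l (\<lambda>cs. F cs - (\<Sum>a\<in>A. c a * G a cs))"
  using assms unfolding highest_weight_fun_def
  by (simp add: tensor_act_diff tensor_act_sum tensor_act_cmult sum_distrib_left right_diff_distrib
      mult.left_commute)

definition in_factor :: "nat \<Rightarrow> nat \<Rightarrow> nat \<Rightarrow> complex mat \<Rightarrow> complex mat list" where
  "in_factor n d k A = (replicate d (1\<^sub>m n))[k := A]"

lemma length_in_factor [simp]: "length (in_factor n d k A) = d"
  by (simp add: in_factor_def)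

lemma nth_in_factor: "l < d \<Longrightarrow> in_factor n d k A ! l = (if l = k then A else 1\<^sub>m n)"
  by (auto simp: in_factor_def)

lemma set_in_factor_subset: "set (in_factor n d k A) \<subseteq> {A, 1\<^sub>m n}"
  unfolding in_factor_def using set_update_subset_insert[of "replicate d (1\<^sub>m n)" k A]
  by (auto split: if_splits)

lemma entry_one_mat: "a \<in> {1..n} \<Longrightarrow> b \<in> {1..n} \<Longrightarrow> entry (1\<^sub>m n) a b = (if a = b then 1 else 0)"
  by (auto simp: entry_def)

lemma act_coeff_in_factor:
  assumes "a \<in> idx n d" "b \<in> idx n d" "k < d"
  shows "act_coeff (in_factor n d k A) a b
    = (if \<forall>l<d. l \<noteq> k \<longrightarrow> b ! l = a ! l then entry A (a ! k) (b ! k) else 0)"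
proof -
  have letters: "a ! l \<in> {1..n}" "b ! l \<in> {1..n}" if "l < d" for l
    using assms(1,2) that nlistsE_nth_in unfolding idx_eq_nlists by blast+
  have "act_coeff (in_factor n d k A) a b
      = entry A (a ! k) (b ! k) * (\<Prod>l\<in>{..<d} - {k}. entry (1\<^sub>m n) (a ! l) (b ! l))"
    unfolding act_coeff_eq_prod using assms(3)
    by (subst prod.remove[of _ k]) (auto simp: nth_in_factor intro!: prod.cong)
  also have "(\<Prod>l\<in>{..<d} - {k}. entry (1\<^sub>m n) (a ! l) (b ! l))
      = (\<Prod>l\<in>{..<d} - {k}. if b ! l = a ! l then 1 else 0)"
    by (rule prod.cong) (use letters in \<open>auto simp: entry_one_mat\<close>)
  also have "\<dots> = (if \<forall>l<d. l \<noteq> k \<longrightarrow> b ! l = a ! l then 1 else 0)"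
    by (auto intro!: prod.neutral)
  finally show ?thesis by (simp only: if_distrib mult_1_right mult_zero_right)
qed

lemma tensor_act_in_factor:
  assumes "cs \<in> nlists l (idx n d)" "k < d"
  shows "tensor_act (idx n d) (act_coeff (in_factor n d k A)) F cs
    = tensor_act {1..n} (entry A) (\<lambda>x. F (put_row k cs x)) (table_row k cs)"
proof -
  have "tensor_act (idx n d) (act_coeff (in_factor n d k A)) F cs
      = tensor_act (idx n d)
          (\<lambda>a b. if \<forall>l<d. l \<noteq> k \<longrightarrow> b ! l = a ! l then entry A (a ! k) (b ! k) else 0) F cs"
    by (rule tensor_act_cong_matrix) (use assms nlistsE_set in \<open>auto simp: act_coeff_in_factor\<close>)
  also have "\<dots> = tensor_act {1..n} (entry A) (\<lambda>x. F (put_row k cs x)) (table_row k cs)"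
    using assms unfolding idx_eq_nlists by (intro tensor_act_single_row) simp_all
  finally show ?thesis .
qed

lemma invertible_upper_triangular:
  fixes A :: "'a::field mat"
  assumes "A \<in> carrier_mat n n" "upper_triangular A" "\<And>i. i < n \<Longrightarrow> A $$ (i, i) \<noteq> 0"
  shows "invertible_mat A"
proof -
  have "det A \<noteq> 0"
    using assms by (auto simp: det_upper_triangular diag_mat_def prod_list_zero_iff)
  from det_non_zero_imp_unit[OF assms(1) this, of "()"]
  obtain B where "B \<in> carrier_mat n n" "B * A = 1\<^sub>m n" "A * B = 1\<^sub>m n"
    by (auto simp: Units_def ring_mat_def)
  then show ?thesis
    using assms(1) unfolding invertible_mat_def inverts_mat_def by auto
qed

lemma in_factor_in_GL:
  assumes "A \<in> carrier_mat n n" "upper_triangular A" "\<And>i. i < n \<Longrightarrow> A $$ (i, i) \<noteq> 0"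
  shows "in_factor n d k A \<in> GL n d"
proof -
  have "invertible_mat (1\<^sub>m n :: complex mat)"
    by (rule invertible_upper_triangular) (auto simp: upper_triangular_def)
  then show ?thesis
    using assms(1) invertible_upper_triangular[OF assms] set_in_factor_subset[of n d k A]
    by (auto simp: GL_def)
qed

lemma in_factor_in_unipotent:
  assumes "A \<in> carrier_mat n n" "upper_triangular A" "\<And>i. i < n \<Longrightarrow> A $$ (i, i) = 1"
  shows "in_factor n d k A \<in> unipotent n d"
  using in_factor_in_GL[of A n d k] set_in_factor_subset[of n d k A] assms
  by (auto simp: unipotent_def upper_triangular_def)

lemma in_factor_in_torus:
  assumes "A \<in> carrier_mat n n" "diagonal_mat A" "\<And>i. i < n \<Longrightarrow> A $$ (i, i) \<noteq> 0"
  shows "in_factor n d k A \<in> torus n d"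
proof -
  have "upper_triangular A" using assms by (auto simp: upper_triangular_def diagonal_mat_def)
  then show ?thesis
    using in_factor_in_GL[of A n d k] set_in_factor_subset[of n d k A] assms
    by (auto simp: torus_def diagonal_mat_def)
qed

definition dilation :: "nat \<Rightarrow> nat \<Rightarrow> complex mat" where
  "dilation n i = mat n n (\<lambda>(r, c). if r = c then if Suc r = i then 2 else 1 else 0)"

lemma entry_dilation:
  "a \<in> {1..n} \<Longrightarrow> b \<in> {1..n} \<Longrightarrow>
     entry (dilation n i) a b = (if a = b then if a = i then 2 else 1 else 0)"
  by (auto simp: entry_def dilation_def)

lemma prod_power_if_eq:
  "finite A \<Longrightarrow> (\<Prod>j\<in>A. (if j = i then c else 1) ^ f j) = (if i \<in> A then c ^ f i else 1)"
  for c :: "'a::comm_monoid_mult"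
  by (subst prod.cong[OF refl, of _ _ "\<lambda>j. if j = i then c ^ f i else 1"]) auto

lemma weight_dilation:
  assumes "k < length lam" "\<forall>p\<in>set lam. length p \<le> n"
  shows "weight lam (in_factor n (length lam) k (dilation n i)) = 2 ^ part (lam ! k) i"
proof -
  have letters: "j \<in> {1..n}" if "l < length lam" "j \<in> {1..length (lam ! l)}" for l j
    using assms(2) that by (meson atLeastAtMost_iff le_trans nth_mem)
  let ?D = "in_factor n (length lam) k (dilation n i)"
  have "(\<Prod>j\<in>{1..length (lam ! l)}. entry (?D ! l) j j ^ part (lam ! l) j)
      = (if l = k then 2 ^ part (lam ! k) i else 1)" if l: "l < length lam" for l
  proof (cases "l = k")
    case True
    then have "entry (?D ! l) j j = (if j = i then 2 else 1)" if "j \<in> {1..length (lam ! l)}" for j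
      using letters[OF l that] assms(1) by (simp add: nth_in_factor entry_dilation)
    then have "(\<Prod>j\<in>{1..length (lam ! l)}. entry (?D ! l) j j ^ part (lam ! l) j)
        = (\<Prod>j\<in>{1..length (lam ! l)}. (if j = i then 2 else 1) ^ part (lam ! l) j)"
      by (intro prod.cong) auto
    then show ?thesis by (simp add: prod_power_if_eq True part_def)
  next
    case False
    then show ?thesis
      using letters[OF l] by (auto simp: nth_in_factor l entry_one_mat intro!: prod.neutral)
  qed
  then show ?thesis
    using assms(1) by (simp add: weight_eq_prod_part)
qed

lemma tensor_act_dilation:
  assumes "cs \<in> nlists l (idx n d)" "k < d"
  shows "tensor_act (idx n d) (act_coeff (in_factor n d k (dilation n i))) F cs
    = 2 ^ count_list (table_row k cs) i * F cs"
proof -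
  let ?x = "table_row k cs"
  have x: "set ?x \<subseteq> {1..n}"
    using table_row_in_nlists[OF assms[unfolded idx_eq_nlists]] by (rule nlistsE_set)
  have "tensor_act (idx n d) (act_coeff (in_factor n d k (dilation n i))) F cs
      = (\<Prod>a\<leftarrow>?x. entry (dilation n i) a a) * F (put_row k cs ?x)"
    unfolding tensor_act_in_factor[OF assms] using x
    by (intro tensor_act_diagonal) (auto simp: entry_dilation)
  also have "(\<Prod>a\<leftarrow>?x. entry (dilation n i) a a) = (\<Prod>a\<leftarrow>?x. if a = i then 2 else 1)"
    using x by (intro arg_cong[of _ _ prod_list] map_cong refl) (auto simp: entry_dilation)
  also have "\<dots> = 2 ^ count_list ?x i"
    using prod_mset_delta[of i "2::complex" "mset ?x"]
    by (simp add: count_mset flip: prod_mset_prod_list)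
  finally show ?thesis by simp
qed

lemma highest_weight_fun_content:
  assumes hw: "highest_weight_fun n lam l F" and len: "\<forall>p\<in>set lam. length p \<le> n"
    and cs: "cs \<in> nlists l (idx n (length lam))" and nz: "F cs \<noteq> 0" and k: "k < length lam"
  shows "table_row k cs \<in> words (lam ! k)"
  unfolding in_words_iff
proof
  fix i
  have "in_factor n (length lam) k (dilation n i) \<in> torus n (length lam)"
    by (rule in_factor_in_torus) (auto simp: dilation_def diagonal_mat_def)
  then have "2 ^ count_list (table_row k cs) i * F cs = 2 ^ part (lam ! k) i * F cs"
    using highest_weight_funD[OF hw _ cs, of "in_factor n (length lam) k (dilation n i)"]
    by (simp add: tensor_act_dilation[OF cs k] weight_dilation[OF k len])
  then have "complex_of_nat (2 ^ count_list (table_row k cs) i) = of_nat (2 ^ part (lam ! k) i)"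
    using nz by simp
  then show "count_list (table_row k cs) i = part (lam ! k) i"
    by (simp only: of_nat_eq_iff) simp
qed

lemma highest_weight_fun_raising:
  assumes hw: "highest_weight_fun n lam l F" and len: "\<forall>p\<in>set lam. length p \<le> n"
    and cs: "cs \<in> nlists l (idx n (length lam))" and k: "k < length lam"
    and i: "1 \<le> i" "i < n" and y: "y \<in> nlists l {1..n}"
  shows "raising i (\<lambda>x. F (put_row k cs x)) y = 0"
proof (rule raising_eq_zero_of_invariant[of "{1..n}"])
  let ?d = "length lam" and ?cs = "put_row k cs y"
  fix z :: complex
  define A where "A = mat n n (\<lambda>(r, c). transvection i z (Suc r) (Suc c))"
  have unipotent: "in_factor n ?d k A \<in> unipotent n ?d"
    by (rule in_factor_in_unipotent) (auto simp: A_def transvection_def upper_triangular_def)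
  have cs': "?cs \<in> nlists l (idx n ?d)"
    using put_row_in_nlists cs y unfolding idx_eq_nlists by blast
  have "tensor_act {1..n} (transvection i z) (\<lambda>x. F (put_row k cs x)) y
      = tensor_act {1..n} (entry A) (\<lambda>x. F (put_row k cs x)) y"
    by (rule tensor_act_cong_matrix) (use nlistsE_set[OF y] in \<open>auto simp: A_def entry_def\<close>)
  also have "\<dots> = tensor_act {1..n} (entry A) (\<lambda>x. F (put_row k ?cs x)) y"
    by (rule tensor_act_cong) (use cs y in \<open>simp add: put_row_put_row\<close>)
  also have "\<dots> = tensor_act (idx n ?d) (act_coeff (in_factor n ?d k A)) F ?cs"
    using tensor_act_in_factor[OF cs' k] table_row_put_row_same[OF cs[unfolded idx_eq_nlists] y k]
    by simp
  also have "\<dots> = F ?cs"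
    using highest_weight_funD[OF hw _ cs'] unipotent weight_unipotent[OF unipotent len] by simp
  finally show "tensor_act {1..n} (transvection i z) (\<lambda>x. F (put_row k cs x)) y = F ?cs" .
qed (use i nlistsE_set[OF y] in auto)

lemma highest_weight_fun_eq_zero_of_row:
  assumes hw: "highest_weight_fun n lam l F" and len: "\<forall>p\<in>set lam. length p \<le> n"
    and cs: "cs \<in> nlists l (idx n (length lam))" and k: "k < length lam"
    and lattice: "\<And>y. y \<in> nlists l {1..n} \<Longrightarrow> lattice_word y \<Longrightarrow> F (put_row k cs y) = 0"
  shows "F cs = 0"
proof -
  note cs' = cs[unfolded idx_eq_nlists]
  have "F (put_row k cs (table_row k cs)) = 0"
  proof (rule highest_weight_eq_zero[where w = "\<lambda>x. F (put_row k cs x)"])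
    show "table_row k cs \<in> nlists l {1..n}" by (rule table_row_in_nlists[OF cs' k])
    fix y assume y: "y \<in> nlists l {1..n}"
    have "put_row k cs y \<in> nlists l (idx n (length lam))"
      using put_row_in_nlists[OF cs' y] by (simp add: idx_eq_nlists)
    then show "count_list y i = part (lam ! k) i" if "F (put_row k cs y) \<noteq> 0" for i
      using highest_weight_fun_content[OF hw len _ that k] table_row_put_row_same[OF cs' y k]
      by (simp add: in_words_iff)
    show "raising i (\<lambda>x. F (put_row k cs x)) y = 0" if "1 \<le> i" "i < n" for i
      by (rule highest_weight_fun_raising[OF hw len cs k that y])
  qed (rule lattice)
  then show ?thesis by simp
qed

lemma highest_weight_fun_eq_zero:
  assumes hw: "highest_weight_fun n lam l F" and len: "\<forall>p\<in>set lam. length p \<le> n"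
    and lattice: "\<And>cs. cs \<in> nlists l (idx n (length lam)) \<Longrightarrow>
      \<forall>k<length lam. lattice_word (table_row k cs) \<Longrightarrow> F cs = 0"
    and cs: "cs \<in> nlists l (idx n (length lam))"
  shows "F cs = 0"
proof -
  have "F cs = 0" if "j \<le> length lam" "cs \<in> nlists l (idx n (length lam))"
    "\<forall>k. j \<le> k \<longrightarrow> k < length lam \<longrightarrow> lattice_word (table_row k cs)" for j cs
    using that
  proof (induction j arbitrary: cs)
    case 0
    show ?case by (rule lattice[OF 0(2)]) (use 0(3) in simp)
  next
    case (Suc j)
    have j: "j < length lam" using Suc.prems(1) by simp
    note cs = Suc.prems(2) and cs' = Suc.prems(2)[unfolded idx_eq_nlists]
    show ?case
    proof (rule highest_weight_fun_eq_zero_of_row[OF hw len cs j])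
      fix y assume y: "y \<in> nlists l {1..n}" and "lattice_word y"
      show "F (put_row j cs y) = 0"
      proof (rule Suc.IH, use j in simp)
        show "put_row j cs y \<in> nlists l (idx n (length lam))"
          using put_row_in_nlists[OF cs' y] by (simp add: idx_eq_nlists)
        have "table_row k (put_row j cs y) = (if k = j then y else table_row k cs)" for k
          using table_row_put_row_same[OF cs' y j] cs y by (simp add: table_row_put_row_other)
        then show "\<forall>k. j \<le> k \<longrightarrow> k < length lam \<longrightarrow> lattice_word (table_row k (put_row j cs y))"
          using Suc.prems(3) \<open>lattice_word y\<close> by simp
      qed
    qed
  qed
  from this[of "length lam"] cs show ?thesis by simp
qed

section \<open>The functions of tables\<close>

definition table_fun :: "nat list list \<Rightarrow> nat list list \<Rightarrow> complex" where
  "table_fun T cs = of_int (\<Prod>k<length T. word_sgn (T ! k) (table_row k cs))"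

lemma tables_A_in_nlists:
  assumes "T \<in> tables_A \<alpha>s" "\<forall>\<alpha>\<in>set \<alpha>s. sum_list \<alpha> = m"
  shows "T \<in> nlists (length \<alpha>s) (nlists m UNIV)"
proof -
  have "length (T ! k) = m" if "k < length \<alpha>s" for k
    using assms that by (auto simp: tables_A_def words_def)
  then show ?thesis
    using assms(1) by (intro nlistsI) (auto simp: tables_A_def in_set_conv_nth in_nlists_UNIV)
qed

lemma finite_tables_A: "finite (tables_A \<alpha>s)"
proof (rule finite_subset)
  show "tables_A \<alpha>s \<subseteq> nlists (length \<alpha>s) (\<Union>\<alpha>\<in>set \<alpha>s. words \<alpha>)"
    by (auto simp: tables_A_def in_set_conv_nth intro!: nlistsI) (metis nth_mem)
  show "finite (nlists (length \<alpha>s) (\<Union>\<alpha>\<in>set \<alpha>s. words \<alpha>))"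
    by (rule finite_nlists) (simp add: finite_words)
qed

lemma tensor_act_table_fun:
  assumes g: "g \<in> GL n d" "\<forall>h\<in>set g. upper_triangular h"
    and T: "T \<in> nlists d (nlists l UNIV)" and cs: "cs \<in> nlists l (idx n d)"
  shows "tensor_act (idx n d) (act_coeff g) (table_fun T) cs
    = (\<Prod>c\<leftarrow>cs. act_coeff g c c) * table_fun T cs"
proof -
  let ?sgn = "\<lambda>k x. of_int (word_sgn (T ! k) x) :: complex"
  have len: "length g = d" "length T = d" using g(1) T by (simp_all add: GL_def)
  have row: "tensor_act {1..n} (entry (g ! k)) (?sgn k) (table_row k cs)
      = (\<Prod>a\<leftarrow>table_row k cs. entry (g ! k) a a) * ?sgn k (table_row k cs)" if k: "k < d" for k
  proof (rule tensor_act_word_sgn)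
    have "g ! k \<in> set g" using k len(1) by simp
    then have gk: "g ! k \<in> carrier_mat n n" "upper_triangular (g ! k)"
      using g by (auto simp: GL_def)
    show "\<forall>a\<in>{1..n}. \<forall>b\<in>{1..n}. b < a \<longrightarrow> entry (g ! k) a b = 0"
      using gk by (auto simp: entry_def intro!: upper_triangularD)
    show "set (table_row k cs) \<subseteq> {1..n}"
      using table_row_in_nlists[OF cs[unfolded idx_eq_nlists] k] by (rule nlistsE_set)
    show "length (T ! k) = length (table_row k cs)"
      using nlistsE_length[OF nlistsE_nth_in[OF T k]] cs by simp
  qed
  have "tensor_act (idx n d) (act_coeff g) (table_fun T) cs
      = tensor_act (nlists d {1..n}) (\<lambda>a b. \<Prod>k<d. entry (g ! k) (a ! k) (b ! k))
          (\<lambda>cs. \<Prod>k<d. ?sgn k (table_row k cs)) cs"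
    by (simp add: idx_eq_nlists act_coeff_eq_prod[abs_def] table_fun_def[abs_def] len)
  also have "\<dots> = (\<Prod>k<d. tensor_act {1..n} (entry (g ! k)) (?sgn k) (table_row k cs))"
    by (rule tensor_act_rows)
  also have "\<dots> = (\<Prod>k<d. (\<Prod>a\<leftarrow>table_row k cs. entry (g ! k) a a) * ?sgn k (table_row k cs))"
    by (intro prod.cong refl row) simp
  also have "\<dots> = (\<Prod>c\<leftarrow>cs. act_coeff g c c) * table_fun T cs"
    by (simp add: prod.distrib prod_list_act_coeff_diagonal table_fun_def len)
  finally show ?thesis .
qed

lemma highest_weight_fun_table_fun:
  assumes T: "T \<in> tables_A (map conjugate_partition lam)"
    and lam: "\<forall>p\<in>set lam. is_partition m p"
  shows "highest_weight_fun n lam m (table_fun T)"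
  unfolding highest_weight_fun_def
proof (intro ballI)
  let ?d = "length lam"
  have T_nlists: "T \<in> nlists ?d (nlists m UNIV)"
    using tables_A_in_nlists[OF T, of m] lam
    by (simp add: is_partition_def sum_list_conjugate_partition)
  fix g cs
  assume "g \<in> torus n ?d \<union> unipotent n ?d" and cs: "cs \<in> nlists m (idx n ?d)"
  then have g: "g \<in> GL n ?d" "\<forall>h\<in>set g. upper_triangular h"
    using torus_unipotent_upper_triangular by blast+
  have "(\<Prod>c\<leftarrow>cs. act_coeff g c c) = weight lam g" if nz: "table_fun T cs \<noteq> 0"
  proof (rule prod_list_act_coeff_eq_weight)
    fix k assume k: "k < ?d"
    show "table_row k cs \<in> words (lam ! k)"
    proof (rule word_sgn_nonzero_imp_words)
      show "T ! k \<in> words (conjugate_partition (lam ! k))" using T k by (simp add: tables_A_def)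
      show "sorted_wrt (\<ge>) (lam ! k)" using lam k by (auto simp: is_partition_def)
      show "word_sgn (T ! k) (table_row k cs) \<noteq> 0"
        using nz k T_nlists by (auto simp: table_fun_def)
      show "length (table_row k cs) = length (T ! k)"
        using nlistsE_length[OF nlistsE_nth_in[OF T_nlists k]] cs by simp
    qed
  qed (use g in \<open>simp add: GL_def\<close>)
  then show "tensor_act (idx n ?d) (act_coeff g) (table_fun T) cs = weight lam g * table_fun T cs"
    by (cases "table_fun T cs = 0") (simp_all add: tensor_act_table_fun[OF g T_nlists cs])
qed

lemma zero_notin_words: "w \<in> words \<alpha> \<Longrightarrow> 0 \<notin> set w"
  by (auto simp: words_def)

lemma tables_A_plus_rowD:
  assumes "T \<in> tables_A_plus \<alpha>s" "k < length \<alpha>s"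
  shows "T ! k \<in> words (\<alpha>s ! k)" "lattice_word (T ! k)"
  using assms by (auto simp: tables_A_plus_def tables_A_def)

lemma running_count_tables_A_plus:
  assumes "Y \<in> tables_A_plus lam"
  shows "map running_count Y \<in> tables_A_plus (map conjugate_partition lam)"
  using assms running_count_in_words lattice_word_running_count
  by (auto simp: tables_A_plus_def tables_A_def)

lemma table_fun_running_count:
  assumes "X \<in> nlists d (nlists m UNIV)" "length Y = d" "d \<ge> 1"
  shows "table_fun (map running_count Y) (List.transpose X)
    = of_int (\<Prod>k<d. word_sgn (running_count (Y ! k)) (X ! k))"
  using assms by (simp add: table_fun_def table_row_transpose)

lemma table_fun_running_count_self:
  assumes Y: "Y \<in> tables_A_plus lam" and "lam \<noteq> []" "\<forall>p\<in>set lam. sum_list p = m"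
  shows "table_fun (map running_count Y) (List.transpose Y) = 1"
proof -
  have Y_nlists: "Y \<in> nlists (length lam) (nlists m UNIV)"
    using Y assms(3) by (intro tables_A_in_nlists) (auto simp: tables_A_plus_def)
  have "word_sgn (running_count (Y ! k)) (Y ! k) = 1" if "k < length lam" for k
    using word_sgn_running_count[of "running_count (Y ! k)"] tables_A_plus_rowD[OF Y that]
    by (simp add: running_count_running_count zero_notin_words)
  then show ?thesis
    using assms(2) Y_nlists by (simp add: table_fun_running_count[OF Y_nlists] Suc_le_eq)
qed

lemma table_fun_running_count_nonzero_imp_le:
  assumes X: "X \<in> tables_A_plus lam" and Y: "Y \<in> tables_A_plus lam"
    and lam: "lam \<noteq> []" "\<forall>p\<in>set lam. sum_list p = m"
    and nz: "table_fun (map running_count Y) (List.transpose X) \<noteq> 0"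
  shows "Y \<le> X"
proof (rule list_le_of_nth_le)
  have nlists: "X \<in> nlists (length lam) (nlists m UNIV)" "Y \<in> nlists (length lam) (nlists m UNIV)"
    using X Y lam(2) by (auto simp: tables_A_plus_def intro!: tables_A_in_nlists)
  then show "length Y = length X" by simp
  fix k assume "k < length X"
  then have k: "k < length lam" using nlists(1) by simp
  have "word_sgn (running_count (Y ! k)) (X ! k) \<noteq> 0"
    using nz k nlists(2) lam(1) by (auto simp: table_fun_running_count[OF nlists(1)] Suc_le_eq)
  then have "running_count (running_count (Y ! k)) \<le> X ! k"
    using nlistsE_nth_in[OF nlists(1) k] nlistsE_nth_in[OF nlists(2) k]
    by (intro word_sgn_nonzero_imp_running_count_le) (auto simp: in_nlists_UNIV)
  then show "Y ! k \<le> X ! k"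
    using tables_A_plus_rowD[OF Y k] by (simp add: running_count_running_count zero_notin_words)
qed

lemma highest_weight_fun_eq_zero_of_degree:
  assumes "highest_weight_fun n lam l F" "\<forall>p\<in>set lam. is_partition m p \<and> length p \<le> n"
    and "lam \<noteq> []" "l \<noteq> m" "cs \<in> nlists l (idx n (length lam))"
  shows "F cs = 0"
proof (rule ccontr)
  assume "F cs \<noteq> 0"
  then have "table_row 0 cs \<in> words (lam ! 0)"
    using assms by (intro highest_weight_fun_content[OF assms(1)]) auto
  then have "length (table_row 0 cs) = sum_list (lam ! 0)" by (simp add: words_def)
  moreover have "sum_list (lam ! 0) = m" using assms(2,3) by (auto simp: is_partition_def)
  ultimately show False using assms(4,5) by simp
qed

lemma highest_weight_fun_eq_zero_of_tables:
  assumes hw: "highest_weight_fun n lam m F" and lam: "\<forall>p\<in>set lam. length p \<le> n" "lam \<noteq> []"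
    and zero: "\<And>X. X \<in> tables_A_plus lam \<Longrightarrow> F (List.transpose X) = 0"
    and cs: "cs \<in> nlists m (idx n (length lam))"
  shows "F cs = 0"
proof (rule highest_weight_fun_eq_zero[OF hw lam(1) _ cs])
  fix cs
  assume cs: "cs \<in> nlists m (idx n (length lam))"
    and lattice: "\<forall>k<length lam. lattice_word (table_row k cs)"
  show "F cs = 0"
  proof (rule ccontr)
    assume "F cs \<noteq> 0"
    then have X: "rows_of (length lam) cs \<in> tables_A_plus lam"
      using highest_weight_fun_content[OF hw lam(1) cs] lattice
      by (auto simp: tables_A_plus_def tables_A_def rows_of_def)
    have "List.transpose (rows_of (length lam) cs) = cs"
      using transpose_rows_of[OF cs[unfolded idx_eq_nlists]] lam(2) by (simp add: Suc_le_eq)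
    then show False using zero[OF X] \<open>F cs \<noteq> 0\<close> by simp
  qed
qed

theorem highest_weight_fun_decomposition:
  assumes hw: "highest_weight_fun n lam m F"
    and lam: "\<forall>p\<in>set lam. is_partition m p \<and> length p \<le> n" "lam \<noteq> []"
  shows "\<exists>c. \<forall>cs\<in>nlists m (idx n (length lam)).
    F cs = (\<Sum>Y\<in>tables_A_plus lam. c Y * table_fun (map running_count Y) cs)"
proof -
  let ?A = "tables_A_plus lam"
  have sums: "\<forall>p\<in>set lam. sum_list p = m" and len: "\<forall>p\<in>set lam. length p \<le> n"
    using lam(1) by (auto simp: is_partition_def)
  have "finite ?A"
    by (rule finite_subset[OF _ finite_tables_A[of lam]]) (auto simp: tables_A_plus_def)
  then obtain c where c: "\<And>X. X \<in> ?A \<Longrightarrow>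
      (\<Sum>Y\<in>?A. c Y * table_fun (map running_count Y) (List.transpose X)) = F (List.transpose X)"
    using unitriangular_interpolation[of ?A
        "\<lambda>Y X. table_fun (map running_count Y) (List.transpose X)" "\<lambda>X. F (List.transpose X)"]
      table_fun_running_count_self[OF _ lam(2) sums]
      table_fun_running_count_nonzero_imp_le[OF _ _ lam(2) sums] by blast
  let ?G = "\<lambda>cs. F cs - (\<Sum>Y\<in>?A. c Y * table_fun (map running_count Y) cs)"
  have hwG: "highest_weight_fun n lam m ?G"
  proof (rule highest_weight_fun_diff_sum[OF hw], rule highest_weight_fun_table_fun)
    show "map running_count Y \<in> tables_A (map conjugate_partition lam)" if "Y \<in> ?A" for Y
      using running_count_tables_A_plus[OF that] by (simp add: tables_A_plus_def)
  qed (use lam(1) in simp)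
  have "?G cs = 0" if "cs \<in> nlists m (idx n (length lam))" for cs
    by (rule highest_weight_fun_eq_zero_of_tables[OF hwG len lam(2) _ that]) (simp add: c)
  then show ?thesis by (intro exI[of _ c]) simp
qed

lemma table_fun_permute_transpose:
  assumes T: "T \<in> nlists d (nlists m UNIV)" and eq: "\<And>k. k < d \<Longrightarrow> T ! k ! i = T ! k ! j"
    and ij: "i < j" "j < m" and cs: "length cs = m"
  shows "table_fun T (permute_list (Transposition.transpose i j) cs) = (- 1) ^ d * table_fun T cs"
proof -
  let ?\<tau> = "Transposition.transpose i j"
  have "word_sgn (T ! k) (table_row k (permute_list ?\<tau> cs)) = - word_sgn (T ! k) (table_row k cs)"
    if k: "k < d" for k
  proof -
    have "table_row k (permute_list ?\<tau> cs) = permute_list ?\<tau> (table_row k cs)"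
      unfolding table_row_def
      by (rule permute_list_map[symmetric]) (use ij cs in \<open>simp add: transpose_permutes_lessThan\<close>)
    then show ?thesis
      using nlistsE_length[OF nlistsE_nth_in[OF T k]] eq[OF k] ij cs
      by (simp add: word_sgn_permute_transpose)
  qed
  then show ?thesis using T by (simp add: table_fun_def prod_uminus)
qed

section \<open>Spans and linear extensions\<close>

lemma span_image_scale_nonzero:
  assumes "\<And>x. x \<in> A \<Longrightarrow> r x \<noteq> 0"
  shows "cvec.span ((\<lambda>x. scale (r x) (f x)) ` A) = cvec.span (f ` A)"
proof -
  have "f x \<in> cvec.span ((\<lambda>x. scale (r x) (f x)) ` A)" if "x \<in> A" for x
  proof -
    have "scale (inverse (r x)) (scale (r x) (f x)) \<in> cvec.span ((\<lambda>x. scale (r x) (f x)) ` A)"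
      using that by (intro cvec.span_scale cvec.span_base) blast
    then show ?thesis using assms[OF that] by simp
  qed
  then show ?thesis
    unfolding cvec.span_eq by (auto intro: cvec.span_scale cvec.span_base)
qed

definition lin_ext :: "('a \<Rightarrow> 'b \<Rightarrow>\<^sub>0 complex) \<Rightarrow> ('a \<Rightarrow>\<^sub>0 complex) \<Rightarrow> ('b \<Rightarrow>\<^sub>0 complex)" where
  "lin_ext \<Phi> p = (\<Sum>a\<in>Poly_Mapping.keys p. scale (poly_mapping.lookup p a) (\<Phi> a))"

lemma lin_ext_superset:
  assumes "finite A" "Poly_Mapping.keys p \<subseteq> A"
  shows "lin_ext \<Phi> p = (\<Sum>a\<in>A. scale (poly_mapping.lookup p a) (\<Phi> a))"
  unfolding lin_ext_def by (rule sum.mono_neutral_left) (use assms in \<open>auto simp: in_keys_iff\<close>)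

lemma lin_ext_add: "lin_ext \<Phi> (p + q) = lin_ext \<Phi> p + lin_ext \<Phi> q"
proof -
  let ?A = "Poly_Mapping.keys p \<union> Poly_Mapping.keys q"
  have "Poly_Mapping.keys (p + q) \<subseteq> ?A" by (rule Poly_Mapping.keys_add)
  then show ?thesis
    by (simp add: lin_ext_superset[of ?A] lookup_add cvec.scale_left_distrib sum.distrib)
qed

lemma lin_ext_scale: "lin_ext \<Phi> (scale c p) = scale c (lin_ext \<Phi> p)"
proof -
  have "Poly_Mapping.keys (scale c p) \<subseteq> Poly_Mapping.keys p"
    by (auto simp: in_keys_iff lookup_scale)
  then show ?thesis
    by (simp add: lin_ext_superset[of "Poly_Mapping.keys p"] lookup_scale cvec.scale_sum_right)
qed

lemma lin_ext_single: "lin_ext \<Phi> (Poly_Mapping.single a c) = scale c (\<Phi> a)"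
  by (cases "c = 0") (simp_all add: lin_ext_def)

section \<open>Quotients of the tensor algebra\<close>

lemma HWV_iff_weight:
  assumes "\<forall>p\<in>set lam. length p \<le> n"
  shows "v \<in> HWV n lam W act \<longleftrightarrow> v \<in> W \<and>
    (\<forall>g\<in>torus n (length lam) \<union> unipotent n (length lam). act g v = scale (weight lam g) v)"
  using weight_unipotent[OF _ assms] by (auto simp: HWV_def)

text \<open>The symmetric and the exterior algebra as quotients of the tensor algebra: the image of the
  tensor \<open>e\<^bsub>c\<^sub>1\<^esub> \<otimes> \<cdots> \<otimes> e\<^bsub>c\<^sub>m\<^esub>\<close> is \<open>\<eta> cs\<close> times the basis vector \<open>key cs\<close>.\<close>

locale tensor_quotient =
  fixes n d :: nat and \<epsilon> :: complex
    and key :: "nat list list \<Rightarrow> 'a" and \<eta> :: "nat list list \<Rightarrow> complex"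
    and act :: "complex mat list \<Rightarrow> ('a \<Rightarrow>\<^sub>0 complex) \<Rightarrow> ('a \<Rightarrow>\<^sub>0 complex)"
    and W :: "('a \<Rightarrow>\<^sub>0 complex) set"
  assumes eps_square: "\<epsilon> * \<epsilon> = 1"
    and eta_swap: "swap_symmetric \<epsilon> \<eta>"
    and eta_square: "\<eta> cs \<noteq> 0 \<Longrightarrow> \<eta> cs * \<eta> cs = 1"
    and eta_zero: "\<eta> cs = 0 \<Longrightarrow> \<epsilon> = - 1 \<and> \<not> distinct cs"
    and key_cong: "mset cs = mset cs' \<Longrightarrow> key cs = key cs'"
    and key_inj: "key cs = key cs' \<Longrightarrow> \<eta> cs \<noteq> 0 \<Longrightarrow> \<eta> cs' \<noteq> 0 \<Longrightarrow> mset cs = mset cs'"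
    and W_eq: "W = {p. \<forall>a\<in>Poly_Mapping.keys p. \<exists>cs. set cs \<subseteq> idx n d \<and> \<eta> cs \<noteq> 0 \<and> key cs = a}"
    and act_add: "act g (p + q) = act g p + act g q"
    and act_scale: "act g (scale c p) = scale c (act g p)"
    and act_monomial: "length g = d \<Longrightarrow> set cs \<subseteq> idx n d \<Longrightarrow>
      act g (Poly_Mapping.single (key cs) (\<eta> cs)) = (\<Sum>x\<in>nlists (length cs) (idx n d).
        scale (tensor_coeff (act_coeff g) x cs) (Poly_Mapping.single (key x) (\<eta> x)))"
begin

definition monomial :: "nat list list \<Rightarrow> ('a \<Rightarrow>\<^sub>0 complex)" where
  "monomial cs = Poly_Mapping.single (key cs) (\<eta> cs)"

definition proj :: "nat \<Rightarrow> (nat list list \<Rightarrow> complex) \<Rightarrow> ('a \<Rightarrow>\<^sub>0 complex)" where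
  "proj l F = (\<Sum>cs\<in>nlists l (idx n d). scale (F cs) (monomial cs))"

text \<open>The division averages over the tensors with the same image.\<close>

definition lift :: "('a \<Rightarrow>\<^sub>0 complex) \<Rightarrow> nat list list \<Rightarrow> complex" where
  "lift p cs = \<eta> cs * poly_mapping.lookup p (key cs) / card (permutations_of_multiset (mset cs))"

lemma proj_cong: "(\<And>cs. cs \<in> nlists l (idx n d) \<Longrightarrow> F cs = G cs) \<Longrightarrow> proj l F = proj l G"
  by (simp add: proj_def)

lemma proj_zero [simp]: "proj l (\<lambda>cs. 0) = 0"
  by (simp add: proj_def)

lemma proj_cmult: "proj l (\<lambda>cs. c * F cs) = scale c (proj l F)"
  by (simp add: proj_def cvec.scale_sum_right)

lemma proj_diff: "proj l (\<lambda>cs. F cs - G cs) = proj l F - proj l G"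
  by (simp add: proj_def cvec.scale_left_diff_distrib sum_subtractf)

lemma proj_sum: "proj l (\<lambda>cs. \<Sum>a\<in>A. c a * F a cs) = (\<Sum>a\<in>A. scale (c a) (proj l (F a)))"
  by (simp add: proj_def cvec.scale_sum_left cvec.scale_sum_right sum.swap[of _ A])

lemma scale_monomial_cong:
  assumes "swap_symmetric \<epsilon> F" "mset x = mset cs"
  shows "scale (F x) (monomial x) = scale (F cs) (monomial cs)"
proof -
  obtain e where e: "e * e = 1" "F x = e * F cs" "\<eta> x = e * \<eta> cs"
    using swap_symmetric_common_sign[OF assms(1) eta_swap eps_square assms(2)] by blast
  have "F x * \<eta> x = (e * e) * (F cs * \<eta> cs)" unfolding e(2,3) by (simp only: mult_ac)
  then show ?thesis
    using e(1) key_cong[OF assms(2)] by (simp add: monomial_def)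
qed

lemma lookup_proj:
  assumes "swap_symmetric \<epsilon> F" "set cs \<subseteq> idx n d" "\<eta> cs \<noteq> 0"
  shows "poly_mapping.lookup (proj l F) (key cs)
    = (if length cs = l then card (permutations_of_multiset (mset cs)) * (F cs * \<eta> cs) else 0)"
proof -
  have "poly_mapping.lookup (scale (F x) (monomial x)) (key cs)
      = (if mset x = mset cs then F cs * \<eta> cs else 0)" for x
  proof (cases "mset x = mset cs")
    case True
    then show ?thesis
      by (simp add: scale_monomial_cong[OF assms(1) True]) (simp add: monomial_def)
  next
    case False
    then have "\<eta> x = 0 \<or> key x \<noteq> key cs" using key_inj[of x cs] assms(3) by blast
    then show ?thesis using False by (auto simp: monomial_def lookup_single when_def)
  qed
  then have "poly_mapping.lookup (proj l F) (key cs)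
      = of_nat (card {x \<in> nlists l (idx n d). mset x = mset cs}) * (F cs * \<eta> cs)"
    by (simp add: proj_def lookup_sum sum.If_cases Int_def finite_nlists)
  moreover have "{x \<in> nlists l (idx n d). mset x = mset cs}
      = (if length cs = l then permutations_of_multiset (mset cs) else {})"
    using assms(2)
    by (auto simp: permutations_of_multiset_def intro!: nlistsI dest: mset_eq_length mset_eq_setD)
  ultimately show ?thesis by simp
qed

lemma card_permutations_nonzero: "card (permutations_of_multiset (mset cs)) \<noteq> 0" for cs :: "'b list"
  by (auto simp: card_eq_0_iff dest: equals0D[where a = cs] intro: permutations_of_multisetI)

lemma sum_proj_injective:
  assumes F: "swap_symmetric \<epsilon> F" and zero: "(\<Sum>l\<le>D. proj l F) = 0"
    and cs: "cs \<in> nlists l (idx n d)" "l \<le> D"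
  shows "F cs = 0"
proof (cases "\<eta> cs = 0")
  case True
  then show ?thesis using eta_zero[OF True] swap_symmetric_not_distinct[of F cs] F by simp
next
  case False
  have "0 = (\<Sum>l'\<le>D. poly_mapping.lookup (proj l' F) (key cs))"
    using arg_cong[OF zero, of "\<lambda>p. poly_mapping.lookup p (key cs)"] by (simp add: lookup_sum)
  also have "\<dots> = card (permutations_of_multiset (mset cs)) * (F cs * \<eta> cs)"
    using cs by (simp add: lookup_proj[OF F nlistsE_set[OF cs(1)] False])
  finally show ?thesis using False card_permutations_nonzero[of cs] by simp
qed

lemma swap_symmetric_lift: "swap_symmetric \<epsilon> (lift p)"
proof (rule swap_symmetricI)
  fix xs ys :: "nat list list" and a b
  have perm: "mset (xs @ a # b # ys) = mset (xs @ b # a # ys)" by simp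
  show "lift p (xs @ a # b # ys) = \<epsilon> * lift p (xs @ b # a # ys)"
    unfolding lift_def swap_symmetricD[OF eta_swap, of xs a b ys] key_cong[OF perm] perm
    by (simp only: mult.assoc times_divide_eq_right)
qed

lemma sum_proj_lift:
  assumes "p \<in> W"
  shows "\<exists>D. p = (\<Sum>l\<le>D. proj l (lift p))"
proof -
  obtain rep where rep: "set (rep a) \<subseteq> idx n d \<and> \<eta> (rep a) \<noteq> 0 \<and> key (rep a) = a"
    if "a \<in> Poly_Mapping.keys p" for a
    using assms unfolding W_eq by simp metis
  obtain D where D: "length (rep a) \<le> D" if "a \<in> Poly_Mapping.keys p" for a
    using finite_nat_set_iff_bounded_le[of "(\<lambda>a. length (rep a)) ` Poly_Mapping.keys p"] by auto
  have "poly_mapping.lookup p a = poly_mapping.lookup (\<Sum>l\<le>D. proj l (lift p)) a" for a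
  proof (cases "a \<in> Poly_Mapping.keys p")
    case True
    note rep = rep[OF True] and D = D[OF True]
    have "poly_mapping.lookup (proj l (lift p)) a
        = (if length (rep a) = l
           then card (permutations_of_multiset (mset (rep a))) * (lift p (rep a) * \<eta> (rep a))
           else 0)" for l
      using lookup_proj[OF swap_symmetric_lift[of p], of "rep a" l] rep by simp
    then have "poly_mapping.lookup (\<Sum>l\<le>D. proj l (lift p)) a
        = card (permutations_of_multiset (mset (rep a))) * (lift p (rep a) * \<eta> (rep a))"
      using D by (simp add: lookup_sum)
    also have "\<dots> = poly_mapping.lookup p a * (\<eta> (rep a) * \<eta> (rep a))"
      using rep card_permutations_nonzero[of "rep a"] by (simp add: lift_def)
    finally show ?thesis using eta_square rep by simp
  next
    case False
    then have "poly_mapping.lookup (scale (lift p cs) (monomial cs)) a = 0" for cs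
      by (simp add: lift_def monomial_def lookup_single when_def in_keys_iff)
    then show ?thesis using False by (simp add: lookup_sum proj_def in_keys_iff)
  qed
  then show ?thesis by (blast intro: poly_mapping_eqI)
qed

lemma act_sum: "act g (sum f A) = (\<Sum>a\<in>A. act g (f a))"
proof (induction A rule: infinite_finite_induct)
  case (insert a A)
  then show ?case by (simp add: act_add)
qed (use act_scale[of g 0 0] in simp_all)

lemma act_proj:
  assumes "length g = d"
  shows "act g (proj l F) = proj l (tensor_act (idx n d) (act_coeff g) F)"
proof -
  let ?N = "nlists l (idx n d)"
  have "act g (proj l F)
      = (\<Sum>cs\<in>?N. \<Sum>x\<in>?N. scale (F cs * tensor_coeff (act_coeff g) x cs) (monomial x))"
    unfolding proj_def act_sum act_scale
  proof (rule sum.cong[OF refl])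
    fix cs assume "cs \<in> ?N"
    then have "act g (monomial cs) = (\<Sum>x\<in>?N. scale (tensor_coeff (act_coeff g) x cs) (monomial x))"
      using act_monomial[OF assms, of cs] nlistsE_set[of cs l "idx n d"] by (simp add: monomial_def)
    then show "scale (F cs) (act g (monomial cs))
        = (\<Sum>x\<in>?N. scale (F cs * tensor_coeff (act_coeff g) x cs) (monomial x))"
      by (simp add: cvec.scale_sum_right)
  qed
  also have "\<dots> = (\<Sum>x\<in>?N. \<Sum>cs\<in>?N. scale (tensor_coeff (act_coeff g) x cs * F cs) (monomial x))"
    by (subst sum.swap) (simp only: mult.commute)
  also have "\<dots> = proj l (tensor_act (idx n d) (act_coeff g) F)"
    unfolding proj_def by (intro sum.cong refl) (simp add: tensor_act_def cvec.scale_sum_left)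
  finally show ?thesis .
qed

lemma subspace_W: "cvec.subspace W"
proof (rule cvec.subspaceI)
  show "x + y \<in> W" if "x \<in> W" "y \<in> W" for x y
    using that Poly_Mapping.keys_add[of x y] unfolding W_eq by blast
  show "scale c x \<in> W" if "x \<in> W" for c x
  proof -
    have "Poly_Mapping.keys (scale c x) \<subseteq> Poly_Mapping.keys x"
      by (auto simp: in_keys_iff lookup_scale)
    then show ?thesis using that unfolding W_eq by blast
  qed
qed (simp add: W_eq)

lemma proj_in_W: "proj l F \<in> W"
proof -
  have "monomial cs \<in> W" if "cs \<in> nlists l (idx n d)" for cs
    using nlistsE_set[OF that] by (auto simp: W_eq monomial_def split: if_splits)
  then show ?thesis
    unfolding proj_def
    by (intro cvec.subspace_sum[OF subspace_W] cvec.subspace_scale[OF subspace_W])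
qed

lemma subspace_HWV: "cvec.subspace (HWV n lam W act)"
proof (rule cvec.subspaceI)
  show "0 \<in> HWV n lam W act"
    using act_scale[of _ 0 0] cvec.subspace_0[OF subspace_W] by (simp add: HWV_def)
  show "x + y \<in> HWV n lam W act" if "x \<in> HWV n lam W act" "y \<in> HWV n lam W act" for x y
    using that cvec.subspace_add[OF subspace_W]
    by (simp add: HWV_def act_add cvec.scale_right_distrib)
  show "scale c x \<in> HWV n lam W act" if "x \<in> HWV n lam W act" for c x
    using that cvec.subspace_scale[OF subspace_W]
    by (simp add: HWV_def act_scale mult.commute)
qed

lemma length_torus_unipotent: "g \<in> torus n d \<union> unipotent n d \<Longrightarrow> length g = d"
  by (auto simp: torus_def unipotent_def GL_def)

lemma proj_in_HWV:
  assumes "highest_weight_fun n lam l F" "length lam = d" "\<forall>p\<in>set lam. length p \<le> n"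
  shows "proj l F \<in> HWV n lam W act"
proof -
  have "act g (proj l F) = scale (weight lam g) (proj l F)" if "g \<in> torus n d \<union> unipotent n d" for g
  proof -
    have "act g (proj l F) = proj l (tensor_act (idx n d) (act_coeff g) F)"
      by (rule act_proj[OF length_torus_unipotent[OF that]])
    also have "\<dots> = proj l (\<lambda>cs. weight lam g * F cs)"
      using highest_weight_funD[OF assms(1)] that assms(2) by (intro proj_cong) simp
    finally show ?thesis by (simp only: proj_cmult)
  qed
  then show ?thesis by (simp add: HWV_iff_weight assms(2,3) proj_in_W)
qed

lemma highest_weight_fun_of_sum_proj:
  assumes F: "swap_symmetric \<epsilon> F" and hwv: "(\<Sum>l\<le>D. proj l F) \<in> HWV n lam W act"
    and lam: "length lam = d" "\<forall>p\<in>set lam. length p \<le> n" and "l \<le> D"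
  shows "highest_weight_fun n lam l F"
  unfolding highest_weight_fun_def lam(1)
proof (intro ballI)
  fix g cs assume g: "g \<in> torus n d \<union> unipotent n d" and cs: "cs \<in> nlists l (idx n d)"
  let ?A = "tensor_act (idx n d) (act_coeff g) F"
  have "swap_symmetric \<epsilon> (\<lambda>cs. ?A cs - weight lam g * F cs)"
  proof (rule swap_symmetricI)
    fix xs a b ys
    show "?A (xs @ a # b # ys) - weight lam g * F (xs @ a # b # ys)
        = \<epsilon> * (?A (xs @ b # a # ys) - weight lam g * F (xs @ b # a # ys))"
      unfolding swap_symmetricD[OF F, of xs a b ys]
        swap_symmetricD[OF swap_symmetric_tensor_act[OF F], of _ _ xs a b ys]
      by (simp only: right_diff_distrib mult.left_commute)
  qed
  moreover have "(\<Sum>l\<le>D. proj l (\<lambda>cs. ?A cs - weight lam g * F cs)) = 0"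
  proof -
    have "act g (\<Sum>l\<le>D. proj l F) = scale (weight lam g) (\<Sum>l\<le>D. proj l F)"
      using hwv g lam by (simp add: HWV_iff_weight)
    then show ?thesis
      by (simp add: proj_diff proj_cmult act_sum act_proj[OF length_torus_unipotent[OF g]]
          sum_subtractf cvec.scale_sum_right)
  qed
  ultimately have "?A cs - weight lam g * F cs = 0"
    using cs \<open>l \<le> D\<close> by (rule sum_proj_injective)
  then show "?A cs = weight lam g * F cs" by simp
qed

lemma proj_in_span_table_fun:
  assumes hw: "highest_weight_fun n lam l F" and d: "length lam = d" "d \<ge> 1"
    and lam: "\<forall>p\<in>set lam. is_partition m p \<and> length p \<le> n"
  shows "proj l F
    \<in> cvec.span ((\<lambda>T. proj m (table_fun T)) ` tables_A_plus (map conjugate_partition lam))"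
proof -
  have "lam \<noteq> []" using d by auto
  show ?thesis
  proof (cases "l = m")
    case True
    obtain c where "\<forall>cs\<in>nlists m (idx n d).
        F cs = (\<Sum>Y\<in>tables_A_plus lam. c Y * table_fun (map running_count Y) cs)"
      using highest_weight_fun_decomposition[of n lam m F] hw lam \<open>lam \<noteq> []\<close> True d(1) by blast
    then have "proj l F
        = proj m (\<lambda>cs. \<Sum>Y\<in>tables_A_plus lam. c Y * table_fun (map running_count Y) cs)"
      unfolding True by (intro proj_cong) simp
    also have "\<dots> = (\<Sum>Y\<in>tables_A_plus lam. scale (c Y) (proj m (table_fun (map running_count Y))))"
      by (rule proj_sum)
    also have "\<dots> \<in> cvec.span
        ((\<lambda>T. proj m (table_fun T)) ` tables_A_plus (map conjugate_partition lam))"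
      using running_count_tables_A_plus
      by (intro cvec.span_sum cvec.span_scale cvec.span_base) blast
    finally show ?thesis .
  next
    case False
    have "proj l F = proj l (\<lambda>cs. 0)"
      using highest_weight_fun_eq_zero_of_degree[OF hw lam \<open>lam \<noteq> []\<close> False] d(1)
      by (intro proj_cong) simp
    then show ?thesis by (simp add: cvec.span_zero)
  qed
qed

theorem HWV_eq_span_proj_table_fun:
  assumes d: "length lam = d" "d \<ge> 1" and lam: "\<forall>p\<in>set lam. is_partition m p \<and> length p \<le> n"
  shows "HWV n lam W act
    = cvec.span ((\<lambda>T. proj m (table_fun T)) ` tables_A_plus (map conjugate_partition lam))"
    (is "_ = cvec.span (?f ` ?A)")
proof
  have len: "\<forall>p\<in>set lam. length p \<le> n" using lam by blast
  show "cvec.span (?f ` ?A) \<subseteq> HWV n lam W act"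
  proof (rule cvec.span_minimal[OF image_subsetI subspace_HWV])
    show "proj m (table_fun T) \<in> HWV n lam W act" if "T \<in> ?A" for T
      using that lam
      by (intro proj_in_HWV[OF highest_weight_fun_table_fun d(1) len])
        (auto simp: tables_A_plus_def)
  qed
  show "HWV n lam W act \<subseteq> cvec.span (?f ` ?A)"
  proof
    fix p assume p: "p \<in> HWV n lam W act"
    then obtain D where D: "p = (\<Sum>l\<le>D. proj l (lift p))"
      using sum_proj_lift[of p] by (auto simp: HWV_def)
    have "highest_weight_fun n lam l (lift p)" if "l \<le> D" for l
      using p D
      by (intro highest_weight_fun_of_sum_proj[OF swap_symmetric_lift _ d(1) len that]) simp
    then have "(\<Sum>l\<le>D. proj l (lift p)) \<in> cvec.span (?f ` ?A)"
      by (intro cvec.span_sum proj_in_span_table_fun[OF _ d lam]) simp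
    then show "p \<in> cvec.span (?f ` ?A)" using D by simp
  qed
qed

lemma proj_eq_zero_of_exchange:
  assumes ij: "i < j" "j < l"
    and exchange: "\<And>cs. length cs = l \<Longrightarrow>
      F (permute_list (Transposition.transpose i j) cs) * \<epsilon> = - F cs"
  shows "proj l F = 0"
proof -
  let ?\<tau> = "permute_list (Transposition.transpose i j) :: nat list list \<Rightarrow> nat list list"
  let ?N = "nlists l (idx n d)"
  have perm: "Transposition.transpose i j permutes {..<l}"
    by (rule transpose_permutes_lessThan[OF ij])
  have closed: "?\<tau> cs \<in> ?N" if "cs \<in> ?N" for cs
    using that nlistsE_set[OF that] by (intro nlistsI) (simp_all add: perm)
  have involution: "?\<tau> (?\<tau> cs) = cs" if "cs \<in> ?N" for cs
    using permute_list_compose[of "Transposition.transpose i j" cs "Transposition.transpose i j"]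
      perm that by simp
  have monomial: "monomial (?\<tau> cs) = scale \<epsilon> (monomial cs)" if "length cs = l" for cs
  proof -
    have "\<eta> (?\<tau> cs) = \<epsilon> * \<eta> cs"
      using that ij by (intro swap_symmetric_permute_transpose[OF eta_swap eps_square]) simp_all
    moreover have "key (?\<tau> cs) = key cs"
      using that by (intro key_cong) (simp add: perm)
    ultimately show ?thesis by (simp add: monomial_def)
  qed
  have "proj l F = (\<Sum>cs\<in>?N. scale (F (?\<tau> cs)) (monomial (?\<tau> cs)))"
    unfolding proj_def
    by (rule sum.reindex_bij_witness[of _ ?\<tau> ?\<tau>]) (simp_all add: closed involution)
  also have "\<dots> = (\<Sum>cs\<in>?N. - scale (F cs) (monomial cs))"
    by (rule sum.cong) (simp_all add: monomial exchange)
  also have "\<dots> = - proj l F" by (simp add: proj_def sum_negf)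
  finally have "proj l F = - proj l F" .
  then have "poly_mapping.lookup (proj l F) a = - poly_mapping.lookup (proj l F) a" for a
    by (metis lookup_uminus)
  then show ?thesis by (intro poly_mapping_eqI) simp
qed

lemma proj_table_fun_eq_zero:
  assumes sign: "\<epsilon> * (- 1) ^ d = - 1" and T: "T \<in> nlists d (nlists m UNIV)" and d: "d \<ge> 1"
    and repeated: "\<not> distinct (List.transpose T)"
  shows "proj m (table_fun T) = 0"
proof -
  have "length (List.transpose T) = m"
    using transpose_in_nlists[OF T d] by (rule nlistsE_length)
  then obtain i j where ij: "i < j" "j < m" and eq: "List.transpose T ! i = List.transpose T ! j"
    using repeated unfolding distinct_conv_nth by (metis linorder_neqE_nat)
  have "T ! k ! i = T ! k ! j" if "k < d" for k
    using arg_cong[OF eq, of "\<lambda>c. c ! k"] ij that by (simp add: transpose_eq_map[OF T d])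
  note exchange = table_fun_permute_transpose[OF T this ij]
  have "table_fun T (permute_list (Transposition.transpose i j) cs) * \<epsilon> = - table_fun T cs"
    if "length cs = m" for cs
  proof -
    have "table_fun T (permute_list (Transposition.transpose i j) cs) * \<epsilon>
        = (\<epsilon> * (- 1) ^ d) * table_fun T cs"
      by (simp only: exchange[OF _ that] mult_ac)
    then show ?thesis by (simp only: sign) simp
  qed
  then show ?thesis by (rule proj_eq_zero_of_exchange[OF ij])
qed

definition table_vector :: "nat list list \<Rightarrow> ('a \<Rightarrow>\<^sub>0 complex)" where
  "table_vector T = scale (of_int (table_sign T) / of_nat (table_norm T))
     (\<Sum>X\<in>tables n (length T) (length (List.transpose T)).
        scale (of_int (table_sgn T X)) (monomial (List.transpose X)))"

lemma table_vector_eq_proj: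
  assumes T: "T \<in> nlists d (nlists m UNIV)" and d: "d \<ge> 1"
  shows "table_vector T
    = scale (of_int (table_sign T) / of_nat (table_norm T)) (proj m (table_fun T))"
proof -
  let ?N = "nlists d (nlists m {1..n})"
  have "(\<Sum>X\<in>?N. scale (of_int (table_sgn T X)) (monomial (List.transpose X)))
      = (\<Sum>X\<in>?N. scale (table_fun T (List.transpose X)) (monomial (List.transpose X)))"
    using T d by (intro sum.cong refl) (simp add: table_sgn_def table_fun_def table_row_transpose)
  also have "\<dots> = proj m (table_fun T)"
    unfolding proj_def idx_eq_nlists by (rule sum.reindex_bij_betw[OF bij_betw_transpose[OF d]])
  finally show ?thesis
    using T nlistsE_length[OF transpose_in_nlists[OF T d]]
    by (simp add: table_vector_def tables_eq_nlists)
qed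

lemma HWV_eq_span_table_vector:
  assumes d: "length lam = d" "d \<ge> 1" and lam: "\<forall>p\<in>set lam. is_partition m p \<and> length p \<le> n"
  shows "HWV n lam W act = cvec.span (table_vector ` tables_A_plus (map conjugate_partition lam))"
    and "\<epsilon> * (- 1) ^ d = - 1 \<Longrightarrow>
      HWV n lam W act = cvec.span (table_vector ` tables_B_plus (map conjugate_partition lam))"
proof -
  let ?A = "tables_A_plus (map conjugate_partition lam)"
  let ?B = "tables_B_plus (map conjugate_partition lam)"
  let ?f = "\<lambda>T. proj m (table_fun T)"
  have T: "T \<in> nlists d (nlists m UNIV)" if "T \<in> ?A" for T
    using tables_A_in_nlists[of T "map conjugate_partition lam" m] that lam d
    by (simp add: tables_A_plus_def is_partition_def sum_list_conjugate_partition)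
  have "B \<subseteq> ?A \<Longrightarrow> table_vector ` B
      = (\<lambda>T. scale (of_int (table_sign T) / of_nat (table_norm T)) (?f T)) ` B" for B
    using table_vector_eq_proj[OF T d(2)] by (intro image_cong) auto
  moreover have "table_sign T \<noteq> 0" "table_norm T \<noteq> 0" for T
    by (induction T) (auto simp: table_sign_def word_sign_def table_norm_def)
  ultimately have span: "B \<subseteq> ?A \<Longrightarrow> cvec.span (table_vector ` B) = cvec.span (?f ` B)" for B
    by (simp add: span_image_scale_nonzero)
  have HWV: "HWV n lam W act = cvec.span (?f ` ?A)"
    by (rule HWV_eq_span_proj_table_fun[OF d lam])
  then show "HWV n lam W act = cvec.span (table_vector ` ?A)" by (simp add: span)
  assume sign: "\<epsilon> * (- 1) ^ d = - 1"
  have B: "?B \<subseteq> ?A" by (auto simp: tables_B_plus_def)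
  have "?f U = 0" if "U \<in> ?A - ?B" for U
    using proj_table_fun_eq_zero[OF sign T d(2)] that
    by (auto simp: tables_B_plus_def tables_B_def tables_A_plus_def)
  then have "?f ` ?A \<subseteq> insert 0 (?f ` ?B)" by blast
  then have "cvec.span (?f ` ?A) = cvec.span (?f ` ?B)"
    using cvec.span_mono[of "?f ` ?A" "insert 0 (?f ` ?B)"]
      cvec.span_mono[OF image_mono[OF B, of ?f]] by auto
  then show "HWV n lam W act = cvec.span (table_vector ` ?B)" using HWV span[OF B] by simp
qed

end

section \<open>The symmetric algebra\<close>

definition list_monomial :: "'a list \<Rightarrow> ('a \<Rightarrow>\<^sub>0 nat)" where
  "list_monomial cs = (\<Sum>c\<leftarrow>cs. Poly_Mapping.single c 1)"

lemma lookup_list_monomial: "poly_mapping.lookup (list_monomial cs) c = count_list cs c"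
  by (induction cs) (auto simp: list_monomial_def lookup_add lookup_single)

lemma keys_list_monomial: "Poly_Mapping.keys (list_monomial cs) = set cs"
  by (auto simp: in_keys_iff lookup_list_monomial count_list_0_iff)

lemma list_monomial_eq_iff: "list_monomial cs = list_monomial cs' \<longleftrightarrow> mset cs = mset cs'"
  by (simp add: poly_mapping_eq_iff fun_eq_iff lookup_list_monomial multiset_eq_iff count_mset)

lemma surj_list_monomial: "\<exists>cs. list_monomial cs = a"
proof -
  have "finite {x. 0 < poly_mapping.lookup a x}"
    using finite_keys[of a] by (simp add: keys.rep_eq)
  then obtain M where M: "count M = poly_mapping.lookup a"
    using count_Abs_multiset[of "poly_mapping.lookup a"] by blast
  obtain cs where "mset cs = M" using ex_mset by blast
  then have "list_monomial cs = a"
    by (intro poly_mapping_eqI) (simp add: lookup_list_monomial M flip: count_mset)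
  then show ?thesis by blast
qed

lemma prod_list_sym_e: "(\<Prod>c\<leftarrow>cs. sym_e c) = Poly_Mapping.single (list_monomial cs) 1"
  by (induction cs) (simp_all add: sym_e_def list_monomial_def mult_single)

lemma scale_mult_left: "scale c p * q = scale c (p * q)" for p q :: sym
  by (simp add: scale_def mult_map_scale_conv_mult mult.assoc)

lemma scale_mult_right: "p * scale c q = scale c (p * q)" for p q :: sym
  using scale_mult_left[of c q p] by (simp add: mult.commute)

lemma prod_list_sym_act_e:
  "(\<Prod>c\<leftarrow>cs. sym_act_e n g c) = (\<Sum>x\<in>nlists (length cs) (idx n (length g)).
     scale (tensor_coeff (act_coeff g) x cs) (\<Prod>c\<leftarrow>x. sym_e c))"
proof (induction cs)
  case (Cons c cs)
  then show ?case
    by (simp add: sum_nlists_Suc sym_act_e_def sum_product scale_mult_left scale_mult_right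
        mult.commute)
qed simp

lemma sym_act_eq_lin_ext:
  "sym_act n g = lin_ext (\<lambda>a. \<Prod>i\<in>Poly_Mapping.keys a. sym_act_e n g i ^ poly_mapping.lookup a i)"
  by (rule ext) (simp add: sym_act_def lin_ext_def)

lemma tensor_quotient_sym: "tensor_quotient n d 1 list_monomial (\<lambda>_. 1) (sym_act n) (sym_space n d)"
proof
  have "Poly_Mapping.keys a \<subseteq> idx n d \<longleftrightarrow> (\<exists>cs. set cs \<subseteq> idx n d \<and> list_monomial cs = a)" for a
    by (metis keys_list_monomial surj_list_monomial)
  then show "sym_space n d = {p. \<forall>a\<in>Poly_Mapping.keys p.
      \<exists>cs. set cs \<subseteq> idx n d \<and> (1::complex) \<noteq> 0 \<and> list_monomial cs = a}"
    by (simp add: sym_space_def)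
  show "sym_act n g (Poly_Mapping.single (list_monomial cs) 1) = (\<Sum>x\<in>nlists (length cs) (idx n d).
      scale (tensor_coeff (act_coeff g) x cs) (Poly_Mapping.single (list_monomial x) 1))"
    if "length g = d" for g cs
  proof -
    have "sym_act n g (Poly_Mapping.single (list_monomial cs) 1) = (\<Prod>c\<leftarrow>cs. sym_act_e n g c)"
      by (simp add: sym_act_eq_lin_ext lin_ext_single keys_list_monomial lookup_list_monomial
          prod_list_eq_prod_count[of cs "set cs"])
    then show ?thesis by (simp add: prod_list_sym_act_e prod_list_sym_e that)
  qed
qed (auto simp: swap_symmetric_def list_monomial_eq_iff sym_act_eq_lin_ext lin_ext_add
    lin_ext_scale)

section \<open>The exterior algebra\<close>

lemma wedge_list_Nil [simp]: "wedge_list [] = ext_one"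
  by (simp add: wedge_list_def)

lemma wedge_list_Cons [simp]: "wedge_list (f # fs) = f \<diamondop> wedge_list fs"
  by (simp add: wedge_list_def)

lemma wedge_list_append: "wedge_list (fs @ gs) = wedge_list fs \<diamondop> wedge_list gs"
  by (induction fs) (simp_all add: wedge_assoc)

lemma scale_minus_one: "scale (- 1) p = - p"
  by simp

lemma swap_symmetric_wedge_list:
  assumes anti: "\<And>i j. f i \<diamondop> f j = - (f j \<diamondop> f i)"
  shows "swap_symmetric (- 1) (\<lambda>cs. poly_mapping.lookup (wedge_list (map f cs)) S)"
proof (rule swap_symmetricI)
  fix xs a b ys
  have "wedge_list (map f (a # b # ys)) = (f a \<diamondop> f b) \<diamondop> wedge_list (map f ys)"
    by (simp add: wedge_assoc)
  also have "\<dots> = scale (- 1) (f b \<diamondop> f a) \<diamondop> wedge_list (map f ys)"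
    by (simp only: anti[of a b] scale_minus_one)
  also have "\<dots> = scale (- 1) (wedge_list (map f (b # a # ys)))"
    by (simp only: wedge_scale_left wedge_assoc wedge_list_Cons list.map)
  finally have "wedge_list (map f (xs @ a # b # ys))
      = scale (- 1) (wedge_list (map f (xs @ b # a # ys)))"
    by (simp only: map_append wedge_list_append wedge_scale_right)
  then show "poly_mapping.lookup (wedge_list (map f (xs @ a # b # ys))) S
      = - 1 * poly_mapping.lookup (wedge_list (map f (xs @ b # a # ys))) S"
    by (simp only: lookup_scale)
qed

text \<open>The sign of the permutation that sorts a list of distinct indices, and \<open>0\<close> on all other
  lists.\<close>

definition sort_sign :: "'a::linorder list \<Rightarrow> complex" where
  "sort_sign cs = poly_mapping.lookup (wedge_list (map ext_e cs)) (fset_of_list cs)"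

lemma wedge_list_ext_e:
  "wedge_list (map ext_e cs) = Poly_Mapping.single (fset_of_list cs) (sort_sign cs)"
proof -
  have "\<exists>c. wedge_list (map ext_e cs) = Poly_Mapping.single (fset_of_list cs) c"
  proof (induction cs)
    case (Cons a cs)
    then obtain c
      where "wedge_list (map ext_e cs) = Poly_Mapping.single (fset_of_list cs) c" by blast
    then have "wedge_list (map ext_e (a # cs)) = scale c (wedge_basis {|a|} (fset_of_list cs))"
      by (simp add: ext_e_def[of a] wedge_single)
    then show ?case
      by (auto simp: wedge_basis_def intro: exI[of _ 0])
  qed (auto simp: ext_one_def)
  then show ?thesis by (auto simp: sort_sign_def)
qed

lemma sort_sign_Nil [simp]: "sort_sign [] = 1"
  by (simp add: sort_sign_def ext_one_def)

lemma sort_sign_Cons: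
  "sort_sign (a # cs)
    = (if a \<in> set cs then 0 else (- 1) ^ shuffle_inv {|a|} (fset_of_list cs) * sort_sign cs)"
proof -
  have "{|a|} |\<inter>| fset_of_list cs = {||} \<longleftrightarrow> a \<notin> set cs"
    by (auto simp: fset_of_list_elem)
  then show ?thesis
    by (simp add: sort_sign_def[of "a # cs"] wedge_list_ext_e ext_e_def wedge_single wedge_basis_def
        mult.commute)
qed

lemma sort_sign_square: "sort_sign cs * sort_sign cs = (if distinct cs then 1 else 0)"
proof (induction cs)
  case (Cons a cs)
  show ?case
  proof (cases "a \<in> set cs")
    case False
    let ?s = "(- 1 :: complex) ^ shuffle_inv {|a|} (fset_of_list cs)"
    have "sort_sign (a # cs) * sort_sign (a # cs) = (?s * ?s) * (sort_sign cs * sort_sign cs)"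
      using False by (simp only: sort_sign_Cons if_False mult_ac)
    also have "?s * ?s = 1" by (simp flip: power_add mult_2)
    finally show ?thesis using False Cons by simp
  qed (simp add: sort_sign_Cons)
qed simp

lemma sort_sign_eq_0_iff: "sort_sign cs = 0 \<longleftrightarrow> \<not> distinct cs"
  using sort_sign_square[of cs] by (auto split: if_splits)

lemma sort_sign_sorted: "sorted cs \<Longrightarrow> distinct cs \<Longrightarrow> sort_sign cs = 1"
proof (induction cs)
  case (Cons a cs)
  then have "{(x, b). x \<in> fset {|a|} \<and> b \<in> fset (fset_of_list cs) \<and> b < x} = {}"
    by (auto simp: fset_of_list.rep_eq not_less[symmetric])
  then have "shuffle_inv {|a|} (fset_of_list cs) = 0" by (simp only: shuffle_inv_def card.empty)
  then show ?case using Cons by (simp add: sort_sign_Cons)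
qed simp

lemma fset_of_list_cong_mset: "mset cs = mset cs' \<Longrightarrow> fset_of_list cs = fset_of_list cs'"
  by (metis fset_inverse fset_of_list.rep_eq mset_eq_setD)

lemma swap_symmetric_sort_sign: "swap_symmetric (- 1) sort_sign"
proof (rule swap_symmetricI)
  fix xs ys :: "'a list" and a b
  have perm: "fset_of_list (xs @ a # b # ys) = fset_of_list (xs @ b # a # ys)"
    by (rule fset_of_list_cong_mset) simp
  show "sort_sign (xs @ a # b # ys) = - 1 * sort_sign (xs @ b # a # ys)"
    unfolding sort_sign_def perm
    by (rule swap_symmetricD[OF swap_symmetric_wedge_list[OF ext_e_anticommute]])
qed

lemma ext_act_e_anticommute:
  "ext_act_e n g i \<diamondop> ext_act_e n g j = - (ext_act_e n g j \<diamondop> ext_act_e n g i)"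
proof -
  let ?I = "idx n (length g)"
  have expand: "ext_act_e n g i \<diamondop> ext_act_e n g j = (\<Sum>a\<in>?I. \<Sum>b\<in>?I.
      scale (act_coeff g a i * act_coeff g b j) (ext_e a \<diamondop> ext_e b))" for i j
    unfolding ext_act_e_def wedge_sum_left
    by (simp add: wedge_sum_right wedge_scale_left wedge_scale_right cvec.scale_sum_right
        mult.commute)
  have "ext_act_e n g i \<diamondop> ext_act_e n g j = (\<Sum>a\<in>?I. \<Sum>b\<in>?I.
      - scale (act_coeff g b j * act_coeff g a i) (ext_e b \<diamondop> ext_e a))"
    unfolding expand
  proof (intro sum.cong refl)
    fix a b
    show "scale (act_coeff g a i * act_coeff g b j) (ext_e a \<diamondop> ext_e b)
        = - scale (act_coeff g b j * act_coeff g a i) (ext_e b \<diamondop> ext_e a)"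
      unfolding ext_e_anticommute[of a b] by (simp add: mult.commute)
  qed
  also have "\<dots> = - (ext_act_e n g j \<diamondop> ext_act_e n g i)"
    unfolding expand by (subst sum.swap) (simp only: sum_negf)
  finally show ?thesis .
qed

lemma wedge_list_ext_act_e:
  "wedge_list (map (ext_act_e n g) cs) = (\<Sum>x\<in>nlists (length cs) (idx n (length g)).
     scale (tensor_coeff (act_coeff g) x cs) (wedge_list (map ext_e x)))"
proof (induction cs)
  case (Cons c cs)
  show ?case
    unfolding list.map wedge_list_Cons Cons ext_act_e_def[of n g c] wedge_sum_left
    by (simp add: sum_nlists_Suc wedge_sum_right wedge_scale_left wedge_scale_right
        cvec.scale_sum_right mult.commute)
qed simp

lemma scale_sort_sign_wedge_list:
  assumes anti: "\<And>i j. f i \<diamondop> f j = - (f j \<diamondop> f i)"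
  shows "scale (sort_sign cs) (wedge_list (map f (sorted_list_of_fset (fset_of_list cs))))
    = wedge_list (map f cs)"
proof (rule poly_mapping_eqI)
  fix S
  let ?F = "\<lambda>cs. poly_mapping.lookup (wedge_list (map f cs)) S"
  let ?z = "sorted_list_of_fset (fset_of_list cs)"
  have F: "swap_symmetric (- 1) ?F" by (rule swap_symmetric_wedge_list[OF anti])
  show "poly_mapping.lookup (scale (sort_sign cs) (wedge_list (map f ?z))) S = ?F cs"
  proof (cases "distinct cs")
    case True
    have z: "sorted ?z" "distinct ?z" "set ?z = set cs"
      by (simp_all add: sorted_list_of_fset.rep_eq fset_of_list.rep_eq)
    then have "mset cs = mset ?z" using True by (simp flip: set_eq_iff_mset_eq_distinct)
    from swap_symmetric_common_sign[OF F swap_symmetric_sort_sign _ this]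
    obtain e where "?F cs = e * ?F ?z" "sort_sign cs = e * sort_sign ?z" by auto
    then show ?thesis using sort_sign_sorted[OF z(1,2)] by (simp add: lookup_scale)
  next
    case False
    then have "sort_sign cs = 0" by (simp add: sort_sign_eq_0_iff)
    moreover have "?F cs = 0" by (rule swap_symmetric_not_distinct[OF F False])
    ultimately show ?thesis by (simp add: lookup_scale)
  qed
qed

lemma ext_act_eq_lin_ext:
  "ext_act n g = lin_ext (\<lambda>S. wedge_list (map (ext_act_e n g) (sorted_list_of_fset S)))"
  by (rule ext) (simp add: ext_act_def lin_ext_def)

lemma fset_subset_iff_sort_sign:
  "fset S \<subseteq> I \<longleftrightarrow> (\<exists>cs. set cs \<subseteq> I \<and> sort_sign cs \<noteq> 0 \<and> fset_of_list cs = S)"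
proof
  assume "fset S \<subseteq> I"
  then show "\<exists>cs. set cs \<subseteq> I \<and> sort_sign cs \<noteq> 0 \<and> fset_of_list cs = S"
    by (intro exI[of _ "sorted_list_of_fset S"])
      (simp add: sort_sign_eq_0_iff sorted_list_of_fset.rep_eq fset_inject[symmetric]
        fset_of_list.rep_eq)
qed (auto simp: fset_of_list.rep_eq)

lemma tensor_quotient_ext:
  "tensor_quotient n d (- 1) fset_of_list sort_sign (ext_act n) (ext_space n d)"
proof
  show "sort_sign cs * sort_sign cs = 1" if "sort_sign cs \<noteq> 0" for cs :: "nat list list"
    using that by (simp add: sort_sign_square sort_sign_eq_0_iff)
  show "fset_of_list cs = fset_of_list cs'" if "mset cs = mset cs'" for cs cs' :: "nat list list"
    using that by (rule fset_of_list_cong_mset)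
  show "mset cs = mset cs'"
    if "fset_of_list cs = fset_of_list cs'" "sort_sign cs \<noteq> 0" "sort_sign cs' \<noteq> 0"
    for cs cs' :: "nat list list"
    using that unfolding sort_sign_eq_0_iff
    by (metis fset_of_list.rep_eq set_eq_iff_mset_eq_distinct)
  show "ext_space n d = {p. \<forall>a\<in>Poly_Mapping.keys p.
      \<exists>cs. set cs \<subseteq> idx n d \<and> sort_sign cs \<noteq> 0 \<and> fset_of_list cs = a}"
    by (simp only: ext_space_def fset_subset_iff_sort_sign)
  show "ext_act n g (Poly_Mapping.single (fset_of_list cs) (sort_sign cs))
      = (\<Sum>x\<in>nlists (length cs) (idx n d).
        scale (tensor_coeff (act_coeff g) x cs)
          (Poly_Mapping.single (fset_of_list x) (sort_sign x)))"
    if "length g = d" for g cs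
  proof -
    have "ext_act n g (Poly_Mapping.single (fset_of_list cs) (sort_sign cs))
        = wedge_list (map (ext_act_e n g) cs)"
      unfolding ext_act_eq_lin_ext lin_ext_single
      by (rule scale_sort_sign_wedge_list[OF ext_act_e_anticommute])
    then show ?thesis by (simp only: wedge_list_ext_act_e wedge_list_ext_e that)
  qed
qed (simp_all add: swap_symmetric_sort_sign sort_sign_eq_0_iff ext_act_eq_lin_ext lin_ext_add
    lin_ext_scale)

theorem mainTheorem4:
  fixes n d m :: nat and lam :: "nat list list"
  assumes "d \<ge> 1"
    and "length lam = d"
    and "\<forall>p\<in>set lam. is_partition m p \<and> length p \<le> n"
  shows "(odd d \<longrightarrow>
            HWV_sym n lam
              = cvec.span {Delta n T | T. T \<in> tables_B_plus (map conjugate_partition lam)} \<and>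
            HWV_ext n lam
              = cvec.span {Nabla n S | S. S \<in> tables_A_plus (map conjugate_partition lam)}) \<and>
         (even d \<longrightarrow>
            HWV_sym n lam
              = cvec.span {Delta n T | T. T \<in> tables_A_plus (map conjugate_partition lam)} \<and>
            HWV_ext n lam
              = cvec.span {Nabla n S | S. S \<in> tables_B_plus (map conjugate_partition lam)})"
proof -
  interpret sym: tensor_quotient n d 1 list_monomial "\<lambda>_. 1" "sym_act n" "sym_space n d"
    by (rule tensor_quotient_sym)
  interpret ext: tensor_quotient n d "- 1" fset_of_list sort_sign "ext_act n" "ext_space n d"
    by (rule tensor_quotient_ext)
  have Delta: "Delta n = sym.table_vector"
    by (simp add: fun_eq_iff Delta_def sym.table_vector_def sym_monom_def sym.monomial_def
        prod_list_sym_e)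
  have Nabla: "Nabla n = ext.table_vector"
    by (simp add: fun_eq_iff Nabla_def ext.table_vector_def ext_monom_def ext.monomial_def
        wedge_list_ext_e)
  note sym = sym.HWV_eq_span_table_vector[OF assms(2,1,3)]
  note ext = ext.HWV_eq_span_table_vector[OF assms(2,1,3)]
  show ?thesis
    unfolding HWV_sym_def HWV_ext_def assms(2) Delta Nabla Setcompr_eq_image
    by (intro conjI impI sym(1) ext(1) sym(2) ext(2)) simp_all
qed

end
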